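(* The following continuous embeddings hold: (1) $H^2(T_{\Lambda_3})\hookrightarrow A^p_{\frac{3p}4-\frac32}(T_{\Lambda_3})$ for all $\frac83<p<4$; (2) $H^2(T_{\Lambda_4})\hookrightarrow A^p_{p-2}(T_{\Lambda_4})$ for all $3<p<4$; (3) $H^2(T_{\Lambda_5})\hookrightarrow A^p_{\frac{5p}4-\frac52}(T_{\Lambda_5})$ for all $\frac{16}5<p<4$; (4) $H^2(T_{\Lambda_6})\hookrightarrow A^p_{\frac{3p}2-3}(T_{\Lambda_6})$ for all $\frac{10}3<p<4$.
   Context: For $n\ge3$, $\Lambda_n=\{y=(y_1,\dots,y_n)\in\mathbb R^n: y_1^2-y_2^2-\cdots-y_n^2>0,\ y_1>0\}$ is the Lorentz cone (a symmetric cone of rank $r=2$), with determinant function $\Delta(y)=y_1^2-y_2^2-\cdots-y_n^2$. $T_{\Lambda_n}=\mathbb R^n+i\Lambda_n\subset\mathbb C^n$. $H^2(T_{\Lambda_n})$ is the space of holomorphic $f$ on $T_{\Lambda_n}$ with $\|f\|_{H^2}=\left(\sup_{t\in\Lambda_n}\int_{\mathbb R^n}|f(x+it)|^2dx\right)^{1/2}<\infty$. For $0<p<\infty$ and $\nu\in\mathbb R$, $A^p_\nu(T_{\Lambda_n})$ is the space of holomorphic $f$ on $T_{\Lambda_n}$ with $\|f\|_{p,\nu}=\left(\int_{T_{\Lambda_n}}|f(x+iy)|^p\Delta^{\nu-\frac n2}(y)\,dx\,dy\right)^{1/p}<\infty$. $X\hookrightarrow Y$ means there is $C>0$ with $\|f\|_Y\le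 C\|f\|_X$ for all $f\in X$. *)

theory Defs
  imports "HOL-Analysis.Analysis"
begin

text \<open>
  The space \<open>\<real>\<^sup>n\<close> is \<open>real ^ 'n\<close>, where \<open>n = CARD('n)\<close>. The class \<open>one\<close> supplies the
  distinguished index \<open>1\<close> of the time-like coordinate; the numeral types \<open>3\<close>, \<open>4\<close>, \<dots> are
  instances, and their elements other than \<open>1\<close> index the remaining coordinates.
\<close>

definition lorentz_det :: "real ^ 'n::{finite,one} \<Rightarrow> real" where
  "lorentz_det y = (y $ 1)\<^sup>2 - (\<Sum>i \<in> UNIV - {1}. (y $ i)\<^sup>2)"

definition lorentz_cone :: "(real ^ 'n::{finite,one}) set" where
  "lorentz_cone = {y. lorentz_det y > 0 \<and> y $ 1 > 0}"

definition re_im_vec :: "real ^ 'n \<Rightarrow> real ^ 'n \<Rightarrow> complex ^ 'n" where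
  "re_im_vec x y = (\<chi> i. Complex (x $ i) (y $ i))"

definition tube_domain :: "(complex ^ 'n::{finite,one}) set" where
  "tube_domain = {re_im_vec x y | x y. y \<in> lorentz_cone}"

text \<open>
  The library's \<open>holomorphic_on\<close> covers one complex variable only. In several variables a function
  is holomorphic on an open set if at each point it has a real Frechet derivative which is
  complex linear.
\<close>

definition holomorphic_vec_on :: "(complex ^ 'n \<Rightarrow> complex) \<Rightarrow> (complex ^ 'n) set \<Rightarrow> bool" where
  "holomorphic_vec_on f S \<longleftrightarrow>
     (\<forall>z\<in>S. \<exists>D. (f has_derivative D) (at z) \<and> (\<forall>c v. D (c *s v) = c * D v))"

text \<open>
  The integrals below take values in \<open>[0,\<infinity>]\<close>, so that finiteness is an explicit condition of
  membership; the norms are real valued and meaningful on the respective spaces. Functions are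
  total, but only their values on the tube domain matter.
\<close>

definition hardy2_integral :: "(complex ^ 'n::{finite,one} \<Rightarrow> complex) \<Rightarrow> ennreal" where
  "hardy2_integral f =
     (SUP t \<in> lorentz_cone. \<integral>\<^sup>+ x. ennreal ((cmod (f (re_im_vec x t)))\<^sup>2) \<partial>lborel)"

definition hardy2_norm :: "(complex ^ 'n::{finite,one} \<Rightarrow> complex) \<Rightarrow> real" where
  "hardy2_norm f = sqrt (enn2real (hardy2_integral f))"

definition hardy2_space :: "(complex ^ 'n::{finite,one} \<Rightarrow> complex) set" where
  "hardy2_space = {f. holomorphic_vec_on f tube_domain \<and> hardy2_integral f < \<infinity>}"

definition bergman_integral ::
    "real \<Rightarrow> real \<Rightarrow> (complex ^ 'n::{finite,one} \<Rightarrow> complex) \<Rightarrow> ennreal" where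
  "bergman_integral p \<nu> f =
     (\<integral>\<^sup>+ (x, y) \<in> UNIV \<times> lorentz_cone.
        ennreal (cmod (f (re_im_vec x y)) powr p * lorentz_det y powr (\<nu> - real CARD('n) / 2))
      \<partial>(lborel \<Otimes>\<^sub>M lborel))"

definition bergman_norm ::
    "real \<Rightarrow> real \<Rightarrow> (complex ^ 'n::{finite,one} \<Rightarrow> complex) \<Rightarrow> real" where
  "bergman_norm p \<nu> f = enn2real (bergman_integral p \<nu> f) powr (1 / p)"

definition bergman_space ::
    "real \<Rightarrow> real \<Rightarrow> (complex ^ 'n::{finite,one} \<Rightarrow> complex) set" where
  "bergman_space p \<nu> = {f. holomorphic_vec_on f tube_domain \<and> bergman_integral p \<nu> f < \<infinity>}"

definition continuously_embedded ::
    "'f set \<Rightarrow> ('f \<Rightarrow> real) \<Rightarrow> 'f set \<Rightarrow> ('f \<Rightarrow> real) \<Rightarrow> bool" where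
  "continuously_embedded X normX Y normY \<longleftrightarrow>
     X \<subseteq> Y \<and> (\<exists>C>0. \<forall>f\<in>X. normY f \<le> C * normX f)"

end

theory Submission
  imports Defs "HOL-Complex_Analysis.Cauchy_Integral_Formula"
begin

text \<open>
  Write \<open>\<Delta>\<close> for \<^const>\<open>lorentz_det\<close>, \<open>e\<close> for the first unit vector, \<open>d\<mu> = \<Delta>(y)\<^bsup>-n\<^esup> dx dy\<close> for the measure on the tube
  that is invariant under its automorphisms, and \<open>F = \<Delta>\<^bsup>n/4\<^esup> \<bar>f\<bar>\<close>. For \<open>\<nu> = n p / 4 - n / 2\<close> the Bergman integral of
  \<open>f\<close> is \<open>\<integral> F\<^sup>p d\<mu>\<close>. So the claim is that multiplication by \<open>\<Delta>\<^bsup>n/4\<^esup>\<close> maps \<open>H\<^sup>2\<close> boundedly into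
  \<open>L\<^sup>p(\<mu>)\<close>. It is proved for all \<open>n \<ge> 2\<close> and \<open>p > 4 (n - 1) / n\<close>; the four parts of the theorem are \<open>n = 3, 4, 5, 6\<close>.

  The idea is the \<open>T T\<^sup>*\<close> method. By the Szego formula (\<open>szego_formula\<close>) the value \<open>f(z)\<close> is a multiple of the inner
  product of the boundary function with \<open>S\<^sub>z(u) = \<Delta>((u - z\<^sup>*) / i)\<^bsup>-n/2\<^esup>\<close>, where \<open>z\<^sup>*\<close> is the complex conjugate,
  and the inner products of these kernels are again values of the kernel (\<open>szego_kernel_reproducing\<close>). Thus
  \<open>T T\<^sup>*\<close> is dominated by the positive kernel
  \<open>\<kappa>(z, w) = \<Delta>(y)\<^bsup>n/4\<^esup> \<Delta>(v)\<^bsup>n/4\<^esup> \<bar>\<Delta>(z - w\<^sup>*)\<bar>\<^bsup>-n/2\<^esup>\<close>, with \<open>y\<close> and \<open>v\<close> the imaginary parts of \<open>z\<close> and \<open>w\<close>.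
  It has to map \<open>L\<^bsup>p'\<^esup>(\<mu>)\<close> to \<open>L\<^sup>p(\<mu>)\<close>, and by an elementary pointwise interpolation (\<open>interpolation_inequality\<close>) it does
  so as soon as \<open>\<kappa>\<^bsup>p/2\<^esup>\<close> is bounded on \<open>L\<^sup>2(\<mu>)\<close>. This is a Schur test: the function
  \<open>(y\<^sub>1 + y\<^sub>k)\<^bsup>-(n-2)/2\<^esup> \<Delta>(y)\<^bsup>(n-1)/2\<^esup>\<close> is an eigenfunction of \<open>\<kappa>\<^bsup>p/2\<^esup>\<close> (\<open>schur_test_integral\<close>), and the integrals that
  express this converge exactly when \<open>n p / 4 > n - 1\<close>.

  The Szego formula is obtained without Fourier analysis. In the coordinates \<open>l, m = x\<^sub>1 \<plusminus> \<bar>x'\<bar>\<close> one has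
  \<open>\<Delta>(x + i e) = (l + i)(m + i)\<close>, and for \<open>l = tan \<phi>\<close>, \<open>m = tan \<psi>\<close> the Poisson density \<open>\<bar>\<Delta>(x + i e)\<bar>\<^bsup>-n\<^esup> dx\<close>
  becomes \<open>\<bar>sin (\<phi> - \<psi>)\<bar>\<^bsup>n-2\<^esup> d\<phi> d\<psi>\<close> (\<open>nn_integral_circle_fibration\<close>). For a fixed difference of the angles, the
  points form the boundary of a holomorphic disc in the tube centred at \<open>i e\<close>, so the mean value property of
  holomorphic functions of one variable gives the Poisson formula at \<open>i e\<close> (\<open>poisson_formula\<close>). Multiplying the
  function by \<open>\<Delta>\<^bsup>n/2\<^esup>\<close> turns the Poisson kernel into the Szego kernel, and affine automorphisms move \<open>i e\<close> to
  any other point. These formulas need bounded functions; \<open>f(z + i \<epsilon> e)\<close> is bounded for \<open>f\<close> in \<open>H\<^sup>2\<close> by the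
  sub-mean-value property on balls (\<open>hardy2_bounded_above_height\<close>), and \<open>\<epsilon> \<rightarrow> 0\<close> at the end.
\<close>

section \<open>The Lorentz form and the cone\<close>

definition lorentz_form :: "'a::comm_ring_1 ^ 'n::{finite,one} \<Rightarrow> 'a ^ 'n::{finite,one} \<Rightarrow> 'a" where
  "lorentz_form u v = u $ 1 * v $ 1 - (\<Sum>i \<in> UNIV - {1}. u $ i * v $ i)"

text \<open>
  The base point \<open>e\<close> of the cone, which is also the unit of the Jordan algebra structure of
  Minkowski space.
\<close>

definition time_axis :: "real ^ 'n::{finite,one}" where
  "time_axis = axis 1 1"

lemma time_axis_nth [simp]: "time_axis $ i = (if i = 1 then 1 else 0)"
  by (auto simp: time_axis_def axis_def)

lemma lorentz_det_eq_form: "lorentz_det y = lorentz_form y y"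
  by (simp add: lorentz_det_def lorentz_form_def power2_eq_square)

lemma lorentz_form_commute: "lorentz_form u v = lorentz_form v u"
  by (simp add: lorentz_form_def mult.commute)

lemma lorentz_form_add_left: "lorentz_form (u + u') v = lorentz_form u v + lorentz_form u' v"
  by (simp add: lorentz_form_def algebra_simps sum.distrib)

lemma lorentz_form_add_right: "lorentz_form v (u + u') = lorentz_form v u + lorentz_form v u'"
  by (simp add: lorentz_form_def algebra_simps sum.distrib)

lemma lorentz_form_diff_left: "lorentz_form (u - u') v = lorentz_form u v - lorentz_form u' v"
  by (simp add: lorentz_form_def algebra_simps sum_subtractf)

lemma lorentz_form_diff_right: "lorentz_form v (u - u') = lorentz_form v u - lorentz_form v u'"
  by (simp add: lorentz_form_def algebra_simps sum_subtractf)

lemma lorentz_form_scaleR_left: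
  fixes u :: "real ^ 'n::{finite,one}"
  shows "lorentz_form (c *\<^sub>R u) v = c * lorentz_form u v"
  by (simp add: lorentz_form_def algebra_simps sum_distrib_left)

lemma lorentz_form_scaleR_right:
  fixes u :: "real ^ 'n::{finite,one}"
  shows "lorentz_form v (c *\<^sub>R u) = c * lorentz_form v u"
  by (simp add: lorentz_form_def algebra_simps sum_distrib_left)

lemmas lorentz_form_bilinear =
  lorentz_form_add_left lorentz_form_add_right lorentz_form_diff_left lorentz_form_diff_right
  lorentz_form_scaleR_left lorentz_form_scaleR_right

lemma lorentz_form_time_axis [simp]:
  "lorentz_form u time_axis = u $ 1" "lorentz_form time_axis u = u $ 1"
  by (simp_all add: lorentz_form_def)

lemma lorentz_det_time_axis [simp]: "lorentz_det time_axis = 1"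
  by (simp add: lorentz_det_eq_form)

lemma lorentz_det_scaleR: "lorentz_det (c *\<^sub>R y) = c\<^sup>2 * lorentz_det y"
  by (simp add: lorentz_det_eq_form lorentz_form_bilinear power2_eq_square)

lemma lorentz_det_add:
  "lorentz_det (u + v) = lorentz_det u + 2 * lorentz_form u v + lorentz_det v"
  by (simp add: lorentz_det_eq_form lorentz_form_bilinear lorentz_form_commute[of v u])

definition spatial_norm :: "real ^ 'n::{finite,one} \<Rightarrow> real" where
  "spatial_norm u = L2_set (($) u) (UNIV - {1})"

lemma spatial_norm_nonneg [simp]: "0 \<le> spatial_norm u"
  by (simp add: spatial_norm_def)

lemma spatial_norm_sq: "(spatial_norm u)\<^sup>2 = (\<Sum>i \<in> UNIV - {1}. (u $ i)\<^sup>2)"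
  by (simp add: spatial_norm_def L2_set_def sum_nonneg)

lemma lorentz_det_spatial_norm: "lorentz_det y = (y $ 1)\<^sup>2 - (spatial_norm y)\<^sup>2"
  by (simp add: spatial_norm_sq lorentz_det_def)

lemma lorentz_cone_iff: "y \<in> lorentz_cone \<longleftrightarrow> spatial_norm y < y $ 1"
proof
  assume "y \<in> lorentz_cone"
  then have "(spatial_norm y)\<^sup>2 < (y $ 1)\<^sup>2" "0 < y $ 1"
    by (auto simp: lorentz_cone_def lorentz_det_spatial_norm)
  then show "spatial_norm y < y $ 1"
    by (meson less_eq_real_def power2_less_imp_less)
next
  assume *: "spatial_norm y < y $ 1"
  then have "0 < y $ 1" "(spatial_norm y)\<^sup>2 < (y $ 1)\<^sup>2"
    using spatial_norm_nonneg[of y] by (auto intro: power_strict_mono simp del: spatial_norm_nonneg)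
  then show "y \<in> lorentz_cone"
    by (auto simp: lorentz_cone_def lorentz_det_spatial_norm)
qed

lemma lorentz_form_pos:
  assumes "u \<in> lorentz_cone" "v \<in> lorentz_cone"
  shows "0 < lorentz_form u v"
proof -
  have "(\<Sum>i\<in>UNIV - {1}. u $ i * v $ i) \<le> (\<Sum>i\<in>UNIV - {1}. \<bar>u $ i\<bar> * \<bar>v $ i\<bar>)"
    by (intro sum_mono) (metis abs_ge_self abs_mult)
  also have "\<dots> \<le> spatial_norm u * spatial_norm v"
    unfolding spatial_norm_def by (rule L2_set_mult_ineq)
  also have "\<dots> < u $ 1 * v $ 1"
    using assms by (intro mult_strict_mono') (auto simp: lorentz_cone_iff)
  finally show ?thesis by (simp add: lorentz_form_def)
qed

lemma time_axis_in_cone [simp]: "time_axis \<in> lorentz_cone"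
  by (simp add: lorentz_cone_def)

lemma lorentz_coneD: "y \<in> lorentz_cone \<Longrightarrow> 0 < lorentz_det y" "y \<in> lorentz_cone \<Longrightarrow> 0 < y $ 1"
  by (auto simp: lorentz_cone_def)

lemma lorentz_cone_add:
  assumes "u \<in> lorentz_cone" "v \<in> lorentz_cone"
  shows "u + v \<in> lorentz_cone"
  using assms lorentz_form_pos[OF assms]
  by (auto simp: lorentz_cone_def lorentz_det_add)

lemma lorentz_cone_scaleR: "y \<in> lorentz_cone \<Longrightarrow> 0 < c \<Longrightarrow> c *\<^sub>R y \<in> lorentz_cone"
  by (auto simp: lorentz_cone_def lorentz_det_scaleR)

lemma lorentz_det_add_ge:
  assumes "u \<in> lorentz_cone" "v \<in> lorentz_cone"
  shows "lorentz_det u \<le> lorentz_det (u + v)"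
  using lorentz_form_pos[OF assms] lorentz_coneD(1)[OF assms(2)] by (simp add: lorentz_det_add)

lemma continuous_on_lorentz_det [continuous_intros]:
  "continuous_on S g \<Longrightarrow> continuous_on S (\<lambda>x. lorentz_det (g x))"
  unfolding lorentz_det_def by (intro continuous_intros)

lemma lorentz_det_measurable [measurable]: "lorentz_det \<in> borel_measurable borel"
  by (intro borel_measurable_continuous_onI continuous_intros)

lemma continuous_on_lorentz_form [continuous_intros]:
  fixes g h :: "'b::topological_space \<Rightarrow> 'a::real_normed_field ^ 'n::{finite,one}"
  shows "continuous_on S g \<Longrightarrow> continuous_on S h \<Longrightarrow> continuous_on S (\<lambda>x. lorentz_form (g x) (h x))"
  unfolding lorentz_form_def by (intro continuous_intros)

lemma open_lorentz_cone: "open (lorentz_cone :: (real ^ 'n::{finite,one}) set)"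
proof -
  have "open {y :: (real, 'n) vec. 0 < lorentz_det y}" "open {y :: (real, 'n) vec. 0 < y $ 1}"
    by (auto intro!: open_Collect_less continuous_intros)
  then show ?thesis
    unfolding lorentz_cone_def by (simp add: Collect_conj_eq open_Int)
qed

lemma lorentz_cone_borel [measurable]: "lorentz_cone \<in> sets borel"
  by (simp add: open_lorentz_cone)

section \<open>Lorentz transformations moving the base point\<close>

text \<open>
  The Lorentz transformation taking the base point \<open>e\<close> to \<open>y\<close> up to the scale \<open>\<rho> = \<surd>\<Delta>(y)\<close>: up to sign
  it is \<open>\<rho>\<close> times the reflection of Minkowski space that fixes the line of \<open>w = y + \<rho> e\<close>, which is where
  \<open>\<Delta>(w) = 2 \<rho> (\<rho> + y\<^sub>1)\<close> enters. It is used to move statements about the base point to an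
  arbitrary point of the cone.
\<close>

definition conformal_map :: "real ^ 'n::{finite,one} \<Rightarrow> real ^ 'n::{finite,one} \<Rightarrow> real ^ 'n::{finite,one}" where
  "conformal_map y u =
     (let \<rho> = sqrt (lorentz_det y); w = y + \<rho> *\<^sub>R time_axis
      in (lorentz_form u w / (\<rho> + y $ 1)) *\<^sub>R w - \<rho> *\<^sub>R u)"

lemma linear_conformal_map: "linear (conformal_map y)"
  by (rule linearI)
    (simp_all add: conformal_map_def Let_def lorentz_form_bilinear algebra_simps add_divide_distrib)

context
  fixes y :: "real ^ 'n::{finite,one}"
  assumes y: "y \<in> lorentz_cone"
begin

lemma conformal_map_time_axis: "conformal_map y time_axis = y"
proof -
  have "sqrt (lorentz_det y) + y $ 1 \<noteq> 0"
    using lorentz_coneD[OF y] by (smt (verit) real_sqrt_gt_zero)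
  then show ?thesis
    by (simp add: conformal_map_def Let_def algebra_simps)
qed

lemma lorentz_form_conformal_map:
  "lorentz_form (conformal_map y u) v = lorentz_form u (conformal_map y v)"
  unfolding conformal_map_def Let_def lorentz_form_diff_left lorentz_form_diff_right
    lorentz_form_scaleR_left lorentz_form_scaleR_right
  by (simp add: lorentz_form_commute mult.commute)

text \<open>
  A multiple of a reflection squares to a scalar. This is what replaces a determinant computation in
  the change of variables below.
\<close>

lemma conformal_map_twice: "conformal_map y (conformal_map y u) = lorentz_det y *\<^sub>R u"
proof -
  define \<rho> where "\<rho> = sqrt (lorentz_det y)"
  define w where "w = y + \<rho> *\<^sub>R time_axis"
  define c where "c = \<rho> + y $ 1"
  have \<rho>: "\<rho>\<^sup>2 = lorentz_det y" "0 < \<rho>"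
    using lorentz_coneD[OF y] by (auto simp: \<rho>_def)
  have c: "c > 0" using \<rho> lorentz_coneD[OF y] by (simp add: c_def)
  have ww: "lorentz_form w w = 2 * \<rho> * c"
    using \<rho>(1) by (simp add: w_def c_def lorentz_form_bilinear lorentz_det_eq_form power2_eq_square algebra_simps)
  have A: "conformal_map y v = (lorentz_form v w / c) *\<^sub>R w - \<rho> *\<^sub>R v" for v
    by (simp add: conformal_map_def Let_def \<rho>_def w_def c_def)
  have "lorentz_form (conformal_map y u) w = \<rho> * lorentz_form u w"
    using c by (simp add: A lorentz_form_bilinear ww field_simps)
  then have "conformal_map y (conformal_map y u) = \<rho>\<^sup>2 *\<^sub>R u"
    by (subst A) (simp add: A[of u] algebra_simps power2_eq_square)
  then show ?thesis by (simp add: \<rho>)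
qed

lemma lorentz_form_conformal_map_both:
  "lorentz_form (conformal_map y u) (conformal_map y v) = lorentz_det y * lorentz_form u v"
  by (simp add: lorentz_form_conformal_map conformal_map_twice lorentz_form_bilinear)

lemma lorentz_det_conformal_map: "lorentz_det (conformal_map y u) = lorentz_det y * lorentz_det u"
  by (simp add: lorentz_det_eq_form lorentz_form_conformal_map_both)

lemma conformal_map_in_cone:
  assumes "u \<in> lorentz_cone"
  shows "conformal_map y u \<in> lorentz_cone"
proof -
  have "conformal_map y u $ 1 = lorentz_form (conformal_map y u) time_axis" by simp
  also have "\<dots> = lorentz_form u y" by (simp only: lorentz_form_conformal_map conformal_map_time_axis)
  also have "\<dots> > 0" by (rule lorentz_form_pos[OF assms y])
  finally show ?thesis
    using lorentz_coneD(1)[OF y] lorentz_coneD(1)[OF assms]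
    by (simp add: lorentz_cone_def lorentz_det_conformal_map)
qed

end

text \<open>
  For \<open>y = e\<close> the inequality reads \<open>\<Delta>(x) \<le> x\<^sub>1\<^sup>2\<close>; the conformal map carries it to every \<open>y\<close>.
\<close>

lemma reverse_Cauchy_Schwarz:
  assumes y: "y \<in> lorentz_cone"
  shows "lorentz_det x * lorentz_det y \<le> (lorentz_form x y)\<^sup>2"
proof -
  have "lorentz_det (conformal_map y x) \<le> (conformal_map y x $ 1)\<^sup>2"
    by (simp add: lorentz_det_spatial_norm)
  also have "conformal_map y x $ 1 = lorentz_form (conformal_map y x) time_axis" by simp
  also have "\<dots> = lorentz_form x y"
    by (simp only: lorentz_form_conformal_map[OF y] conformal_map_time_axis[OF y])
  finally show ?thesis by (simp add: lorentz_det_conformal_map[OF y] mult.commute)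
qed

section \<open>The determinant on the tube\<close>

text \<open>
  The value \<open>\<Delta>(z / i)\<close> of the complexified determinant. The division by \<open>i\<close> turns the tube into the right
  tube \<open>\<Lambda> + i \<real>\<^sup>n\<close>, on which \<open>\<Delta>\<close> avoids the negative half-line, so principal powers are available.
\<close>

definition tube_det :: "complex ^ 'n::{finite,one} \<Rightarrow> complex" where
  "tube_det z = - lorentz_form z z"

lemma tube_det_re_im:
  "tube_det (re_im_vec x y) = Complex (lorentz_det y - lorentz_det x) (- 2 * lorentz_form x y)"
proof -
  have "lorentz_form (re_im_vec x y) (re_im_vec x y) = Complex (lorentz_det x - lorentz_det y) (2 * lorentz_form x y)"
    unfolding complex_eq_iff
    by (simp add: lorentz_form_def re_im_vec_def lorentz_det_def power2_eq_square sum_subtractf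
        sum.distrib sum_distrib_left algebra_simps)
  then show ?thesis by (simp add: tube_det_def complex_eq_iff)
qed

text \<open>
  Since \<open>\<bar>\<Delta>(x + i y)\<bar>\<^sup>2 = (\<Delta>(y) - \<Delta>(x))\<^sup>2 + 4 B(x, y)\<^sup>2\<close>, the reverse Cauchy-Schwarz inequality bounds this
  below by \<open>(\<Delta>(y) + \<Delta>(x))\<^sup>2\<close>, which suffices when \<open>\<Delta>(x) \<ge> 0\<close>; otherwise the first square suffices.
\<close>

lemma norm_tube_det_ge:
  assumes y: "y \<in> lorentz_cone"
  shows "lorentz_det y \<le> cmod (tube_det (re_im_vec x y))"
proof -
  have "(lorentz_det y)\<^sup>2 \<le> (lorentz_det y - lorentz_det x)\<^sup>2 + 4 * (lorentz_form x y)\<^sup>2"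
  proof (cases "lorentz_det x \<ge> 0")
    case True
    have "(lorentz_det y)\<^sup>2 \<le> (lorentz_det y + lorentz_det x)\<^sup>2"
      using True lorentz_coneD[OF y] by (intro power_mono) auto
    also have "\<dots> = (lorentz_det y - lorentz_det x)\<^sup>2 + 4 * (lorentz_det x * lorentz_det y)"
      by (simp add: power2_eq_square algebra_simps)
    finally show ?thesis using reverse_Cauchy_Schwarz[OF y, of x] by simp
  next
    case False
    have "(lorentz_det y)\<^sup>2 \<le> (lorentz_det y - lorentz_det x)\<^sup>2"
      using False lorentz_coneD[OF y] by (intro power_mono) auto
    then show ?thesis by (smt (verit) zero_le_power2)
  qed
  then have "(lorentz_det y)\<^sup>2 \<le> (cmod (tube_det (re_im_vec x y)))\<^sup>2"
    by (simp add: tube_det_re_im cmod_power2 power_mult_distrib)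
  then show ?thesis by (rule power2_le_imp_le) simp
qed

text \<open>
  A non-positive real value would force \<open>B(x, y) = 0\<close> with \<open>\<Delta>(x) \<ge> \<Delta>(y) > 0\<close>: two orthogonal timelike
  vectors, which do not exist.
\<close>

lemma tube_det_not_nonpos_Reals:
  assumes y: "y \<in> lorentz_cone"
  shows "tube_det (re_im_vec x y) \<notin> \<real>\<^sub>\<le>\<^sub>0"
proof
  assume "tube_det (re_im_vec x y) \<in> \<real>\<^sub>\<le>\<^sub>0"
  then have *: "lorentz_det y \<le> lorentz_det x" "lorentz_form x y = 0"
    by (auto simp: tube_det_re_im complex_nonpos_Reals_iff)
  have "0 < lorentz_det x * lorentz_det y" using * lorentz_coneD[OF y] by auto
  then show False using reverse_Cauchy_Schwarz[OF y, of x] * by simp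
qed

lemma tube_det_conformal_map:
  assumes y: "y \<in> lorentz_cone"
  shows "tube_det (re_im_vec (conformal_map y u) (conformal_map y v)) = lorentz_det y * tube_det (re_im_vec u v)"
  by (simp add: tube_det_re_im lorentz_form_conformal_map_both[OF y] lorentz_det_conformal_map[OF y]
      complex_eq_iff algebra_simps)

section \<open>Linear changes of variables\<close>

lemma nn_integral_lborel_translate:
  fixes g :: "'a::euclidean_space \<Rightarrow> ennreal"
  assumes [measurable]: "g \<in> borel_measurable borel"
  shows "(\<integral>\<^sup>+ u. g (c + u) \<partial>lborel) = (\<integral>\<^sup>+ u. g u \<partial>lborel)"
  by (subst (2) lborel_distr_plus[of c, symmetric]) (simp add: nn_integral_distr)

lemma nn_integral_lborel_scale:
  fixes g :: "'a::euclidean_space \<Rightarrow> ennreal"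
  assumes [measurable]: "g \<in> borel_measurable borel" and "c \<noteq> 0"
  shows "(\<integral>\<^sup>+ u. g u \<partial>lborel) = ennreal (\<bar>c\<bar> ^ DIM('a)) * (\<integral>\<^sup>+ u. g (c *\<^sub>R u) \<partial>lborel)"
  by (subst lborel_affine[OF \<open>c \<noteq> 0\<close>, of 0])
    (simp add: nn_integral_density nn_integral_distr nn_integral_cmult)

text \<open>
  The uniqueness argument for Haar measure, applied to the image of Lebesgue measure under an invertible
  linear map: in \<open>\<integral>\<integral> g(A u) h(v)\<close> one substitutes \<open>v \<rightarrow> A u + v\<close> and then \<open>u \<rightarrow> B v + u\<close>. It says that
  the map scales all integrals by the same factor.
\<close>

lemma nn_integral_lborel_linear_ratio:
  fixes A :: "'a::euclidean_space \<Rightarrow> 'a" and g h :: "'a \<Rightarrow> ennreal"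
  assumes A: "linear A" "\<And>u. A (B u) = u"
    and [measurable]: "g \<in> borel_measurable borel" "h \<in> borel_measurable borel"
  shows "(\<integral>\<^sup>+ u. g (A u) \<partial>lborel) * (\<integral>\<^sup>+ u. h u \<partial>lborel)
    = (\<integral>\<^sup>+ u. h (A u) \<partial>lborel) * (\<integral>\<^sup>+ u. g u \<partial>lborel)"
proof -
  have [measurable]: "A \<in> borel_measurable borel"
    using A(1) by (intro borel_measurable_continuous_onI linear_continuous_on) (simp add: linear_conv_bounded_linear)
  have "(\<integral>\<^sup>+ u. g (A u) \<partial>lborel) * (\<integral>\<^sup>+ v. h v \<partial>lborel)
      = (\<integral>\<^sup>+ u. \<integral>\<^sup>+ v. g (A u) * h v \<partial>lborel \<partial>lborel)"
    by (simp add: nn_integral_cmult nn_integral_multc)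
  also have "\<dots> = (\<integral>\<^sup>+ u. \<integral>\<^sup>+ v. g (A u) * h (A u + v) \<partial>lborel \<partial>lborel)"
    by (simp add: nn_integral_cmult nn_integral_lborel_translate)
  also have "\<dots> = (\<integral>\<^sup>+ v. \<integral>\<^sup>+ u. g (A u) * h (A u + v) \<partial>lborel \<partial>lborel)"
    by (intro lborel_pair.Fubini') simp
  also have "\<dots> = (\<integral>\<^sup>+ v. \<integral>\<^sup>+ u. g (A u - v) * h (A u) \<partial>lborel \<partial>lborel)"
  proof (rule nn_integral_cong)
    fix v
    have "(\<integral>\<^sup>+ u. g (A u - v) * h (A u) \<partial>lborel)
        = (\<integral>\<^sup>+ u. g (A (B v + u) - v) * h (A (B v + u)) \<partial>lborel)"
      by (rule nn_integral_lborel_translate[symmetric]) measurable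
    also have "\<dots> = (\<integral>\<^sup>+ u. g (A u) * h (A u + v) \<partial>lborel)"
      by (simp add: linear_add[OF A(1)] A(2) add.commute)
    finally show "(\<integral>\<^sup>+ u. g (A u) * h (A u + v) \<partial>lborel)
        = (\<integral>\<^sup>+ u. g (A u - v) * h (A u) \<partial>lborel)" by (rule sym)
  qed
  also have "\<dots> = (\<integral>\<^sup>+ u. \<integral>\<^sup>+ v. g (A u - v) * h (A u) \<partial>lborel \<partial>lborel)"
    by (intro lborel_pair.Fubini') simp
  also have "\<dots> = (\<integral>\<^sup>+ u. h (A u) * (\<integral>\<^sup>+ v. g v \<partial>lborel) \<partial>lborel)"
  proof (rule nn_integral_cong)
    fix u
    have "(\<integral>\<^sup>+ v. g (A u - v) \<partial>lborel) = (\<integral>\<^sup>+ v. g v \<partial>lborel)"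
      using nn_integral_lborel_scale[of "\<lambda>v. g (A u + v)" "-1"]
      by (simp add: nn_integral_lborel_translate)
    then show "(\<integral>\<^sup>+ v. g (A u - v) * h (A u) \<partial>lborel) = h (A u) * (\<integral>\<^sup>+ v. g v \<partial>lborel)"
      by (subst nn_integral_multc) (auto simp: mult.commute)
  qed
  also have "\<dots> = (\<integral>\<^sup>+ u. h (A u) \<partial>lborel) * (\<integral>\<^sup>+ v. g v \<partial>lborel)"
    by (simp add: nn_integral_multc)
  finally show ?thesis .
qed

text \<open>
  The scaling factor \<open>k\<close> of the conformal map satisfies \<open>k\<^sup>2 = \<Delta>(y)\<^bsup>-n\<^esup>\<close>, because the map applied twice is
  multiplication by \<open>\<Delta>(y)\<close>.
\<close>

lemma nn_integral_conformal_map: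
  fixes y :: "real ^ 'n::{finite,one}"
  assumes y: "y \<in> lorentz_cone" and g [measurable]: "g \<in> borel_measurable borel"
  shows "(\<integral>\<^sup>+ u. g u \<partial>lborel)
    = ennreal (lorentz_det y powr (real CARD('n) / 2)) * (\<integral>\<^sup>+ u. g (conformal_map y u) \<partial>lborel)"
proof -
  let ?A = "conformal_map y" and ?d = "lorentz_det y"
  have d: "?d > 0" using y by (rule lorentz_coneD)
  have [measurable]: "?A \<in> borel_measurable borel"
    using linear_conformal_map
    by (intro borel_measurable_continuous_onI linear_continuous_on) (simp add: linear_conv_bounded_linear)
  have inv: "?A ((1 / ?d) *\<^sub>R ?A u) = u" for u
    using d by (simp add: linear_cmul[OF linear_conformal_map] conformal_map_twice[OF y])
  \<comment> \<open>any test function with finite positive integral determines the factor\<close>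
  define h :: "(real, 'n) vec \<Rightarrow> ennreal" where "h = indicator (ball 0 1)"
  have [measurable]: "h \<in> borel_measurable borel"
    unfolding h_def by (intro borel_measurable_indicator) simp
  define a where "a = (\<integral>\<^sup>+ u. h u \<partial>lborel)"
  define b where "b = (\<integral>\<^sup>+ u. h (?A u) \<partial>lborel)"
  have a: "a = emeasure lborel (ball (0::(real,'n) vec) 1)"
    unfolding a_def h_def by simp
  have afin: "a < \<infinity>" unfolding a by (rule emeasure_lborel_ball_finite)
  have apos: "a > 0" unfolding a
    using content_ball_pos[of 1 "0::(real,'n) vec"] by (simp add: measure_def enn2real_positive_iff)
  have ratio: "(\<integral>\<^sup>+ u. f (?A u) \<partial>lborel) * a = b * (\<integral>\<^sup>+ u. f u \<partial>lborel)"
    if [measurable]: "f \<in> borel_measurable borel" for f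
    unfolding a_def b_def using linear_conformal_map inv by (rule nn_integral_lborel_linear_ratio) measurable
  define k where "k = b / a"
  have ratio': "(\<integral>\<^sup>+ u. f (?A u) \<partial>lborel) = k * (\<integral>\<^sup>+ u. f u \<partial>lborel)"
    if [measurable]: "f \<in> borel_measurable borel" for f
  proof -
    have "k * (\<integral>\<^sup>+ u. f u \<partial>lborel) = (\<integral>\<^sup>+ u. f (?A u) \<partial>lborel) * a / a"
      unfolding k_def ratio[OF that] by (simp add: ennreal_divide_times ennreal_times_divide)
    also have "\<dots> = (\<integral>\<^sup>+ u. f (?A u) \<partial>lborel)"
      using afin apos by (intro mult_divide_eq_ennreal) auto
    finally show ?thesis by (rule sym)
  qed
  have two: "(\<integral>\<^sup>+ u. f (?d *\<^sub>R u) \<partial>lborel) = k * (k * (\<integral>\<^sup>+ u. f u \<partial>lborel))"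
    if [measurable]: "f \<in> borel_measurable borel" for f :: "(real, 'n) vec \<Rightarrow> ennreal"
    using ratio'[of "\<lambda>u. f (?A u)"] ratio'[OF that] by (simp add: conformal_map_twice[OF y])
  have scale: "(\<integral>\<^sup>+ u. f u \<partial>lborel) = ennreal (?d ^ CARD('n)) * (\<integral>\<^sup>+ u. f (?d *\<^sub>R u) \<partial>lborel)"
    if [measurable]: "f \<in> borel_measurable borel" for f :: "(real,'n) vec \<Rightarrow> ennreal"
    using nn_integral_lborel_scale[OF that, of ?d] d by simp
  have *: "a = ennreal (?d ^ CARD('n)) * (k * k) * a"
    using scale[of h] two[of h] by (simp add: a_def mult.assoc)
  then have kk: "ennreal (?d ^ CARD('n)) * (k * k) = 1"
  proof -
    have "ennreal (?d ^ CARD('n)) * (k * k) = ennreal (?d ^ CARD('n)) * (k * k) * a / a"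
      using afin apos by (intro mult_divide_eq_ennreal[symmetric]) auto
    also have "\<dots> = 1" unfolding *[symmetric] using afin apos by (intro ennreal_divide_self) auto
    finally show ?thesis .
  qed
  define r where "r = ?d powr (real CARD('n) / 2)"
  have r: "r > 0" "r * r = ?d ^ CARD('n)" using d
    by (auto simp: r_def powr_add[symmetric] powr_realpow)
  have sq: "(ennreal r * k) * (ennreal r * k) = 1"
    using kk r(1) by (simp add: r(2)[symmetric] ennreal_mult mult_ac)
  have "ennreal r * k = 1"
  proof (cases "ennreal r * k")
    case (real t)
    with sq have "t * t = 1" by (simp add: ennreal_mult[symmetric] del: ennreal_mult)
    with real show ?thesis by (simp add: square_eq_1_iff)
  next
    case top
    with sq show ?thesis by simp
  qed
  then show ?thesis
    unfolding ratio'[OF g] r_def[symmetric] by (simp add: mult.assoc[symmetric])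
qed

lemma nn_integral_lborel_affine_vec:
  fixes c t :: "'n::finite \<Rightarrow> real" and g :: "(real, 'n) vec \<Rightarrow> ennreal"
  assumes c: "\<And>i. c i \<noteq> 0" and [measurable]: "g \<in> borel_measurable borel"
  shows "(\<integral>\<^sup>+ u. g u \<partial>lborel)
    = ennreal (\<Prod>i\<in>UNIV. \<bar>c i\<bar>) * (\<integral>\<^sup>+ u. g (\<chi> i. t i + c i * u $ i) \<partial>lborel)"
proof -
  define C where "C = (\<lambda>b::(real,'n) vec. c (SOME i. b = axis i 1))"
  have C [simp]: "C (axis i 1) = c i" for i
    by (simp add: C_def axis_eq_axis)
  have Basis: "(Basis :: (real,'n) vec set) = range (\<lambda>i. axis i 1)"
    by (auto simp: Basis_vec_def)
  have eq: "(\<chi> i. t i) + (\<Sum>j\<in>Basis. (C j * (u \<bullet> j)) *\<^sub>R j) = (\<chi> i. t i + c i * u $ i)" for u :: "(real,'n) vec"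
  proof (rule euclidean_eqI)
    fix b :: "(real,'n) vec" assume b: "b \<in> Basis"
    then obtain i where i: "b = axis i 1" unfolding Basis by auto
    have "((\<Sum>j\<in>Basis. (C j * (u \<bullet> j)) *\<^sub>R j)) \<bullet> b = C b * (u \<bullet> b)"
      using b by simp
    then show "((\<chi> i. t i) + (\<Sum>j\<in>Basis. (C j * (u \<bullet> j)) *\<^sub>R j)) \<bullet> b = (\<chi> i. t i + c i * u $ i) \<bullet> b"
      unfolding inner_add_left by (simp add: i inner_axis)
  qed
  have prod: "(\<Prod>j\<in>Basis. \<bar>C j\<bar>) = (\<Prod>i\<in>UNIV. \<bar>c i\<bar>)"
    unfolding Basis by (subst prod.reindex) (auto simp: inj_on_def axis_eq_axis)
  have "\<And>j. j \<in> Basis \<Longrightarrow> C j \<noteq> 0" using c by (auto simp: Basis)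
  note * = lborel_affine_euclidean[where t = "\<chi> i. t i", OF this]
  have "(\<integral>\<^sup>+ u. g u \<partial>lborel) = ennreal (\<Prod>j\<in>Basis. \<bar>C j\<bar>) * (\<integral>\<^sup>+ u. g ((\<chi> i. t i) + (\<Sum>j\<in>Basis. (C j * (u \<bullet> j)) *\<^sub>R j)) \<partial>lborel)"
    by (subst *) (simp_all add: nn_integral_density nn_integral_distr nn_integral_cmult)
  then show ?thesis unfolding prod eq .
qed

section \<open>Averaging over one coordinate\<close>

definition set_coord :: "'n \<Rightarrow> real \<Rightarrow> real ^ 'n::finite \<Rightarrow> real ^ 'n::finite" where
  "set_coord i r u = (\<chi> j. if j = i then r else u $ j)"

lemma set_coord_nth [simp]: "set_coord i r u $ j = (if j = i then r else u $ j)"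
  by (simp add: set_coord_def)

lemma vec_nth_measurable [measurable (raw)]:
  fixes f :: "_ \<Rightarrow> (real, 'n::finite) vec"
  assumes "f \<in> borel_measurable M"
  shows "(\<lambda>x. f x $ i) \<in> borel_measurable M"
  using borel_measurable_nth assms by (rule measurable_compose_rev)

lemma set_coord_measurable [measurable (raw)]:
  fixes g :: "_ \<Rightarrow> (real, 'n::finite) vec"
  assumes [measurable]: "f \<in> borel_measurable M" "g \<in> borel_measurable M"
  shows "(\<lambda>x. set_coord i (f x) (g x)) \<in> borel_measurable M"
proof -
  have "set_coord i r u = u + (r - u $ i) *\<^sub>R axis i 1" for r and u :: "(real, 'n) vec"
    by (simp add: vec_eq_iff axis_def)
  then show ?thesis by simp
qed

text \<open>
  One coordinate is split off as an inner integral while the ambient space stays the same: the original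
  coordinate is kept as a dummy variable that ranges over an interval of length 1. Proof: insert
  \<open>1 = \<integral> 1\<^bsub>(0,1)\<^esub>(u\<^sub>i + \<tau>) d\<tau>\<close> and translate.
\<close>

lemma nn_integral_average_coord:
  fixes g :: "(real, 'n::finite) vec \<Rightarrow> ennreal"
  assumes [measurable]: "g \<in> borel_measurable borel"
  shows "(\<integral>\<^sup>+ u. g u \<partial>lborel)
    = (\<integral>\<^sup>+ u. indicator {0<..<1} (u $ i) * (\<integral>\<^sup>+ r. g (set_coord i r u) \<partial>lborel) \<partial>lborel)"
proof -
  let ?I = "indicator {0<..<1::real} :: real \<Rightarrow> ennreal"
  have one: "(\<integral>\<^sup>+ \<tau>. ?I (a + \<tau>) \<partial>lborel) = 1" for a :: real
    by (simp add: nn_integral_lborel_translate)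
  have "(\<integral>\<^sup>+ u. g u \<partial>lborel) = (\<integral>\<^sup>+ u. \<integral>\<^sup>+ \<tau>. g u * ?I (u $ i + \<tau>) \<partial>lborel \<partial>lborel)"
    by (simp add: nn_integral_cmult one)
  also have "\<dots> = (\<integral>\<^sup>+ \<tau>. \<integral>\<^sup>+ u. g u * ?I (u $ i + \<tau>) \<partial>lborel \<partial>lborel)"
    by (intro lborel_pair.Fubini') simp
  also have "\<dots> = (\<integral>\<^sup>+ \<tau>. \<integral>\<^sup>+ u. g (- \<tau> *\<^sub>R axis i 1 + u) * ?I (u $ i) \<partial>lborel \<partial>lborel)"
  proof (rule nn_integral_cong)
    fix \<tau> :: real
    have "(\<integral>\<^sup>+ u. g u * ?I (u $ i + \<tau>) \<partial>lborel)
      = (\<integral>\<^sup>+ u. g (- \<tau> *\<^sub>R axis i 1 + u) * ?I ((- \<tau> *\<^sub>R axis i 1 + u) $ i + \<tau>) \<partial>lborel)"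
      by (rule nn_integral_lborel_translate[symmetric]) measurable
    also have "\<dots> = (\<integral>\<^sup>+ u. g (- \<tau> *\<^sub>R axis i 1 + u) * ?I (u $ i) \<partial>lborel)" by simp
    finally show "(\<integral>\<^sup>+ u. g u * ?I (u $ i + \<tau>) \<partial>lborel)
      = (\<integral>\<^sup>+ u. g (- \<tau> *\<^sub>R axis i 1 + u) * ?I (u $ i) \<partial>lborel)" .
  qed
  also have "\<dots> = (\<integral>\<^sup>+ u. \<integral>\<^sup>+ \<tau>. g (- \<tau> *\<^sub>R axis i 1 + u) * ?I (u $ i) \<partial>lborel \<partial>lborel)"
    by (intro lborel_pair.Fubini') simp
  also have "\<dots> = (\<integral>\<^sup>+ u. ?I (u $ i) * (\<integral>\<^sup>+ r. g (set_coord i r u) \<partial>lborel) \<partial>lborel)"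
  proof (rule nn_integral_cong)
    fix u :: "(real,'n) vec"
    have "(\<integral>\<^sup>+ r. g (set_coord i r u) \<partial>lborel) = (\<integral>\<^sup>+ \<tau>. g (set_coord i (u $ i + (- 1) * \<tau>) u) \<partial>lborel)"
      by (subst nn_integral_real_affine[where c = "-1" and t = "u $ i"]) simp_all
    also have "\<dots> = (\<integral>\<^sup>+ \<tau>. g (- \<tau> *\<^sub>R axis i 1 + u) \<partial>lborel)"
      by (intro nn_integral_cong arg_cong[where f = g]) (simp add: vec_eq_iff axis_def)
    finally show "(\<integral>\<^sup>+ \<tau>. g (- \<tau> *\<^sub>R axis i 1 + u) * ?I (u $ i) \<partial>lborel)
      = ?I (u $ i) * (\<integral>\<^sup>+ r. g (set_coord i r u) \<partial>lborel)"
      by (subst nn_integral_multc) (simp_all add: mult.commute)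
  qed
  finally show ?thesis .
qed

section \<open>Integration in spectral coordinates\<close>

definition spatial_dilate :: "real \<Rightarrow> real ^ 'n::{finite,one} \<Rightarrow> real ^ 'n::{finite,one}" where
  "spatial_dilate \<tau> u = (\<chi> i. if i = 1 then u $ 1 else \<tau> * u $ i)"

lemma spatial_dilate_nth [simp]: "spatial_dilate \<tau> u $ i = (if i = 1 then u $ 1 else \<tau> * u $ i)"
  by (simp add: spatial_dilate_def)

lemma spatial_norm_cong: "(\<And>i. i \<noteq> 1 \<Longrightarrow> u $ i = v $ i) \<Longrightarrow> spatial_norm u = spatial_norm v"
  unfolding spatial_norm_def by (intro L2_set_cong) auto

lemma spatial_norm_dilate [simp]: "spatial_norm (spatial_dilate \<tau> u) = \<bar>\<tau>\<bar> * spatial_norm u"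
proof -
  have "spatial_norm (spatial_dilate \<tau> u) = L2_set (\<lambda>i. \<tau> * u $ i) (UNIV - {1})"
    unfolding spatial_norm_def by (intro L2_set_cong) auto
  also have "\<dots> = \<bar>\<tau>\<bar> * spatial_norm u"
    unfolding spatial_norm_def L2_set_def
    by (simp add: power_mult_distrib sum_distrib_left[symmetric] real_sqrt_mult)
  finally show ?thesis .
qed

lemma spatial_norm_set_coord [simp]: "spatial_norm (set_coord 1 r u) = spatial_norm u"
  by (rule spatial_norm_cong) simp

lemma spatial_norm_measurable [measurable]: "spatial_norm \<in> borel_measurable borel"
  unfolding spatial_norm_def[abs_def] L2_set_def by measurable

lemma abs_nth_le_spatial_norm:
  assumes "k \<noteq> 1"
  shows "\<bar>u $ k\<bar> \<le> spatial_norm u"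
proof -
  have "(u $ k)\<^sup>2 \<le> (spatial_norm u)\<^sup>2"
    unfolding spatial_norm_sq using assms by (intro member_le_sum[of k _ "\<lambda>i. (u $ i)\<^sup>2"]) auto
  then show ?thesis by (simp add: abs_le_square_iff[symmetric])
qed

lemma spatial_dilate_measurable [measurable (raw)]:
  fixes g :: "_ \<Rightarrow> (real, 'n::{finite,one}) vec"
  assumes [measurable]: "f \<in> borel_measurable M" "g \<in> borel_measurable M"
  shows "(\<lambda>x. spatial_dilate (f x) (g x)) \<in> borel_measurable M"
proof -
  have "spatial_dilate \<tau> u = \<tau> *\<^sub>R u + ((1 - \<tau>) * u $ 1) *\<^sub>R time_axis" for \<tau> and u :: "(real, 'n) vec"
    by (simp add: vec_eq_iff algebra_simps)
  then show ?thesis by simp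
qed

lemma nn_integral_spatial_dilate:
  fixes g :: "(real, 'n::{finite,one}) vec \<Rightarrow> ennreal"
  assumes "\<tau> \<noteq> 0" and [measurable]: "g \<in> borel_measurable borel"
  shows "(\<integral>\<^sup>+ u. g u \<partial>lborel)
    = ennreal (\<bar>\<tau>\<bar> ^ (CARD('n) - 1)) * (\<integral>\<^sup>+ u. g (spatial_dilate \<tau> u) \<partial>lborel)"
proof -
  have "(\<Prod>i\<in>(UNIV::'n set). \<bar>if i = 1 then 1 else \<tau>\<bar>) = (\<Prod>i\<in>UNIV - {1::'n}. \<bar>\<tau>\<bar>)"
    by (subst prod.remove[of UNIV 1]) (auto intro!: prod.cong)
  also have "\<dots> = \<bar>\<tau>\<bar> ^ (CARD('n) - 1)" by (simp add: card_Diff_singleton)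
  finally have p: "(\<Prod>i\<in>(UNIV::'n set). \<bar>if i = 1 then 1 else \<tau>\<bar>) = \<bar>\<tau>\<bar> ^ (CARD('n) - 1)" .
  have "(\<chi> i. 0 + (if i = 1 then 1 else \<tau>) * u $ i) = spatial_dilate \<tau> u" for u :: "(real,'n) vec"
    by (simp add: vec_eq_iff)
  then show ?thesis
    using nn_integral_lborel_affine_vec[of "\<lambda>i. if i = 1 then 1 else \<tau>" g "\<lambda>_. 0"] assms p by simp
qed

lemma nn_integral_even_real:
  fixes h :: "real \<Rightarrow> ennreal"
  assumes [measurable]: "h \<in> borel_measurable borel"
  shows "(\<integral>\<^sup>+ \<tau>. h \<bar>\<tau>\<bar> \<partial>lborel) = 2 * (\<integral>\<^sup>+ \<tau>. h \<tau> * indicator {0..} \<tau> \<partial>lborel)"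
proof -
  have "(\<integral>\<^sup>+ \<tau>. h \<bar>\<tau>\<bar> \<partial>lborel) = (\<integral>\<^sup>+ \<tau>. h \<tau> * indicator {0..} \<tau> + h (- \<tau>) * indicator {0..} (- \<tau>) \<partial>lborel)"
  proof (rule nn_integral_cong_AE)
    show "AE \<tau> in lborel. h \<bar>\<tau>\<bar> = h \<tau> * indicator {0..} \<tau> + h (- \<tau>) * indicator {0..} (- \<tau>)"
      using AE_lborel_singleton[of "0::real"] by eventually_elim (auto simp: indicator_def abs_if)
  qed
  also have "\<dots> = (\<integral>\<^sup>+ \<tau>. h \<tau> * indicator {0..} \<tau> \<partial>lborel) + (\<integral>\<^sup>+ \<tau>. h (- \<tau>) * indicator {0..} (- \<tau>) \<partial>lborel)"
    by (rule nn_integral_add) measurable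
  also have "(\<integral>\<^sup>+ \<tau>. h (- \<tau>) * indicator {0..} (- \<tau>) \<partial>lborel) = (\<integral>\<^sup>+ \<tau>. h \<tau> * indicator {0..} \<tau> \<partial>lborel)"
    using nn_integral_real_affine[of "\<lambda>\<tau>. h \<tau> * indicator {0..} \<tau>" "-1" 0] by simp
  finally show ?thesis by (simp add: mult_2)
qed

lemma nn_integral_inverse_power_tail:
  fixes c :: real
  assumes c: "0 < c" and m: "1 \<le> m"
  shows "(\<integral>\<^sup>+ \<tau>. ennreal (indicator {c..} \<bar>\<tau>\<bar> * (c ^ m / \<bar>\<tau>\<bar> ^ Suc m)) \<partial>lborel) = ennreal (2 / real m)"
proof -
  have "(\<integral>\<^sup>+ \<tau>. ennreal (indicator {c..} \<tau> * (c ^ m / \<tau> ^ Suc m)) * indicator {0..} \<tau> \<partial>lborel)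
      = (\<integral>\<^sup>+ \<tau>. ennreal (c ^ m / \<tau> ^ Suc m) * indicator {c..} \<tau> \<partial>lborel)"
    using c by (intro nn_integral_cong) (auto simp: indicator_def)
  also have "\<dots> = ennreal (0 - - (c ^ m) / (real m * c ^ m))"
  proof (rule nn_integral_FTC_atLeast[where F = "\<lambda>\<tau>. - (c ^ m) / (real m * \<tau> ^ m)" and T = 0])
    show "((\<lambda>\<tau>. - (c ^ m) / (real m * \<tau> ^ m)) \<longlongrightarrow> 0) at_top"
    proof -
      have "filterlim (\<lambda>\<tau>::real. real m * \<tau> ^ m) at_top at_top"
        using m by (intro filterlim_tendsto_pos_mult_at_top[OF tendsto_const] filterlim_pow_at_top filterlim_ident) auto
      then show ?thesis by (rule real_tendsto_divide_at_top[OF tendsto_const])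
    qed
    fix \<tau> assume \<tau>: "c \<le> \<tau>"
    show "0 \<le> c ^ m / \<tau> ^ Suc m" using c \<tau> by simp
    obtain k where k: "m = Suc k" using m by (cases m) auto
    define r where "r = real m"
    have r: "0 < r" using m by (simp add: r_def)
    have "((\<lambda>\<tau>. \<tau> ^ m) has_real_derivative r * \<tau> ^ k) (at \<tau>)"
      using DERIV_pow[of m \<tau>] by (simp add: k r_def)
    then have "((\<lambda>\<tau>. inverse (\<tau> ^ m)) has_real_derivative - (inverse (\<tau> ^ m) * (r * \<tau> ^ k) * inverse (\<tau> ^ m))) (at \<tau>)"
      using c \<tau> by (intro DERIV_inverse') auto
    then have "((\<lambda>\<tau>. - (c ^ m) / r * inverse (\<tau> ^ m)) has_real_derivative
        - (c ^ m) / r * - (inverse (\<tau> ^ m) * (r * \<tau> ^ k) * inverse (\<tau> ^ m))) (at \<tau>)"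
      by (rule DERIV_cmult)
    moreover have "- (c ^ m) / r * - (inverse (\<tau> ^ m) * (r * \<tau> ^ k) * inverse (\<tau> ^ m)) = c ^ m / \<tau> ^ Suc m"
      using c \<tau> r by (simp add: k field_simps)
    moreover have "(\<lambda>\<tau>. - (c ^ m) / r * inverse (\<tau> ^ m)) = (\<lambda>\<tau>. - (c ^ m) / (real m * \<tau> ^ m))"
      by (simp add: r_def divide_inverse fun_eq_iff)
    ultimately show "((\<lambda>\<tau>. - (c ^ m) / (real m * \<tau> ^ m)) has_real_derivative c ^ m / \<tau> ^ Suc m) (at \<tau>)"
      by simp
  qed measurable
  also have "\<dots> = ennreal (1 / m)" using c by simp
  finally have *: "(\<integral>\<^sup>+ \<tau>. ennreal (indicator {c..} \<tau> * (c ^ m / \<tau> ^ Suc m)) * indicator {0..} \<tau> \<partial>lborel) = ennreal (1 / m)" .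
  have "(\<integral>\<^sup>+ \<tau>. ennreal (indicator {c..} \<bar>\<tau>\<bar> * (c ^ m / \<bar>\<tau>\<bar> ^ Suc m)) \<partial>lborel) = 2 * ennreal (1 / m)"
    by (subst nn_integral_even_real[of "\<lambda>\<tau>. ennreal (indicator {c..} \<tau> * (c ^ m / \<tau> ^ Suc m))"]) (measurable, simp only: *)
  also have "\<dots> = ennreal (2 * (1 / m))" by (subst ennreal_mult) auto
  finally show ?thesis by simp
qed

lemma exists_spatial_index:
  assumes "2 \<le> CARD('n::{finite,one})"
  shows "\<exists>k::'n. k \<noteq> 1"
proof (rule ccontr)
  assume "\<nexists>k::'n. k \<noteq> 1"
  then have "(UNIV :: 'n set) = {1}" by auto
  then have "CARD('n) = card {1::'n}" by (rule arg_cong)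
  then show False using assms by simp
qed

text \<open>
  The time axis lies in a coordinate hyperplane.
\<close>

lemma AE_spatial_norm_pos:
  assumes "2 \<le> CARD('n::{finite,one})"
  shows "AE u :: (real,'n) vec in lborel. 0 < spatial_norm u"
proof -
  obtain k :: 'n where k: "k \<noteq> 1" using exists_spatial_index[OF assms] by blast
  have "AE u :: (real,'n) vec in lborel. u \<bullet> axis k 1 \<noteq> 0"
    by (rule AE_lborel_inner_neq) (auto simp: Basis_vec_def)
  then show ?thesis
  proof eventually_elim
    case (elim u)
    then have "0 < \<bar>u $ k\<bar>" by (simp add: inner_axis)
    also have "\<bar>u $ k\<bar> \<le> spatial_norm u" using k by (rule abs_nth_le_spatial_norm)
    finally show ?case .
  qed
qed

text \<open>
  Polar coordinates in the spatial variables without a surface measure: averaging over the sphere is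
  replaced by averaging over the unit ball. Proof: insert the dilation invariant constant
  \<open>\<integral> W(\<bar>u'\<bar> / \<bar>\<tau>\<bar>) d\<tau> / \<bar>\<tau>\<bar>\<close> with \<open>W(t) = t\<^bsup>n-1\<^esup> 1\<^bsub>t \<le> 1\<^esub>\<close>, dilate \<open>u'\<close> by \<open>\<tau>\<close>, and put \<open>s = \<tau> \<bar>u'\<bar>\<close>; the
  factor \<open>W(\<bar>u'\<bar>)\<close> then cancels the powers of \<open>\<bar>u'\<bar>\<close>. Both signs of \<open>s\<close> are used, so that
  the two eigenvalues below enter symmetrically.
\<close>

lemma nn_integral_spatial_polar:
  fixes k :: "(real, 'n::{finite,one}) vec \<Rightarrow> ennreal"
  assumes n: "2 \<le> CARD('n)" and [measurable]: "k \<in> borel_measurable borel"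
  shows "(\<integral>\<^sup>+ u. k u \<partial>lborel) = ennreal (real (CARD('n) - 1) / 2) *
    (\<integral>\<^sup>+ u. indicator {0<..1} (spatial_norm u) *
      (\<integral>\<^sup>+ s. k (spatial_dilate (s / spatial_norm u) u) * ennreal (\<bar>s\<bar> ^ (CARD('n) - 2)) \<partial>lborel) \<partial>lborel)"
proof -
  define m where "m = CARD('n) - 1"
  have m: "1 \<le> m" "CARD('n) - 2 = m - 1" using n by (auto simp: m_def)
  \<comment> \<open>supported in \<open>t \<le> 1\<close>, so that the base of the fibration is bounded\<close>
  define W :: "real \<Rightarrow> real" where "W t = indicator {..1} t * t ^ m" for t
  have [measurable]: "W \<in> borel_measurable borel" unfolding W_def[abs_def] by measurable
  have W0: "0 \<le> t \<Longrightarrow> 0 \<le> W t" for t by (simp add: W_def indicator_def)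
  have one: "ennreal (m / 2) * (\<integral>\<^sup>+ \<tau>. ennreal (W (c / \<bar>\<tau>\<bar>) / \<bar>\<tau>\<bar>) \<partial>lborel) = 1" if c: "c > 0" for c
  proof -
    have "(\<integral>\<^sup>+ \<tau>. ennreal (W (c / \<bar>\<tau>\<bar>) / \<bar>\<tau>\<bar>) \<partial>lborel)
        = (\<integral>\<^sup>+ \<tau>. ennreal (indicator {c..} \<bar>\<tau>\<bar> * (c ^ m / \<bar>\<tau>\<bar> ^ Suc m)) \<partial>lborel)"
    proof (rule nn_integral_cong_AE)
      show "AE \<tau> in lborel. ennreal (W (c / \<bar>\<tau>\<bar>) / \<bar>\<tau>\<bar>) = ennreal (indicator {c..} \<bar>\<tau>\<bar> * (c ^ m / \<bar>\<tau>\<bar> ^ Suc m))"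
        using AE_lborel_singleton[of "0::real"]
        by eventually_elim (auto simp: W_def indicator_def divide_simps mult.commute)
    qed
    also have "\<dots> = ennreal (2 / real m)" by (rule nn_integral_inverse_power_tail[OF c m(1)])
    finally show ?thesis using m(1) by (simp add: ennreal_mult[symmetric])
  qed
  have "(\<integral>\<^sup>+ u. k u \<partial>lborel)
    = (\<integral>\<^sup>+ u. k u * (ennreal (m / 2) * (\<integral>\<^sup>+ \<tau>. ennreal (W (spatial_norm u / \<bar>\<tau>\<bar>) / \<bar>\<tau>\<bar>) \<partial>lborel)) \<partial>lborel)"
    using AE_spatial_norm_pos[OF n] by (intro nn_integral_cong_AE) (auto simp: one)
  also have "\<dots> = ennreal (m / 2) * (\<integral>\<^sup>+ u. \<integral>\<^sup>+ \<tau>. k u * ennreal (W (spatial_norm u / \<bar>\<tau>\<bar>) / \<bar>\<tau>\<bar>) \<partial>lborel \<partial>lborel)"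
    by (simp add: nn_integral_cmult mult.left_commute[of _ "ennreal (real m / 2)"])
  also have "(\<integral>\<^sup>+ u. \<integral>\<^sup>+ \<tau>. k u * ennreal (W (spatial_norm u / \<bar>\<tau>\<bar>) / \<bar>\<tau>\<bar>) \<partial>lborel \<partial>lborel)
    = (\<integral>\<^sup>+ \<tau>. \<integral>\<^sup>+ u. k u * ennreal (W (spatial_norm u / \<bar>\<tau>\<bar>) / \<bar>\<tau>\<bar>) \<partial>lborel \<partial>lborel)"
    by (intro lborel_pair.Fubini') simp
  also have "\<dots> = (\<integral>\<^sup>+ \<tau>. \<integral>\<^sup>+ u. k (spatial_dilate \<tau> u) * ennreal (W (spatial_norm u) * \<bar>\<tau>\<bar> ^ (m - 1)) \<partial>lborel \<partial>lborel)"
  proof (rule nn_integral_cong_AE)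
    show "AE \<tau> in lborel. (\<integral>\<^sup>+ u. k u * ennreal (W (spatial_norm u / \<bar>\<tau>\<bar>) / \<bar>\<tau>\<bar>) \<partial>lborel)
      = (\<integral>\<^sup>+ u. k (spatial_dilate \<tau> u) * ennreal (W (spatial_norm u) * \<bar>\<tau>\<bar> ^ (m - 1)) \<partial>lborel)"
      using AE_lborel_singleton[of "0::real"]
    proof eventually_elim
      case (elim \<tau>)
      have "(\<integral>\<^sup>+ u. k u * ennreal (W (spatial_norm u / \<bar>\<tau>\<bar>) / \<bar>\<tau>\<bar>) \<partial>lborel)
        = ennreal (\<bar>\<tau>\<bar> ^ m) * (\<integral>\<^sup>+ u. k (spatial_dilate \<tau> u) * ennreal (W (spatial_norm u) / \<bar>\<tau>\<bar>) \<partial>lborel)"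
        using elim by (subst nn_integral_spatial_dilate[OF elim]) (simp_all add: m_def)
      also have "\<dots> = (\<integral>\<^sup>+ u. k (spatial_dilate \<tau> u) * (ennreal (\<bar>\<tau>\<bar> ^ m) * ennreal (W (spatial_norm u) / \<bar>\<tau>\<bar>)) \<partial>lborel)"
        by (subst nn_integral_cmult[symmetric]) (simp_all add: mult.left_commute)
      also have "(\<lambda>u::(real,'n) vec. ennreal (\<bar>\<tau>\<bar> ^ m) * ennreal (W (spatial_norm u) / \<bar>\<tau>\<bar>)) = (\<lambda>u. ennreal (W (spatial_norm u) * \<bar>\<tau>\<bar> ^ (m - 1)))"
      proof
        fix u :: "(real,'n) vec"
        have "\<bar>\<tau>\<bar> ^ m = \<bar>\<tau>\<bar> ^ (m - 1) * \<bar>\<tau>\<bar>" using m(1) by (metis Suc_diff_1 less_eq_Suc_le One_nat_def power_Suc2)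
        then show "ennreal (\<bar>\<tau>\<bar> ^ m) * ennreal (W (spatial_norm u) / \<bar>\<tau>\<bar>) = ennreal (W (spatial_norm u) * \<bar>\<tau>\<bar> ^ (m - 1))"
          using elim by (simp add: ennreal_mult[symmetric] W0 mult.commute)
      qed
      finally show ?case .
    qed
  qed
  also have "\<dots> = (\<integral>\<^sup>+ u. \<integral>\<^sup>+ \<tau>. k (spatial_dilate \<tau> u) * ennreal (W (spatial_norm u) * \<bar>\<tau>\<bar> ^ (m - 1)) \<partial>lborel \<partial>lborel)"
    by (intro lborel_pair.Fubini') simp
  also have "\<dots> = (\<integral>\<^sup>+ u. indicator {0<..1} (spatial_norm u) *
      (\<integral>\<^sup>+ s. k (spatial_dilate (s / spatial_norm u) u) * ennreal (\<bar>s\<bar> ^ (m - 1)) \<partial>lborel) \<partial>lborel)"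
  proof (rule nn_integral_cong)
    fix u :: "(real,'n) vec"
    let ?c = "spatial_norm u"
    show "(\<integral>\<^sup>+ \<tau>. k (spatial_dilate \<tau> u) * ennreal (W ?c * \<bar>\<tau>\<bar> ^ (m - 1)) \<partial>lborel)
      = indicator {0<..1} ?c * (\<integral>\<^sup>+ s. k (spatial_dilate (s / ?c) u) * ennreal (\<bar>s\<bar> ^ (m - 1)) \<partial>lborel)"
    proof (cases "0 < ?c \<and> ?c \<le> 1")
      case True
      have "(\<integral>\<^sup>+ \<tau>. k (spatial_dilate \<tau> u) * ennreal (W ?c * \<bar>\<tau>\<bar> ^ (m - 1)) \<partial>lborel)
         = ennreal (1 / ?c) * (\<integral>\<^sup>+ s. k (spatial_dilate (s / ?c) u) * ennreal (W ?c * \<bar>s / ?c\<bar> ^ (m - 1)) \<partial>lborel)"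
        using True by (subst nn_integral_real_affine[where c = "1 / ?c" and t = 0]) simp_all
      also have "\<dots> = (\<integral>\<^sup>+ s. k (spatial_dilate (s / ?c) u) * (ennreal (1 / ?c) * ennreal (W ?c * \<bar>s / ?c\<bar> ^ (m - 1))) \<partial>lborel)"
        by (subst nn_integral_cmult[symmetric]) (simp_all add: mult.left_commute)
      also have "(\<lambda>s. ennreal (1 / ?c) * ennreal (W ?c * \<bar>s / ?c\<bar> ^ (m - 1))) = (\<lambda>s. ennreal (\<bar>s\<bar> ^ (m - 1)))"
      proof
        fix s
        have "?c ^ m = ?c ^ (m - 1) * ?c" using m(1) by (metis Suc_diff_1 less_eq_Suc_le One_nat_def power_Suc2)
        then have "1 / ?c * (W ?c * \<bar>s / ?c\<bar> ^ (m - 1)) = \<bar>s\<bar> ^ (m - 1)"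
          using True by (simp add: W_def power_divide)
        then show "ennreal (1 / ?c) * ennreal (W ?c * \<bar>s / ?c\<bar> ^ (m - 1)) = ennreal (\<bar>s\<bar> ^ (m - 1))"
          using True by (subst ennreal_mult[symmetric]) (auto simp: W0)
      qed
      finally show ?thesis using True by simp
    next
      case False
      then have "W ?c = 0" using m(1) spatial_norm_nonneg[of u] by (auto simp: W_def indicator_def)
      then show ?thesis using False by (simp add: indicator_def)
    qed
  qed
  finally show ?thesis unfolding m(2) m_def[symmetric] .
qed

lemma measurable_case_prod_compose:
  assumes "case_prod G \<in> borel_measurable (A \<Otimes>\<^sub>M B)" "f \<in> measurable M A" "g \<in> measurable M B"
  shows "(\<lambda>x. G (f x) (g x)) \<in> borel_measurable M"
  using measurable_compose[OF measurable_Pair[OF assms(2,3)] assms(1)] by simp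

lemma nn_integral_light_cone_coords:
  fixes G :: "real \<Rightarrow> real \<Rightarrow> ennreal"
  assumes [measurable]: "case_prod G \<in> borel_measurable (borel \<Otimes>\<^sub>M borel)"
  shows "(\<integral>\<^sup>+ s. \<integral>\<^sup>+ r. G r s \<partial>lborel \<partial>lborel)
    = ennreal (1 / 2) * (\<integral>\<^sup>+ l. \<integral>\<^sup>+ m. G ((l + m) / 2) ((l - m) / 2) \<partial>lborel \<partial>lborel)"
proof -
  note [measurable (raw)] = measurable_case_prod_compose[OF assms(1)]
  have "(\<integral>\<^sup>+ s. \<integral>\<^sup>+ r. G r s \<partial>lborel \<partial>lborel) = (\<integral>\<^sup>+ s. \<integral>\<^sup>+ l. G (- s + l) s \<partial>lborel \<partial>lborel)"
    by (intro nn_integral_cong nn_integral_lborel_translate[symmetric]) measurable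
  also have "\<dots> = (\<integral>\<^sup>+ l. \<integral>\<^sup>+ s. G (- s + l) s \<partial>lborel \<partial>lborel)"
    by (intro lborel_pair.Fubini') measurable
  also have "\<dots> = (\<integral>\<^sup>+ l. ennreal (1 / 2) * (\<integral>\<^sup>+ m. G ((l + m) / 2) ((l - m) / 2) \<partial>lborel) \<partial>lborel)"
  proof (rule nn_integral_cong)
    fix l :: real
    have "(\<integral>\<^sup>+ s. G (- s + l) s \<partial>lborel)
      = ennreal (1 / 2) * (\<integral>\<^sup>+ m. G (- (l / 2 + (- 1 / 2) * m) + l) (l / 2 + (- 1 / 2) * m) \<partial>lborel)"
      by (subst nn_integral_real_affine[where c = "-1/2" and t = "l/2"]) simp_all
    also have "\<dots> = ennreal (1 / 2) * (\<integral>\<^sup>+ m. G ((l + m) / 2) ((l - m) / 2) \<partial>lborel)"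
      by (intro arg_cong2[where f = "(*)"] nn_integral_cong arg_cong2[where f = G]) (auto simp: field_simps)
    finally show "(\<integral>\<^sup>+ s. G (- s + l) s \<partial>lborel) = ennreal (1 / 2) * (\<integral>\<^sup>+ m. G ((l + m) / 2) ((l - m) / 2) \<partial>lborel)" .
  qed
  also have "\<dots> = ennreal (1 / 2) * (\<integral>\<^sup>+ l. \<integral>\<^sup>+ m. G ((l + m) / 2) ((l - m) / 2) \<partial>lborel \<partial>lborel)"
    by (rule nn_integral_cmult) measurable
  finally show ?thesis .
qed

text \<open>
  The point with eigenvalues \<open>l\<close> and \<open>m\<close>, that is \<open>l c\<^sub>1 + m c\<^sub>2\<close> where \<open>c\<^sub>1, c\<^sub>2 = (e \<plusminus> u' / \<bar>u'\<bar>) / 2\<close> are the two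
  idempotents in the spatial direction of \<open>u\<close>. In these coordinates \<open>\<Delta> = l m\<close>.
\<close>

definition spectral :: "real ^ 'n::{finite,one} \<Rightarrow> real \<Rightarrow> real \<Rightarrow> real ^ 'n::{finite,one}" where
  "spectral u l m = (\<chi> i. if i = 1 then (l + m) / 2 else (l - m) / 2 / spatial_norm u * u $ i)"

lemma spectral_nth [simp]:
  "spectral u l m $ i = (if i = 1 then (l + m) / 2 else (l - m) / 2 / spatial_norm u * u $ i)"
  by (simp add: spectral_def)

lemma spectral_measurable [measurable (raw)]:
  fixes f :: "_ \<Rightarrow> (real, 'n::{finite,one}) vec"
  assumes [measurable]: "f \<in> borel_measurable M" "g \<in> borel_measurable M" "h \<in> borel_measurable M"
  shows "(\<lambda>x. spectral (f x) (g x) (h x)) \<in> borel_measurable M"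
proof -
  have "spectral u l m = set_coord 1 ((l + m) / 2) (spatial_dilate ((l - m) / 2 / spatial_norm u) u)"
    for u :: "(real, 'n) vec" and l m
    by (simp add: vec_eq_iff)
  then show ?thesis by (simp del: divide_divide_eq_left)
qed

text \<open>
  The set of parameters \<open>u\<close> of the spectral coordinates; only the spatial direction of \<open>u\<close> matters, the rest
  is the dummy range produced by the two averaging lemmas.
\<close>

definition spectral_base :: "(real ^ 'n::{finite,one}) set" where
  "spectral_base = {u. 0 < u $ 1 \<and> u $ 1 < 1 \<and> 0 < spatial_norm u \<and> spatial_norm u \<le> 1}"

lemma spectral_base_sets [measurable]: "spectral_base \<in> sets borel"
  unfolding spectral_base_def by measurable

lemma emeasure_spectral_base: "emeasure lborel (spectral_base :: (real,'n::{finite,one}) vec set) < \<infinity>"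
proof -
  have "u \<in> cball 0 (real CARD('n))" if "u \<in> spectral_base" for u :: "(real,'n) vec"
  proof -
    have "\<bar>u $ i\<bar> \<le> 1" for i
    proof (cases "i = 1")
      case False
      then have "\<bar>u $ i\<bar> \<le> spatial_norm u" by (rule abs_nth_le_spatial_norm)
      then show ?thesis using that by (auto simp: spectral_base_def)
    qed (use that in \<open>auto simp: spectral_base_def\<close>)
    then have "(\<Sum>i\<in>UNIV. \<bar>u $ i\<bar>) \<le> (\<Sum>i\<in>(UNIV::'n set). 1)" by (intro sum_mono)
    then show ?thesis using norm_le_l1_cart[of u] by simp
  qed
  then have "emeasure lborel (spectral_base :: (real,'n::{finite,one}) vec set) \<le> emeasure lborel (cball (0::(real,'n) vec) (real CARD('n)))"
    by (intro emeasure_mono) auto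
  also have "\<dots> < \<infinity>" by (rule emeasure_lborel_cball_finite)
  finally show ?thesis .
qed

definition spectral_const :: "'n itself \<Rightarrow> real" where
  "spectral_const _ = real (CARD('n) - 1) / 4 / 2 ^ (CARD('n) - 2)"

text \<open>
  The weight \<open>\<bar>l - m\<bar>\<^bsup>n-2\<^esup>\<close> is the Jacobian \<open>\<bar>s\<bar>\<^bsup>n-2\<^esup>\<close> of polar coordinates, with radius \<open>s = (l - m) / 2\<close>.
\<close>

lemma nn_integral_spectral:
  fixes g :: "(real, 'n::{finite,one}) vec \<Rightarrow> ennreal"
  assumes n: "2 \<le> CARD('n)" and [measurable]: "g \<in> borel_measurable borel"
  shows "(\<integral>\<^sup>+ u. g u \<partial>lborel) = ennreal (spectral_const TYPE('n)) *
    (\<integral>\<^sup>+ u. indicator spectral_base u *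
      (\<integral>\<^sup>+ l. \<integral>\<^sup>+ m. g (spectral u l m) * ennreal (\<bar>l - m\<bar> ^ (CARD('n) - 2)) \<partial>lborel \<partial>lborel) \<partial>lborel)"
proof -
  let ?n1 = "ennreal (real (CARD('n) - 1) / 2)" and ?n2 = "CARD('n) - 2"
  define k where "k u = indicator {0<..<1} (u $ 1) * (\<integral>\<^sup>+ r. g (set_coord 1 r u) \<partial>lborel)" for u :: "(real,'n) vec"
  have [measurable]: "k \<in> borel_measurable borel" unfolding k_def[abs_def] by measurable
  have "(\<integral>\<^sup>+ u. g u \<partial>lborel) = (\<integral>\<^sup>+ u. k u \<partial>lborel)"
    unfolding k_def by (rule nn_integral_average_coord) measurable
  also have "\<dots> = ?n1 *
    (\<integral>\<^sup>+ u. indicator {0<..1} (spatial_norm u) *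
      (\<integral>\<^sup>+ s. k (spatial_dilate (s / spatial_norm u) u) * ennreal (\<bar>s\<bar> ^ ?n2) \<partial>lborel) \<partial>lborel)"
    by (rule nn_integral_spatial_polar[OF n]) measurable
  also have "\<dots> = ?n1 *
    (\<integral>\<^sup>+ u. ennreal (1 / 2 / 2 ^ ?n2) * (indicator spectral_base u *
      (\<integral>\<^sup>+ l. \<integral>\<^sup>+ m. g (spectral u l m) * ennreal (\<bar>l - m\<bar> ^ ?n2) \<partial>lborel \<partial>lborel)) \<partial>lborel)"
  proof (rule arg_cong2[where f = "(*)", OF refl], rule nn_integral_cong)
    fix u :: "(real,'n) vec"
    let ?G = "\<lambda>r s. g (set_coord 1 r (spatial_dilate (s / spatial_norm u) u)) * ennreal (\<bar>s\<bar> ^ ?n2)"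
    have "(\<integral>\<^sup>+ s. k (spatial_dilate (s / spatial_norm u) u) * ennreal (\<bar>s\<bar> ^ ?n2) \<partial>lborel)
      = indicator {0<..<1} (u $ 1) * (\<integral>\<^sup>+ s. \<integral>\<^sup>+ r. ?G r s \<partial>lborel \<partial>lborel)"
      by (simp add: k_def nn_integral_multc nn_integral_cmult mult.assoc)
    also have "(\<integral>\<^sup>+ s. \<integral>\<^sup>+ r. ?G r s \<partial>lborel \<partial>lborel)
      = ennreal (1 / 2) * (\<integral>\<^sup>+ l. \<integral>\<^sup>+ m. ?G ((l + m) / 2) ((l - m) / 2) \<partial>lborel \<partial>lborel)"
      by (rule nn_integral_light_cone_coords) simp
    also have "(\<integral>\<^sup>+ l. \<integral>\<^sup>+ m. ?G ((l + m) / 2) ((l - m) / 2) \<partial>lborel \<partial>lborel)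
      = (\<integral>\<^sup>+ l. \<integral>\<^sup>+ m. ennreal (1 / 2 ^ ?n2) * (g (spectral u l m) * ennreal (\<bar>l - m\<bar> ^ ?n2)) \<partial>lborel \<partial>lborel)"
    proof (rule nn_integral_cong, rule nn_integral_cong)
      fix l m :: real
      have "set_coord 1 ((l + m) / 2) (spatial_dilate ((l - m) / 2 / spatial_norm u) u) = spectral u l m"
        by (simp add: vec_eq_iff)
      moreover have "ennreal (\<bar>(l - m) / 2\<bar> ^ ?n2) = ennreal (1 / 2 ^ ?n2) * ennreal (\<bar>l - m\<bar> ^ ?n2)"
        by (simp add: ennreal_mult[symmetric] power_divide)
      ultimately show "?G ((l + m) / 2) ((l - m) / 2) = ennreal (1 / 2 ^ ?n2) * (g (spectral u l m) * ennreal (\<bar>l - m\<bar> ^ ?n2))"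
        by (simp add: mult_ac)
    qed
    also have "\<dots> = ennreal (1 / 2 ^ ?n2) * (\<integral>\<^sup>+ l. \<integral>\<^sup>+ m. g (spectral u l m) * ennreal (\<bar>l - m\<bar> ^ ?n2) \<partial>lborel \<partial>lborel)"
      by (simp add: nn_integral_cmult)
    finally have "(\<integral>\<^sup>+ s. k (spatial_dilate (s / spatial_norm u) u) * ennreal (\<bar>s\<bar> ^ ?n2) \<partial>lborel)
      = (ennreal (1 / 2) * ennreal (1 / 2 ^ ?n2)) * (indicator {0<..<1} (u $ 1) *
        (\<integral>\<^sup>+ l. \<integral>\<^sup>+ m. g (spectral u l m) * ennreal (\<bar>l - m\<bar> ^ ?n2) \<partial>lborel \<partial>lborel))"
      by (simp only: mult_ac)
    moreover have "ennreal (1 / 2) * ennreal (1 / 2 ^ ?n2) = ennreal (1 / 2 / 2 ^ ?n2)"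
      by (subst ennreal_mult[symmetric]) auto
    ultimately show "indicator {0<..1} (spatial_norm u) *
      (\<integral>\<^sup>+ s. k (spatial_dilate (s / spatial_norm u) u) * ennreal (\<bar>s\<bar> ^ ?n2) \<partial>lborel)
      = ennreal (1 / 2 / 2 ^ ?n2) * (indicator spectral_base u *
      (\<integral>\<^sup>+ l. \<integral>\<^sup>+ m. g (spectral u l m) * ennreal (\<bar>l - m\<bar> ^ ?n2) \<partial>lborel \<partial>lborel))"
      by (auto simp: spectral_base_def indicator_def)
  qed
  also have "\<dots> = ?n1 * (ennreal (1 / 2 / 2 ^ ?n2) * (\<integral>\<^sup>+ u. indicator spectral_base u *
      (\<integral>\<^sup>+ l. \<integral>\<^sup>+ m. g (spectral u l m) * ennreal (\<bar>l - m\<bar> ^ ?n2) \<partial>lborel \<partial>lborel) \<partial>lborel))"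
    by (subst nn_integral_cmult) simp_all
  also have "\<dots> = (?n1 * ennreal (1 / 2 / 2 ^ ?n2)) * (\<integral>\<^sup>+ u. indicator spectral_base u *
      (\<integral>\<^sup>+ l. \<integral>\<^sup>+ m. g (spectral u l m) * ennreal (\<bar>l - m\<bar> ^ ?n2) \<partial>lborel \<partial>lborel) \<partial>lborel)"
    by (simp only: mult_ac)
  also have "?n1 * ennreal (1 / 2 / 2 ^ ?n2) = ennreal (spectral_const TYPE('n))"
    by (simp add: ennreal_mult[symmetric] spectral_const_def)
  finally show ?thesis .
qed

section \<open>Two integrals on the line\<close>

lemma nn_integral_even_decay_finite:
  fixes \<beta> :: real
  assumes "1 < \<beta>"
  shows "(\<integral>\<^sup>+ t. ennreal ((1 + t\<^sup>2) powr (- (\<beta> / 2))) \<partial>lborel) < \<infinity>"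
proof -
  have "(\<integral>\<^sup>+ t. ennreal ((1 + t\<^sup>2) powr (- (\<beta> / 2))) \<partial>lborel)
    \<le> (\<integral>\<^sup>+ t. ennreal (2 powr (\<beta> / 2)) * ennreal ((1 + \<bar>t\<bar>) powr (- \<beta>)) \<partial>lborel)"
  proof (rule nn_integral_mono)
    fix t :: real
    have "(1 + \<bar>t\<bar>)\<^sup>2 \<le> 2 * (1 + t\<^sup>2)"
      using sum_squares_bound[of 1 "\<bar>t\<bar>"] by (simp add: power2_eq_square algebra_simps)
    then have "(2 * (1 + t\<^sup>2)) powr (- (\<beta> / 2)) \<le> ((1 + \<bar>t\<bar>)\<^sup>2) powr (- (\<beta> / 2))"
      using assms by (intro powr_mono2') (auto simp: add_pos_nonneg)
    also have "((1 + \<bar>t\<bar>)\<^sup>2) powr (- (\<beta> / 2)) = (1 + \<bar>t\<bar>) powr (- \<beta>)"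
      by (simp add: power2_eq_square powr_mult powr_add[symmetric])
    also have "(2 * (1 + t\<^sup>2)) powr (- (\<beta> / 2)) = 2 powr (- (\<beta> / 2)) * (1 + t\<^sup>2) powr (- (\<beta> / 2))"
      by (rule powr_mult)
    finally have "2 powr (\<beta> / 2) * (2 powr (- (\<beta> / 2)) * (1 + t\<^sup>2) powr (- (\<beta> / 2))) \<le> 2 powr (\<beta> / 2) * (1 + \<bar>t\<bar>) powr (- \<beta>)"
      by (intro mult_left_mono) auto
    then have "(1 + t\<^sup>2) powr (- (\<beta> / 2)) \<le> 2 powr (\<beta> / 2) * (1 + \<bar>t\<bar>) powr (- \<beta>)"
      by (simp add: mult.assoc[symmetric] powr_add[symmetric])
    then show "ennreal ((1 + t\<^sup>2) powr (- (\<beta> / 2))) \<le> ennreal (2 powr (\<beta> / 2)) * ennreal ((1 + \<bar>t\<bar>) powr (- \<beta>))"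
      by (simp add: ennreal_mult[symmetric] ennreal_leI)
  qed
  also have "\<dots> = ennreal (2 powr (\<beta> / 2)) * (\<integral>\<^sup>+ t. ennreal ((1 + \<bar>t\<bar>) powr (- \<beta>)) \<partial>lborel)"
    by (rule nn_integral_cmult) measurable
  also have "(\<integral>\<^sup>+ t. ennreal ((1 + \<bar>t\<bar>) powr (- \<beta>)) \<partial>lborel)
    = 2 * (\<integral>\<^sup>+ t. ennreal ((1 + t) powr (- \<beta>)) * indicator {0..} t \<partial>lborel)"
    by (rule nn_integral_even_real) measurable
  also have "(\<integral>\<^sup>+ t. ennreal ((1 + t) powr (- \<beta>)) * indicator {0..} t \<partial>lborel)
    = ennreal (0 - (1 + 0) powr (1 - \<beta>) / (1 - \<beta>))"
  proof (rule nn_integral_FTC_atLeast[where F = "\<lambda>t. (1 + t) powr (1 - \<beta>) / (1 - \<beta>)" and T = 0])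
    have "filterlim (\<lambda>t::real. 1 + t) at_top at_top"
      by (intro filterlim_tendsto_add_at_top[OF tendsto_const] filterlim_ident)
    then have "((\<lambda>t. (1 + t) powr (1 - \<beta>)) \<longlongrightarrow> 0) at_top"
      using assms by (intro tendsto_neg_powr) auto
    from tendsto_divide[OF this tendsto_const[of "1 - \<beta>"]]
    show "((\<lambda>t. (1 + t) powr (1 - \<beta>) / (1 - \<beta>)) \<longlongrightarrow> 0) at_top" using assms by simp
    fix t :: real assume "0 \<le> t"
    then show "((\<lambda>t. (1 + t) powr (1 - \<beta>) / (1 - \<beta>)) has_real_derivative (1 + t) powr (- \<beta>)) (at t)"
      using assms by (auto intro!: derivative_eq_intros)
  qed auto
  finally show ?thesis by (auto simp: ennreal_mult_less_top intro: le_less_trans)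
qed

lemma nn_integral_powr_ratio_finite:
  fixes \<sigma> :: real
  assumes "0 < \<sigma>"
  shows "(\<integral>\<^sup>+ p. ennreal ((1 + p) powr (- 2 * \<sigma>) * p powr (\<sigma> - 1)) * indicator {0<..} p \<partial>lborel) < \<infinity>"
proof -
  have 1: "(\<integral>\<^sup>+ p. ennreal (p powr (\<sigma> - 1) * indicator {0..1} p) \<partial>lborel) = ennreal (1 / \<sigma>)"
  proof (rule nn_integral_has_integral_lborel)
    have "((\<lambda>x. x powr (\<sigma> - 1)) has_integral (1 powr (\<sigma> - 1 + 1) / (\<sigma> - 1 + 1))) {0..1}"
      using assms by (intro has_integral_powr_from_0) auto
    then have "((\<lambda>x. if x \<in> {0..1} then x powr (\<sigma> - 1) else 0) has_integral 1 / \<sigma>) UNIV"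
      unfolding has_integral_restrict_UNIV by simp
    moreover have "(\<lambda>x. if x \<in> {0..1} then x powr (\<sigma> - 1) else 0) = (\<lambda>p. p powr (\<sigma> - 1) * indicator {0..1} p)"
      by (auto simp: indicator_def)
    ultimately show "((\<lambda>p. p powr (\<sigma> - 1) * indicator {0..1} p) has_integral 1 / \<sigma>) UNIV" by simp
  qed auto
  have 2: "(\<integral>\<^sup>+ p. ennreal (p powr (- \<sigma> - 1) * indicator {1..} p) \<partial>lborel) = ennreal (1 / \<sigma>)"
  proof (rule nn_integral_has_integral_lborel)
    have "((\<lambda>x. x powr (- \<sigma> - 1)) has_integral - (1 powr (- \<sigma> - 1 + 1)) / (- \<sigma> - 1 + 1)) {1..}"
      using assms by (intro has_integral_powr_to_inf) auto
    then have "((\<lambda>x. if x \<in> {1..} then x powr (- \<sigma> - 1) else 0) has_integral 1 / \<sigma>) UNIV"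
      unfolding has_integral_restrict_UNIV by simp
    moreover have "(\<lambda>x. if x \<in> {1..} then x powr (- \<sigma> - 1) else 0) = (\<lambda>p. p powr (- \<sigma> - 1) * indicator {1..} p)"
      by (auto simp: indicator_def)
    ultimately show "((\<lambda>p. p powr (- \<sigma> - 1) * indicator {1..} p) has_integral 1 / \<sigma>) UNIV" by simp
  qed auto
  have "(\<integral>\<^sup>+ p. ennreal ((1 + p) powr (- 2 * \<sigma>) * p powr (\<sigma> - 1)) * indicator {0<..} p \<partial>lborel)
    \<le> (\<integral>\<^sup>+ p. ennreal (p powr (\<sigma> - 1) * indicator {0..1} p) + ennreal (p powr (- \<sigma> - 1) * indicator {1..} p) \<partial>lborel)"
  proof (rule nn_integral_mono)
    fix p :: real
    consider "p \<le> 0" | "0 < p" "p \<le> 1" | "1 < p" by linarith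
    then show "ennreal ((1 + p) powr (- 2 * \<sigma>) * p powr (\<sigma> - 1)) * indicator {0<..} p
      \<le> ennreal (p powr (\<sigma> - 1) * indicator {0..1} p) + ennreal (p powr (- \<sigma> - 1) * indicator {1..} p)"
    proof cases
      case 2
      have "(1 + p) powr (- 2 * \<sigma>) \<le> (1 + p) powr 0" using 2 assms by (intro powr_mono) auto
      then have "(1 + p) powr (- 2 * \<sigma>) * p powr (\<sigma> - 1) \<le> 1 * p powr (\<sigma> - 1)"
        using 2 by (intro mult_right_mono) auto
      then have "ennreal ((1 + p) powr (- 2 * \<sigma>) * p powr (\<sigma> - 1)) * indicator {0<..} p
          \<le> ennreal (p powr (\<sigma> - 1) * indicator {0..1} p)"
        using 2 by (simp add: ennreal_leI)
      then show ?thesis by (rule order_trans) simp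
    next
      case 3
      have "(1 + p) powr (- 2 * \<sigma>) \<le> p powr (- 2 * \<sigma>)" using 3 assms by (intro powr_mono2') auto
      then have "(1 + p) powr (- 2 * \<sigma>) * p powr (\<sigma> - 1) \<le> p powr (- 2 * \<sigma>) * p powr (\<sigma> - 1)"
        by (intro mult_right_mono) auto
      also have "\<dots> = p powr (- \<sigma> - 1)" by (simp add: powr_add[symmetric])
      finally show ?thesis using 3 by (simp add: ennreal_leI)
    qed simp
  qed
  also have "\<dots> = ennreal (1 / \<sigma>) + ennreal (1 / \<sigma>)"
    unfolding 1[symmetric] 2[symmetric] by (subst nn_integral_add) (auto simp: 1 2)
  also have "\<dots> < \<infinity>" by simp
  finally show ?thesis .
qed

section \<open>Integrals of powers of the determinant over horizontal slices\<close>

lemma lorentz_form_spectral: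
  assumes "0 < spatial_norm u"
  shows "lorentz_form (spectral u a b) (spectral u c d) = (a * d + b * c) / 2"
proof -
  define N where "N = spatial_norm u"
  have N: "N\<^sup>2 = (\<Sum>i\<in>UNIV - {1}. (u $ i)\<^sup>2)" "N > 0" using assms by (simp_all add: N_def spatial_norm_sq)
  have "(\<Sum>i\<in>UNIV - {1}. spectral u a b $ i * spectral u c d $ i)
      = (\<Sum>i\<in>UNIV - {1}. ((a - b) / 2 / N * ((c - d) / 2 / N)) * (u $ i)\<^sup>2)"
    by (intro sum.cong) (auto simp: N_def power2_eq_square)
  also have "\<dots> = (a - b) / 2 / N * ((c - d) / 2 / N) * N\<^sup>2"
    by (simp only: N(1) sum_distrib_left)
  also have "\<dots> = (a - b) * (c - d) / 4" using N(2) by (simp add: power2_eq_square)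
  finally have "lorentz_form (spectral u a b) (spectral u c d) = (a + b) / 2 * ((c + d) / 2) - (a - b) * (c - d) / 4"
    by (simp add: lorentz_form_def)
  also have "\<dots> = (a * d + b * c) / 2" by (simp add: field_simps)
  finally show ?thesis .
qed

lemma lorentz_det_spectral: "0 < spatial_norm u \<Longrightarrow> lorentz_det (spectral u a b) = a * b"
  by (simp add: lorentz_det_eq_form lorentz_form_spectral)

lemma spectral_in_cone:
  assumes "0 < spatial_norm u" "0 < a" "0 < b"
  shows "spectral u a b \<in> lorentz_cone"
  using assms by (simp add: lorentz_cone_def lorentz_det_spectral)

lemma spectral_one: "spectral u 1 1 = time_axis"
  by (simp add: vec_eq_iff)

definition spectral_complex :: "real ^ 'n::{finite,one} \<Rightarrow> complex \<Rightarrow> complex \<Rightarrow> complex ^ 'n::{finite,one}" where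
  "spectral_complex u l m = re_im_vec (spectral u (Re l) (Re m)) (spectral u (Im l) (Im m))"

lemma tube_det_spectral_complex:
  assumes "0 < spatial_norm u"
  shows "tube_det (spectral_complex u l m) = - (l * m)"
  by (simp add: spectral_complex_def tube_det_re_im lorentz_det_spectral[OF assms]
      lorentz_form_spectral[OF assms] complex_eq_iff)

lemma spectral_complex_nth:
  "spectral_complex u l m $ i = (if i = 1 then (l + m) / 2 else (l - m) / 2 * complex_of_real (u $ i / spatial_norm u))"
  by (simp add: spectral_complex_def re_im_vec_def complex_eq_iff)

lemma re_im_vec_add: "re_im_vec x y + re_im_vec u v = re_im_vec (x + u) (y + v)"
  by (simp add: re_im_vec_def vec_eq_iff complex_eq_iff)

lemma continuous_on_re_im_vec [continuous_intros]:
  fixes f g :: "'b::topological_space \<Rightarrow> (real, 'n::finite) vec"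
  assumes "continuous_on S f" "continuous_on S g"
  shows "continuous_on S (\<lambda>x. re_im_vec (f x) (g x))"
  unfolding re_im_vec_def Complex_eq
  by (intro continuous_on_vec_lambda continuous_intros assms)

lemma continuous_on_tube_det [continuous_intros]:
  fixes f :: "'b::topological_space \<Rightarrow> (complex, 'n::{finite,one}) vec"
  assumes "continuous_on S f"
  shows "continuous_on S (\<lambda>x. tube_det (f x))"
  unfolding tube_det_def by (intro continuous_intros assms)

lemma re_im_vec_measurable [measurable (raw)]:
  fixes f g :: "_ \<Rightarrow> (real, 'n::finite) vec"
  assumes [measurable]: "f \<in> borel_measurable M" "g \<in> borel_measurable M"
  shows "(\<lambda>x. re_im_vec (f x) (g x)) \<in> borel_measurable M"
  by (rule borel_measurable_continuous_on[where f = "\<lambda>(x, y). re_im_vec x y" and g = "\<lambda>x. (f x, g x)", simplified])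
     (auto intro!: continuous_intros simp: case_prod_beta)

lemma tube_det_measurable [measurable]: "tube_det \<in> borel_measurable borel"
  by (intro borel_measurable_continuous_onI continuous_intros)

definition tube_det_mass :: "real \<Rightarrow> 'n::{finite,one} itself \<Rightarrow> ennreal" where
  "tube_det_mass \<alpha> _ = (\<integral>\<^sup>+ x. ennreal (cmod (tube_det (re_im_vec (x::(real,'n) vec) time_axis)) powr (- \<alpha>)) \<partial>lborel)"

text \<open>
  By homogeneity only the slice through \<open>i e\<close> has to be understood.
\<close>

lemma nn_integral_tube_det_powr:
  fixes y :: "(real,'n::{finite,one}) vec"
  assumes y: "y \<in> lorentz_cone"
  shows "(\<integral>\<^sup>+ x. ennreal (cmod (tube_det (re_im_vec x y)) powr (- \<alpha>)) \<partial>lborel)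
    = tube_det_mass \<alpha> TYPE('n) * ennreal (lorentz_det y powr (real CARD('n) / 2 - \<alpha>))"
proof -
  have d: "lorentz_det y > 0" using y by (rule lorentz_coneD)
  have "(\<integral>\<^sup>+ x. ennreal (cmod (tube_det (re_im_vec x y)) powr (- \<alpha>)) \<partial>lborel)
    = ennreal (lorentz_det y powr (real CARD('n) / 2)) *
      (\<integral>\<^sup>+ x. ennreal (cmod (tube_det (re_im_vec (conformal_map y x) (conformal_map y time_axis))) powr (- \<alpha>)) \<partial>lborel)"
    unfolding conformal_map_time_axis[OF y] by (rule nn_integral_conformal_map[OF y]) measurable
  also have "(\<integral>\<^sup>+ x. ennreal (cmod (tube_det (re_im_vec (conformal_map y x) (conformal_map y time_axis))) powr (- \<alpha>)) \<partial>lborel)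
    = (\<integral>\<^sup>+ x. ennreal (lorentz_det y powr (- \<alpha>)) * ennreal (cmod (tube_det (re_im_vec (x::(real,'n) vec) time_axis)) powr (- \<alpha>)) \<partial>lborel)"
    unfolding tube_det_conformal_map[OF y] using d
    by (intro nn_integral_cong) (simp add: norm_mult powr_mult ennreal_mult)
  also have "\<dots> = ennreal (lorentz_det y powr (- \<alpha>)) * tube_det_mass \<alpha> TYPE('n)"
    unfolding tube_det_mass_def by (rule nn_integral_cmult) measurable
  finally have "(\<integral>\<^sup>+ x. ennreal (cmod (tube_det (re_im_vec x y)) powr (- \<alpha>)) \<partial>lborel)
    = tube_det_mass \<alpha> TYPE('n) * (ennreal (lorentz_det y powr (real CARD('n) / 2)) * ennreal (lorentz_det y powr (- \<alpha>)))"
    by (simp only: mult_ac)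
  also have "ennreal (lorentz_det y powr (real CARD('n) / 2)) * ennreal (lorentz_det y powr (- \<alpha>))
    = ennreal (lorentz_det y powr (real CARD('n) / 2 - \<alpha>))"
    by (simp add: ennreal_mult[symmetric] powr_add[symmetric])
  finally show ?thesis .
qed

lemma norm_tube_det_spectral:
  assumes "0 < spatial_norm u"
  shows "cmod (tube_det (re_im_vec (spectral u l m) time_axis)) = sqrt ((1 + l\<^sup>2) * (1 + m\<^sup>2))"
proof -
  have "re_im_vec (spectral u l m) time_axis = spectral_complex u (Complex l 1) (Complex m 1)"
    by (simp add: spectral_complex_def spectral_one)
  then have "cmod (tube_det (re_im_vec (spectral u l m) time_axis)) = cmod (Complex l 1) * cmod (Complex m 1)"
    by (simp only: tube_det_spectral_complex[OF assms] norm_minus_cancel norm_mult)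
  then show ?thesis
    by (simp add: cmod_def real_sqrt_mult add.commute)
qed

text \<open>
  In spectral coordinates the integrand is
  \<open>((1 + l\<^sup>2)(1 + m\<^sup>2))\<^bsup>-\<alpha>/2\<^esup> \<bar>l - m\<bar>\<^bsup>n-2\<^esup>\<close>, and \<open>(l - m)\<^sup>2 \<le> (1 + l\<^sup>2)(1 + m\<^sup>2)\<close>
  leaves the product of two one-dimensional integrals with exponent \<open>\<alpha> - (n - 2) > 1\<close>.
\<close>

lemma tube_det_mass_finite:
  assumes n: "2 \<le> CARD('n::{finite,one})" and \<alpha>: "real CARD('n) - 1 < \<alpha>"
  shows "tube_det_mass \<alpha> TYPE('n) < \<infinity>"
proof -
  define k where "k = CARD('n) - 2"
  have k: "real k = real CARD('n) - 2" using n by (simp add: k_def)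
  define \<beta> where "\<beta> = \<alpha> - real k"
  have \<beta>: "1 < \<beta>" using \<alpha> by (simp add: \<beta>_def k)
  let ?J = "\<integral>\<^sup>+ t. ennreal ((1 + t\<^sup>2) powr (- (\<beta> / 2))) \<partial>lborel"
  let ?W = "\<lambda>u::(real,'n) vec. \<integral>\<^sup>+ l. \<integral>\<^sup>+ m. ennreal (cmod (tube_det (re_im_vec (spectral u l m) time_axis)) powr (- \<alpha>)) * ennreal (\<bar>l - m\<bar> ^ k) \<partial>lborel \<partial>lborel"
  have bound: "sqrt ((1 + l\<^sup>2) * (1 + m\<^sup>2)) powr (- \<alpha>) * \<bar>l - m\<bar> ^ k
      \<le> (1 + l\<^sup>2) powr (- (\<beta> / 2)) * (1 + m\<^sup>2) powr (- (\<beta> / 2))" for l m :: real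
  proof -
    define A where "A = sqrt ((1 + l\<^sup>2) * (1 + m\<^sup>2))"
    have pos: "1 + l\<^sup>2 > 0" "1 + m\<^sup>2 > 0" by (auto simp: add_pos_nonneg)
    then have A: "A > 0" by (simp add: A_def)
    have "(l - m)\<^sup>2 \<le> (1 + l\<^sup>2) * (1 + m\<^sup>2)"
      using zero_le_power2[of "1 + l * m"] by (simp add: power2_eq_square algebra_simps)
    then have "\<bar>l - m\<bar> \<le> A" unfolding A_def by (simp add: real_le_rsqrt)
    then have "\<bar>l - m\<bar> ^ k \<le> A ^ k" by (intro power_mono) auto
    then have "A powr (- \<alpha>) * \<bar>l - m\<bar> ^ k \<le> A powr (- \<alpha>) * A powr (real k)"
      using A by (intro mult_left_mono) (auto simp: powr_realpow)
    also have "\<dots> = A powr (- \<beta>)" by (simp add: powr_add[symmetric] \<beta>_def)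
    also have "A powr (- \<beta>) = (((1 + l\<^sup>2) * (1 + m\<^sup>2)) powr (1 / 2)) powr (- \<beta>)"
      unfolding A_def using pos by (simp add: powr_half_sqrt)
    also have "\<dots> = (1 + l\<^sup>2) powr (- (\<beta> / 2)) * (1 + m\<^sup>2) powr (- (\<beta> / 2))"
      using pos by (simp add: powr_powr powr_mult)
    finally show ?thesis unfolding A_def .
  qed
  have "tube_det_mass \<alpha> TYPE('n) = ennreal (spectral_const TYPE('n)) *
    (\<integral>\<^sup>+ u. indicator spectral_base (u::(real,'n) vec) *
      ?W u \<partial>lborel)"
    unfolding tube_det_mass_def k_def by (rule nn_integral_spectral[OF n]) measurable
  also have "\<dots> \<le> ennreal (spectral_const TYPE('n)) * (\<integral>\<^sup>+ u. indicator spectral_base (u::(real,'n) vec) * (?J * ?J) \<partial>lborel)"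
  proof (rule mult_left_mono, rule nn_integral_mono)
    fix u :: "(real,'n) vec"
    have "?W u
       \<le> ?J * ?J" if u: "u \<in> spectral_base"
    proof -
      have u': "0 < spatial_norm u" using u by (simp add: spectral_base_def)
      have "?W u
        \<le> (\<integral>\<^sup>+ l. \<integral>\<^sup>+ m. ennreal ((1 + l\<^sup>2) powr (- (\<beta> / 2))) * ennreal ((1 + m\<^sup>2) powr (- (\<beta> / 2))) \<partial>lborel \<partial>lborel)"
        using bound
        by (intro nn_integral_mono) (simp add: norm_tube_det_spectral[OF u'] ennreal_mult[symmetric] ennreal_leI)
      also have "\<dots> = ?J * ?J" by (simp add: nn_integral_cmult nn_integral_multc)
      finally show ?thesis .
    qed
    then show "indicator spectral_base u * ?W u
       \<le> indicator spectral_base u * (?J * ?J)"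
      by (auto simp: indicator_def)
  qed auto
  also have "\<dots> = ennreal (spectral_const TYPE('n)) * (emeasure lborel (spectral_base::(real,'n) vec set) * (?J * ?J))"
    by (subst nn_integral_multc) auto
  also have "\<dots> < \<infinity>"
    using emeasure_spectral_base[where 'n='n] nn_integral_even_decay_finite[OF \<beta>]
    by (simp add: ennreal_mult_less_top)
  finally show ?thesis .
qed

section \<open>The circle fibration of the Poisson density\<close>

text \<open>
  The range of the principal branch of the arctangent.
\<close>

abbreviation quarter_turns :: "real set" where
  "quarter_turns \<equiv> {- (pi / 2)<..<pi / 2}"

lemma tan_measurable [measurable]: "(tan :: real \<Rightarrow> real) \<in> borel_measurable borel"
  unfolding tan_def[abs_def] by measurable

lemma lborel_eq_distr_tan:
  "lborel = distr (density lborel (\<lambda>\<phi>. indicator quarter_turns \<phi> * ennreal (1 / (cos \<phi>)\<^sup>2))) borel (tan :: real \<Rightarrow> real)"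
proof (rule lborel_eqI)
  fix l u :: real assume "\<And>b. b \<in> Basis \<Longrightarrow> l \<bullet> b \<le> u \<bullet> b"
  then have lu: "l \<le> u" by simp
  have "tan -` {l<..<u} \<in> sets borel"
    using measurable_sets[OF tan_measurable, of "{l<..<u}"] by simp
  then have "emeasure (distr (density lborel (\<lambda>\<phi>. indicator quarter_turns \<phi> * ennreal (1 / (cos \<phi>)\<^sup>2))) borel tan) (box l u)
    = (\<integral>\<^sup>+ \<phi>. indicator quarter_turns \<phi> * ennreal (1 / (cos \<phi>)\<^sup>2) * indicator {l<..<u} (tan \<phi>) \<partial>lborel)"
    by (subst emeasure_distr, simp_all, subst emeasure_density) (auto intro!: nn_integral_cong simp: indicator_def)
  also have "\<dots> = (\<integral>\<^sup>+ \<phi>. ennreal (1 / (cos \<phi>)\<^sup>2) * indicator {arctan l..arctan u} \<phi> \<partial>lborel)"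
  proof (rule nn_integral_cong_AE)
    have eq: "(\<phi> \<in> quarter_turns \<and> tan \<phi> \<in> {l<..<u}) \<longleftrightarrow> \<phi> \<in> {arctan l..arctan u}"
      if "\<phi> \<noteq> arctan l" "\<phi> \<noteq> arctan u" for \<phi>
    proof
      assume *: "\<phi> \<in> quarter_turns \<and> tan \<phi> \<in> {l<..<u}"
      then have "\<phi> = arctan (tan \<phi>)" by (simp add: arctan_tan)
      moreover have "arctan l \<le> arctan (tan \<phi>)" "arctan (tan \<phi>) \<le> arctan u" using * by (auto simp: arctan_le_iff)
      ultimately show "\<phi> \<in> {arctan l..arctan u}" by simp
    next
      assume "\<phi> \<in> {arctan l..arctan u}"
      with that have *: "arctan l < \<phi>" "\<phi> < arctan u" by auto
      then have q: "- (pi / 2) < \<phi>" "\<phi> < pi / 2"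
        using arctan_lbound[of l] arctan_ubound[of u] by linarith+
      then have "arctan (tan \<phi>) = \<phi>" by (intro arctan_tan) auto
      with * have "l < tan \<phi>" "tan \<phi> < u" by (metis arctan_less_iff)+
      with q show "\<phi> \<in> quarter_turns \<and> tan \<phi> \<in> {l<..<u}" by simp
    qed
    show "AE \<phi> in lborel. indicator quarter_turns \<phi> * ennreal (1 / (cos \<phi>)\<^sup>2) * indicator {l<..<u} (tan \<phi>)
        = ennreal (1 / (cos \<phi>)\<^sup>2) * indicator {arctan l..arctan u} \<phi>"
      using AE_lborel_singleton[of "arctan l"] AE_lborel_singleton[of "arctan u"]
    proof eventually_elim
      case (elim \<phi>)
      then show ?case using eq[of \<phi>] by (auto simp: indicator_def)
    qed
  qed
  also have "\<dots> = ennreal (tan (arctan u) - tan (arctan l))"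
  proof (rule nn_integral_FTC_Icc)
    show "arctan l \<le> arctan u" using lu by (simp add: arctan_le_iff)
    fix \<phi> assume "\<phi> \<in> {arctan l..arctan u}"
    then have "- (pi / 2) < \<phi>" "\<phi> < pi / 2"
      using arctan_lbound[of l] arctan_ubound[of u] by auto
    then have "cos \<phi> \<noteq> 0" using cos_gt_zero_pi[of \<phi>] by simp
    then show "(tan has_real_derivative 1 / (cos \<phi>)\<^sup>2) (at \<phi>)"
      using DERIV_tan[of \<phi>] by (simp add: inverse_eq_divide)
  qed auto
  also have "\<dots> = ennreal (\<Prod>b\<in>Basis. (u - l) \<bullet> b)" by (simp add: tan_arctan)
  finally show "emeasure (distr (density lborel (\<lambda>\<phi>. indicator quarter_turns \<phi> * ennreal (1 / (cos \<phi>)\<^sup>2))) borel tan) (box l u)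
    = ennreal (\<Prod>b\<in>Basis. (u - l) \<bullet> b)" .
qed simp

lemma nn_integral_tan:
  assumes [measurable]: "g \<in> borel_measurable borel"
  shows "(\<integral>\<^sup>+ t. g t \<partial>lborel) = (\<integral>\<^sup>+ \<phi>. indicator quarter_turns \<phi> * (ennreal (1 / (cos \<phi>)\<^sup>2) * g (tan \<phi>)) \<partial>lborel)"
  by (subst lborel_eq_distr_tan) (simp add: nn_integral_distr nn_integral_density mult.assoc)

lemma nn_integral_periodic_window:
  fixes H :: "real \<Rightarrow> ennreal"
  assumes [measurable]: "H \<in> borel_measurable borel" and H: "\<And>t. H (t + P) = H t" and ab: "a \<le> b" "b \<le> a + P"
  shows "(\<integral>\<^sup>+ t. indicator {a<..a + P} t * H t \<partial>lborel) = (\<integral>\<^sup>+ t. indicator {b<..b + P} t * H t \<partial>lborel)"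
proof -
  have "(\<integral>\<^sup>+ t. indicator {a<..a + P} t * H t \<partial>lborel)
    = (\<integral>\<^sup>+ t. indicator {a<..b} t * H t + indicator {b<..a + P} t * H t \<partial>lborel)"
    using ab by (intro nn_integral_cong) (auto simp: indicator_def)
  also have "\<dots> = (\<integral>\<^sup>+ t. indicator {a<..b} t * H t \<partial>lborel) + (\<integral>\<^sup>+ t. indicator {b<..a + P} t * H t \<partial>lborel)"
    by (rule nn_integral_add) measurable
  also have "(\<integral>\<^sup>+ t. indicator {a<..b} t * H t \<partial>lborel) = (\<integral>\<^sup>+ t. indicator {a + P<..b + P} t * H t \<partial>lborel)"
    by (subst (2) nn_integral_lborel_translate[of _ P, symmetric])
       (auto intro!: nn_integral_cong simp: indicator_def H add.commute[of P])
  also have "\<dots> + (\<integral>\<^sup>+ t. indicator {b<..a + P} t * H t \<partial>lborel)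
    = (\<integral>\<^sup>+ t. indicator {a + P<..b + P} t * H t + indicator {b<..a + P} t * H t \<partial>lborel)"
    by (rule nn_integral_add[symmetric]) measurable
  also have "\<dots> = (\<integral>\<^sup>+ t. indicator {b<..b + P} t * H t \<partial>lborel)"
    using ab by (intro nn_integral_cong) (auto simp: indicator_def)
  finally show ?thesis .
qed

text \<open>
  Used with \<open>H\<close> depending on \<open>tan\<close>: for a fixed angle \<open>\<phi>\<close>, the second angle \<open>\<psi>\<close> is replaced by the difference
  \<open>\<delta> = \<phi> - \<psi>\<close>, which is only defined modulo \<open>\<pi>\<close>.
\<close>

lemma nn_integral_periodic_reflect:
  fixes H :: "real \<Rightarrow> ennreal"
  assumes [measurable]: "H \<in> borel_measurable borel" and H: "\<And>t. H (t + pi) = H t" and \<phi>: "\<phi> \<in> quarter_turns"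
  shows "(\<integral>\<^sup>+ \<delta>. indicator quarter_turns \<delta> * H (\<phi> - \<delta>) \<partial>lborel) = (\<integral>\<^sup>+ \<psi>. indicator quarter_turns \<psi> * H \<psi> \<partial>lborel)"
proof -
  have half: "(\<integral>\<^sup>+ t. indicator {a<..<a + pi} t * H t \<partial>lborel) = (\<integral>\<^sup>+ t. indicator {a<..a + pi} t * H t \<partial>lborel)" for a
  proof (rule nn_integral_cong_AE)
    show "AE t in lborel. indicator {a<..<a + pi} t * H t = indicator {a<..a + pi} t * H t"
      using AE_lborel_singleton[of "a + pi"] by eventually_elim (auto simp: indicator_def)
  qed
  have window: "(\<integral>\<^sup>+ t. indicator {\<phi> - pi / 2<..\<phi> - pi / 2 + pi} t * H t \<partial>lborel)
    = (\<integral>\<^sup>+ t. indicator {- (pi / 2)<..- (pi / 2) + pi} t * H t \<partial>lborel)"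
  proof (cases "\<phi> \<ge> 0")
    case True
    show ?thesis
      by (rule nn_integral_periodic_window[symmetric]) (use True \<phi> H in auto)
  next
    case False
    show ?thesis
      by (rule nn_integral_periodic_window) (use False \<phi> H in auto)
  qed
  have "(\<integral>\<^sup>+ \<delta>. indicator quarter_turns \<delta> * H (\<phi> - \<delta>) \<partial>lborel)
    = (\<integral>\<^sup>+ t. indicator {\<phi> - pi / 2<..<\<phi> - pi / 2 + pi} t * H t \<partial>lborel)"
    by (subst (2) nn_integral_real_affine[where c = "-1" and t = \<phi>])
       (auto intro!: nn_integral_cong simp: indicator_def)
  also have "\<dots> = (\<integral>\<^sup>+ t. indicator {- (pi / 2)<..<- (pi / 2) + pi} t * H t \<partial>lborel)"
    unfolding half by (rule window)
  finally show ?thesis by simp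
qed

text \<open>
  The Poisson density disintegrates along circles. With \<open>l = tan \<phi>\<close>, \<open>m = tan \<psi>\<close> and \<open>\<delta> = \<phi> - \<psi>\<close> one has
  \<open>\<bar>l - m\<bar> = \<bar>sin \<delta>\<bar> / (cos \<phi> cos \<psi>)\<close>, and all powers of the cosines cancel
  precisely for the exponent \<open>n\<close> of the density. For fixed \<open>u\<close> and \<open>\<delta>\<close> the inner integral runs, with
  uniform weight, over an orbit of the circle group that fixes \<open>i e\<close>.
\<close>

lemma nn_integral_circle_fibration:
  fixes g :: "(real, 'n::{finite,one}) vec \<Rightarrow> ennreal"
  assumes n: "2 \<le> CARD('n)" and [measurable]: "g \<in> borel_measurable borel"
  shows "(\<integral>\<^sup>+ u. ennreal (cmod (tube_det (re_im_vec u time_axis)) powr (- real CARD('n))) * g u \<partial>lborel)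
    = ennreal (spectral_const TYPE('n)) *
    (\<integral>\<^sup>+ u. indicator spectral_base u * (\<integral>\<^sup>+ \<delta>. indicator quarter_turns \<delta> * ennreal (\<bar>sin \<delta>\<bar> ^ (CARD('n) - 2)) *
      (\<integral>\<^sup>+ \<phi>. indicator quarter_turns \<phi> * g (spectral u (tan \<phi>) (tan (\<phi> - \<delta>))) \<partial>lborel) \<partial>lborel) \<partial>lborel)"
proof -
  define k where "k = CARD('n) - 2"
  have k: "CARD('n) = k + 2" using n by (simp add: k_def)
  have key: "1 / (cos a)\<^sup>2 * (1 / (cos b)\<^sup>2 * (sqrt ((1 + (tan a)\<^sup>2) * (1 + (tan b)\<^sup>2)) powr (- real CARD('n)) * \<bar>tan a - tan b\<bar> ^ k))
      = \<bar>sin (a - b)\<bar> ^ k" if "a \<in> quarter_turns" "b \<in> quarter_turns" for a b :: real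
  proof -
    have c: "cos a > 0" "cos b > 0" using that by (auto intro!: cos_gt_zero_pi)
    have t: "1 + (tan a)\<^sup>2 = 1 / (cos a)\<^sup>2" "1 + (tan b)\<^sup>2 = 1 / (cos b)\<^sup>2"
      using c by (simp_all add: tan_sec inverse_eq_divide power_one_over)
    have s: "sqrt ((1 + (tan a)\<^sup>2) * (1 + (tan b)\<^sup>2)) = 1 / (cos a * cos b)"
      using c unfolding t by (simp add: real_sqrt_mult real_sqrt_divide)
    have "(1 / x) powr (- real CARD('n)) = x ^ CARD('n)" if "0 < x" for x :: real
      using that by (simp add: powr_minus powr_divide powr_realpow)
    then have "(1 / (cos a * cos b)) powr (- real CARD('n)) = (cos a * cos b) ^ (k + 2)"
      using c unfolding k[symmetric] by simp
    moreover have "tan a - tan b = sin (a - b) / (cos a * cos b)"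
      using c by (simp add: tan_def sin_diff field_simps)
    moreover define x where "x = cos a * cos b"
    moreover have "1 / (cos a)\<^sup>2 * (1 / (cos b)\<^sup>2 * (x ^ (k + 2) * \<bar>sin (a - b) / x\<bar> ^ k)) = \<bar>sin (a - b)\<bar> ^ k"
    proof -
      have "x > 0" using c by (simp add: x_def)
      have "1 / (cos a)\<^sup>2 * (1 / (cos b)\<^sup>2 * y) = 1 / x\<^sup>2 * y" for y
        by (simp add: x_def power_mult_distrib)
      moreover have "x ^ (k + 2) = x ^ k * x\<^sup>2" by (rule power_add)
      moreover have "\<bar>sin (a - b) / x\<bar> ^ k = \<bar>sin (a - b)\<bar> ^ k / x ^ k"
        using \<open>x > 0\<close> by (simp add: power_divide)
      ultimately have "1 / (cos a)\<^sup>2 * (1 / (cos b)\<^sup>2 * (x ^ (k + 2) * \<bar>sin (a - b) / x\<bar> ^ k))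
        = 1 / x\<^sup>2 * (x ^ k * x\<^sup>2 * (\<bar>sin (a - b)\<bar> ^ k / x ^ k))"
        by (simp only:)
      then show ?thesis using \<open>x > 0\<close> by simp
    qed
    ultimately show ?thesis by (simp add: s)
  qed
  have inner: "(\<integral>\<^sup>+ l. \<integral>\<^sup>+ m. ennreal (cmod (tube_det (re_im_vec (spectral u l m) time_axis)) powr (- real CARD('n))) * g (spectral u l m) * ennreal (\<bar>l - m\<bar> ^ k) \<partial>lborel \<partial>lborel)
    = (\<integral>\<^sup>+ \<delta>. indicator quarter_turns \<delta> * ennreal (\<bar>sin \<delta>\<bar> ^ k) *
      (\<integral>\<^sup>+ \<phi>. indicator quarter_turns \<phi> * g (spectral u (tan \<phi>) (tan (\<phi> - \<delta>))) \<partial>lborel) \<partial>lborel)"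
    if u: "u \<in> spectral_base" for u :: "(real,'n) vec"
  proof -
    have u': "0 < spatial_norm u" using u by (simp add: spectral_base_def)
    let ?w = "\<lambda>l m. ennreal (sqrt ((1 + l\<^sup>2) * (1 + m\<^sup>2)) powr (- real CARD('n))) * g (spectral u l m) * ennreal (\<bar>l - m\<bar> ^ k)"
    have "(\<integral>\<^sup>+ l. \<integral>\<^sup>+ m. ?w l m \<partial>lborel \<partial>lborel)
      = (\<integral>\<^sup>+ a. indicator quarter_turns a * (ennreal (1 / (cos a)\<^sup>2) * (\<integral>\<^sup>+ b. indicator quarter_turns b * (ennreal (1 / (cos b)\<^sup>2) * ?w (tan a) (tan b)) \<partial>lborel)) \<partial>lborel)"
      by (subst nn_integral_tan, simp, subst nn_integral_tan) simp_all
    also have "\<dots> = (\<integral>\<^sup>+ a. indicator quarter_turns a * (\<integral>\<^sup>+ b. indicator quarter_turns b * (g (spectral u (tan a) (tan b)) * ennreal (\<bar>sin (a - b)\<bar> ^ k)) \<partial>lborel) \<partial>lborel)"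
    proof (rule nn_integral_cong)
      fix a :: real
      show "indicator quarter_turns a * (ennreal (1 / (cos a)\<^sup>2) * (\<integral>\<^sup>+ b. indicator quarter_turns b * (ennreal (1 / (cos b)\<^sup>2) * ?w (tan a) (tan b)) \<partial>lborel))
        = indicator quarter_turns a * (\<integral>\<^sup>+ b. indicator quarter_turns b * (g (spectral u (tan a) (tan b)) * ennreal (\<bar>sin (a - b)\<bar> ^ k)) \<partial>lborel)"
      proof (cases "a \<in> quarter_turns")
        case True
        have "ennreal (1 / (cos a)\<^sup>2) * (\<integral>\<^sup>+ b. indicator quarter_turns b * (ennreal (1 / (cos b)\<^sup>2) * ?w (tan a) (tan b)) \<partial>lborel)
          = (\<integral>\<^sup>+ b. ennreal (1 / (cos a)\<^sup>2) * (indicator quarter_turns b * (ennreal (1 / (cos b)\<^sup>2) * ?w (tan a) (tan b))) \<partial>lborel)"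
          by (rule nn_integral_cmult[symmetric]) measurable
        also have "\<dots> = (\<integral>\<^sup>+ b. indicator quarter_turns b * (g (spectral u (tan a) (tan b)) * ennreal (\<bar>sin (a - b)\<bar> ^ k)) \<partial>lborel)"
        proof (rule nn_integral_cong)
          fix b :: real
          show "ennreal (1 / (cos a)\<^sup>2) * (indicator quarter_turns b * (ennreal (1 / (cos b)\<^sup>2) * ?w (tan a) (tan b)))
            = indicator quarter_turns b * (g (spectral u (tan a) (tan b)) * ennreal (\<bar>sin (a - b)\<bar> ^ k))"
          proof (cases "b \<in> quarter_turns")
            case b: True
            have "ennreal (1 / (cos a)\<^sup>2) * (ennreal (1 / (cos b)\<^sup>2) * ?w (tan a) (tan b))
              = (ennreal (1 / (cos a)\<^sup>2) * (ennreal (1 / (cos b)\<^sup>2) * (ennreal (sqrt ((1 + (tan a)\<^sup>2) * (1 + (tan b)\<^sup>2)) powr (- real CARD('n))) * ennreal (\<bar>tan a - tan b\<bar> ^ k)))) * g (spectral u (tan a) (tan b))"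
              by (simp only: mult_ac)
            also have "ennreal (1 / (cos a)\<^sup>2) * (ennreal (1 / (cos b)\<^sup>2) * (ennreal (sqrt ((1 + (tan a)\<^sup>2) * (1 + (tan b)\<^sup>2)) powr (- real CARD('n))) * ennreal (\<bar>tan a - tan b\<bar> ^ k)))
              = ennreal (\<bar>sin (a - b)\<bar> ^ k)"
              unfolding key[OF True b, symmetric] by (simp add: ennreal_mult[symmetric])
            finally show ?thesis using b by (simp add: mult.commute)
          qed simp
        qed
        finally show ?thesis by simp
      qed simp
    qed
    also have "\<dots> = (\<integral>\<^sup>+ a. indicator quarter_turns a * (\<integral>\<^sup>+ \<delta>. indicator quarter_turns \<delta> * (g (spectral u (tan a) (tan (a - \<delta>))) * ennreal (\<bar>sin \<delta>\<bar> ^ k)) \<partial>lborel) \<partial>lborel)"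
    proof (rule nn_integral_cong)
      fix a :: real
      let ?H = "\<lambda>b. g (spectral u (tan a) (tan b)) * ennreal (\<bar>sin (a - b)\<bar> ^ k)"
      have per: "?H (t + pi) = ?H t" for t
      proof -
        \<comment> \<open>the absolute value of the sine has period \<open>\<pi>\<close>, like the tangent\<close>
        have "sin (a - (t + pi)) = - sin (a - t)"
          using sin_minus_pi[of "a - t"] by (simp add: algebra_simps)
        then show ?thesis by simp
      qed
      show "indicator quarter_turns a * (\<integral>\<^sup>+ b. indicator quarter_turns b * ?H b \<partial>lborel)
        = indicator quarter_turns a * (\<integral>\<^sup>+ \<delta>. indicator quarter_turns \<delta> * (g (spectral u (tan a) (tan (a - \<delta>))) * ennreal (\<bar>sin \<delta>\<bar> ^ k)) \<partial>lborel)"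
        using nn_integral_periodic_reflect[of ?H a, OF _ per] by (cases "a \<in> quarter_turns") auto
    qed
    also have "\<dots> = (\<integral>\<^sup>+ a. \<integral>\<^sup>+ \<delta>. indicator quarter_turns a * (indicator quarter_turns \<delta> * (g (spectral u (tan a) (tan (a - \<delta>))) * ennreal (\<bar>sin \<delta>\<bar> ^ k))) \<partial>lborel \<partial>lborel)"
      by (simp add: nn_integral_cmult)
    also have "\<dots> = (\<integral>\<^sup>+ \<delta>. \<integral>\<^sup>+ a. indicator quarter_turns a * (indicator quarter_turns \<delta> * (g (spectral u (tan a) (tan (a - \<delta>))) * ennreal (\<bar>sin \<delta>\<bar> ^ k))) \<partial>lborel \<partial>lborel)"
      by (intro lborel_pair.Fubini') measurable
    also have "\<dots> = (\<integral>\<^sup>+ \<delta>. indicator quarter_turns \<delta> * ennreal (\<bar>sin \<delta>\<bar> ^ k) *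
      (\<integral>\<^sup>+ \<phi>. indicator quarter_turns \<phi> * g (spectral u (tan \<phi>) (tan (\<phi> - \<delta>))) \<partial>lborel) \<partial>lborel)"
      by (subst nn_integral_cmult[symmetric]) (auto intro!: nn_integral_cong simp: mult_ac)
    finally show ?thesis by (simp add: norm_tube_det_spectral[OF u'])
  qed
  have "(\<integral>\<^sup>+ u. ennreal (cmod (tube_det (re_im_vec u time_axis)) powr (- real CARD('n))) * g u \<partial>lborel)
    = ennreal (spectral_const TYPE('n)) * (\<integral>\<^sup>+ u. indicator spectral_base u *
     (\<integral>\<^sup>+ l. \<integral>\<^sup>+ m. ennreal (cmod (tube_det (re_im_vec (spectral u l m) time_axis)) powr (- real CARD('n))) * g (spectral u l m) * ennreal (\<bar>l - m\<bar> ^ k) \<partial>lborel \<partial>lborel) \<partial>lborel)"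
    unfolding k_def by (rule nn_integral_spectral[OF n]) measurable
  also have "(\<integral>\<^sup>+ u. indicator spectral_base u *
     (\<integral>\<^sup>+ l. \<integral>\<^sup>+ m. ennreal (cmod (tube_det (re_im_vec (spectral u l m) time_axis)) powr (- real CARD('n))) * g (spectral u l m) * ennreal (\<bar>l - m\<bar> ^ k) \<partial>lborel \<partial>lborel) \<partial>lborel)
    = (\<integral>\<^sup>+ u. indicator spectral_base u * (\<integral>\<^sup>+ \<delta>. indicator quarter_turns \<delta> * ennreal (\<bar>sin \<delta>\<bar> ^ k) *
      (\<integral>\<^sup>+ \<phi>. indicator quarter_turns \<phi> * g (spectral u (tan \<phi>) (tan (\<phi> - \<delta>))) \<partial>lborel) \<partial>lborel) \<partial>lborel)"
    by (rule nn_integral_cong) (simp add: inner indicator_def)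
  finally show ?thesis unfolding k_def .
qed

section \<open>Mean values of holomorphic functions\<close>

lemma bounded_linear_axis: "bounded_linear (axis i :: complex \<Rightarrow> complex ^ 'n::finite)"
  unfolding linear_conv_bounded_linear[symmetric]
  by (rule linearI) (simp_all add: vec_eq_iff axis_def)

text \<open>
  Holomorphy in several variables is only ever used along holomorphic curves, where it reduces to
  holomorphy in one variable.
\<close>

lemma holomorphic_vec_on_compose_curve:
  fixes G :: "(complex, 'n::finite) vec \<Rightarrow> complex"
  assumes G: "holomorphic_vec_on G S" and U: "open U"
    and \<gamma>: "\<And>i. (\<lambda>\<zeta>. \<gamma> \<zeta> $ i) holomorphic_on U" "\<And>\<zeta>. \<zeta> \<in> U \<Longrightarrow> \<gamma> \<zeta> \<in> S"
  shows "(\<lambda>\<zeta>. G (\<gamma> \<zeta>)) holomorphic_on U"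
proof (rule holomorphic_onI)
  fix \<zeta> assume \<zeta>: "\<zeta> \<in> U"
  define v where "v = (\<chi> i. deriv (\<lambda>w. \<gamma> w $ i) \<zeta>)"
  obtain D where D: "(G has_derivative D) (at (\<gamma> \<zeta>))" "\<And>c v. D (c *s v) = c * D v"
    using G \<gamma>(2)[OF \<zeta>] unfolding holomorphic_vec_on_def by blast
  have "((\<lambda>w. \<gamma> w $ i) has_derivative (\<lambda>h. v $ i * h)) (at \<zeta>)" for i
    using holomorphic_derivI[OF \<gamma>(1) U \<zeta>] by (simp add: v_def has_field_derivative_def)
  then have "((\<lambda>w. \<Sum>i\<in>UNIV. axis i (\<gamma> w $ i)) has_derivative (\<lambda>h. \<Sum>i\<in>UNIV. axis i (v $ i * h))) (at \<zeta>)"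
    by (intro has_derivative_sum bounded_linear.has_derivative[OF bounded_linear_axis])
  moreover have "(\<Sum>i\<in>UNIV. axis i (\<gamma> w $ i)) = \<gamma> w" for w
    by (simp add: vec_eq_iff axis_def)
  moreover have "(\<Sum>i\<in>UNIV. axis i (v $ i * h)) = h *s v" for h
    by (simp add: vec_eq_iff axis_def mult.commute)
  ultimately have "(\<gamma> has_derivative (\<lambda>h. h *s v)) (at \<zeta>)" by simp
  then have "((\<lambda>w. G (\<gamma> w)) has_derivative (\<lambda>h. D (h *s v))) (at \<zeta>)"
    by (rule has_derivative_compose) (rule D(1))
  moreover have "(\<lambda>h. D (h *s v)) = (*) (D v)" by (simp add: D(2) fun_eq_iff mult.commute)
  ultimately have "((\<lambda>w. G (\<gamma> w)) has_field_derivative D v) (at \<zeta>)"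
    by (simp add: has_field_derivative_def)
  then show "(\<lambda>w. G (\<gamma> w)) field_differentiable at \<zeta> within U"
    by (meson field_differentiable_def field_differentiable_at_within)
qed

lemma integral_circle_mean_value:
  fixes f :: "complex \<Rightarrow> complex"
  assumes f: "f holomorphic_on cball z r" and r: "0 < r"
  shows "((\<lambda>x. f (z + r * exp (2 * of_real pi * \<i> * of_real x))) has_integral f z) {0..1}"
proof -
  have "((\<lambda>u. f u / (u - z)) has_contour_integral (2 * of_real pi * \<i> * f z)) (circlepath z r)"
    by (rule Cauchy_integral_circlepath_simple[OF f]) (use r in auto)
  then have "((\<lambda>x. f (circlepath z r x) / (circlepath z r x - z) * vector_derivative (circlepath z r) (at x within {0..1}))
      has_integral 2 * of_real pi * \<i> * f z) {0..1}"
    by (simp add: has_contour_integral_def)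
  then have "((\<lambda>x. 2 * of_real pi * \<i> * f (z + r * exp (2 * of_real pi * \<i> * of_real x)))
      has_integral 2 * of_real pi * \<i> * f z) {0..1}"
  proof (rule has_integral_eq[rotated])
    fix x :: real assume "x \<in> {0..1}"
    then have vd: "vector_derivative (circlepath z r) (at x within {0..1}) = 2 * pi * \<i> * r * exp (2 * of_real pi * \<i> * x)"
      by (intro vector_derivative_circlepath01) auto
    have cp: "circlepath z r x = z + r * exp (2 * of_real pi * \<i> * x)" by (simp add: circlepath)
    show "f (circlepath z r x) / (circlepath z r x - z) * vector_derivative (circlepath z r) (at x within {0..1})
      = 2 * of_real pi * \<i> * f (z + r * exp (2 * of_real pi * \<i> * of_real x))"
      unfolding vd unfolding cp using r by simp
  qed
  from has_integral_mult_right[OF this, of "1 / (2 * of_real pi * \<i>)"]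
  show ?thesis by simp
qed

lemma lebesgue_integral_circle_mean_value:
  fixes f :: "complex \<Rightarrow> complex"
  assumes f: "f holomorphic_on cball z r" and r: "0 < r"
  shows "integrable lborel (\<lambda>x. indicator {0..1} x *\<^sub>R f (z + r * exp (2 * of_real pi * \<i> * of_real x)))"
    and "(\<integral>x. indicator {0..1} x *\<^sub>R f (z + r * exp (2 * of_real pi * \<i> * of_real x)) \<partial>lborel) = f z"
proof -
  have cont: "continuous_on {0..1} (\<lambda>x. f (z + r * exp (2 * of_real pi * \<i> * of_real x)))"
    by (rule continuous_on_compose2[OF holomorphic_on_imp_continuous_on[OF f]])
       (use r in \<open>auto intro!: continuous_intros simp: dist_norm norm_mult\<close>)
  from borel_integrable_compact[OF _ cont]
  show int: "integrable lborel (\<lambda>x. indicator {0..1} x *\<^sub>R f (z + r * exp (2 * of_real pi * \<i> * of_real x)))" by simp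
  show "(\<integral>x. indicator {0..1} x *\<^sub>R f (z + r * exp (2 * of_real pi * \<i> * of_real x)) \<partial>lborel) = f z"
    using set_borel_integral_eq_integral(2)[of "{0..1}" "\<lambda>x. f (z + r * exp (2 * of_real pi * \<i> * of_real x))"]
      int integral_unique[OF integral_circle_mean_value[OF f r]]
    by (simp add: set_integrable_def set_lebesgue_integral_def)
qed

text \<open>
  The mean value property on a circle, parametrised by half the angle so that it fits the tangent
  coordinates.
\<close>

lemma integral_quarter_turns_mean_value:
  fixes f :: "complex \<Rightarrow> complex" and r :: real
  assumes f: "f holomorphic_on ball 0 1" and r: "0 < r" "r < 1"
  shows "(\<integral>\<phi>. indicator quarter_turns \<phi> *\<^sub>R f (r * cis (2 * \<phi>)) \<partial>lborel) = pi * f 0"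
proof -
  have h: "(\<lambda>\<zeta>. f (- \<zeta>)) holomorphic_on cball 0 r"
    using r by (intro holomorphic_on_compose_gen[OF _ f, of uminus, unfolded o_def]) (auto intro!: holomorphic_intros)
  have e: "- exp (2 * of_real pi * \<i> * of_real x) = cis (2 * (- (pi / 2) + pi * x))" for x :: real
  proof -
    have "cis (2 * (- (pi / 2) + pi * x)) = cis (2 * pi * x - pi)" by (simp add: algebra_simps)
    also have "\<dots> = - cis (2 * pi * x)" by (simp add: complex_eq_iff cos_diff sin_diff)
    finally show ?thesis by (simp add: cis_conv_exp mult_ac)
  qed
  have "(\<integral>\<phi>. indicator quarter_turns \<phi> *\<^sub>R f (r * cis (2 * \<phi>)) \<partial>lborel)
    = pi *\<^sub>R (\<integral>x. indicator quarter_turns (- (pi / 2) + pi * x) *\<^sub>R f (r * cis (2 * (- (pi / 2) + pi * x))) \<partial>lborel)"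
    by (subst lborel_integral_real_affine[where c = pi and t = "- (pi / 2)"]) simp_all
  also have "(\<integral>x. indicator quarter_turns (- (pi / 2) + pi * x) *\<^sub>R f (r * cis (2 * (- (pi / 2) + pi * x))) \<partial>lborel)
    = (\<integral>x. indicator {0..1} x *\<^sub>R f (- (0 + r * exp (2 * of_real pi * \<i> * of_real x))) \<partial>lborel)"
  proof (rule integral_cong_AE)
    have [measurable]: "(\<lambda>x. indicator {0..1} x *\<^sub>R f (- (0 + r * exp (2 * of_real pi * \<i> * of_real x)))) \<in> borel_measurable lborel"
      using lebesgue_integral_circle_mean_value(1)[OF h r(1)] by (rule borel_measurable_integrable)
    have ae: "indicator quarter_turns (- (pi / 2) + pi * x) *\<^sub>R f (r * cis (2 * (- (pi / 2) + pi * x)))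
       = indicator {0<..<1} x *\<^sub>R (indicator {0..1} x *\<^sub>R f (- (0 + r * exp (2 * of_real pi * \<i> * of_real x))))" for x
    proof -
      have "- (pi / 2) + pi * x \<in> quarter_turns \<longleftrightarrow> x \<in> {0<..<1}"
        using pi_gt_zero by (auto simp: zero_less_mult_iff) 
      moreover have "- (r * exp (2 * of_real pi * \<i> * of_real x)) = r * cis (2 * (- (pi / 2) + pi * x))"
        by (simp only: e[symmetric] mult_minus_right)
      ultimately show ?thesis by (auto simp: indicator_def)
    qed
    show "(\<lambda>x. indicator quarter_turns (- (pi / 2) + pi * x) *\<^sub>R f (r * cis (2 * (- (pi / 2) + pi * x)))) \<in> borel_measurable lborel"
      unfolding ae by measurable
    show "AE x in lborel. indicator quarter_turns (- (pi / 2) + pi * x) *\<^sub>R f (r * cis (2 * (- (pi / 2) + pi * x)))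
       = indicator {0..1} x *\<^sub>R f (- (0 + r * exp (2 * of_real pi * \<i> * of_real x)))"
      unfolding ae using AE_lborel_singleton[of "0::real"] AE_lborel_singleton[of "1::real"]
      by eventually_elim (auto simp: indicator_def)
  qed (rule borel_measurable_integrable[OF lebesgue_integral_circle_mean_value(1)[OF h r(1)]])
  also have "\<dots> = f 0" using lebesgue_integral_circle_mean_value(2)[OF h r(1)] by simp
  finally show ?thesis by (simp add: scaleR_conv_of_real)
qed

section \<open>The Poisson formula\<close>

text \<open>
  The Cayley transform of the unit disc onto the upper half-plane; it sends \<open>e\<^bsup>2 i \<phi>\<^esup>\<close> to \<open>tan \<phi>\<close>, so a rotation of
  the disc becomes a translation of the angle \<open>\<phi>\<close>.
\<close>

definition cayley :: "complex \<Rightarrow> complex" where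
  "cayley \<zeta> = \<i> * (1 - \<zeta>) / (1 + \<zeta>)"

lemma cayley_0 [simp]: "cayley 0 = \<i>"
  by (simp add: cayley_def)

lemma Im_cayley_pos:
  assumes "cmod \<zeta> < 1"
  shows "0 < Im (cayley \<zeta>)"
proof -
  have ne: "1 + \<zeta> \<noteq> 0" using assms by (metis add_eq_0_iff less_irrefl norm_minus_cancel norm_one)
  have "cayley \<zeta> = \<i> * ((1 - \<zeta>) * cnj (1 + \<zeta>)) / of_real ((cmod (1 + \<zeta>))\<^sup>2)"
  proof -
    have "cayley \<zeta> = \<i> * ((1 - \<zeta>) * cnj (1 + \<zeta>)) / ((1 + \<zeta>) * cnj (1 + \<zeta>))"
      using ne by (simp add: cayley_def del: complex_cnj_add)
    then show ?thesis by (simp only: complex_norm_square)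
  qed
  then have "Im (cayley \<zeta>) = Re ((1 - \<zeta>) * cnj (1 + \<zeta>)) / (cmod (1 + \<zeta>))\<^sup>2"
    by (simp add: Im_divide_of_real)
  also have "Re ((1 - \<zeta>) * cnj (1 + \<zeta>)) = 1 - (cmod \<zeta>)\<^sup>2"
    unfolding cmod_power2 by (simp add: power2_eq_square algebra_simps)
  finally show ?thesis using ne assms by (simp add: power_less_one_iff)
qed

lemma holomorphic_on_cayley: "cayley holomorphic_on ball 0 1"
  unfolding cayley_def
  by (intro holomorphic_intros) (metis add_eq_0_iff dist_0_norm less_irrefl mem_ball norm_minus_cancel norm_one)

lemma one_plus_cis: "1 + cis (2 * \<phi>) = 2 * complex_of_real (cos \<phi>) * cis \<phi>"
  by (simp add: complex_eq_iff cos_double_cos sin_double power2_eq_square)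

lemma cayley_cis:
  assumes "cos \<phi> \<noteq> 0"
  shows "cayley (cis (2 * \<phi>)) = complex_of_real (tan \<phi>)"
proof -
  have "1 - cis (2 * \<phi>) = - 2 * \<i> * complex_of_real (sin \<phi>) * cis \<phi>"
    by (simp add: complex_eq_iff cos_double_sin sin_double power2_eq_square)
  then have "cayley (cis (2 * \<phi>)) = (\<i> * (- 2 * \<i> * complex_of_real (sin \<phi>) * cis \<phi>)) / (2 * complex_of_real (cos \<phi>) * cis \<phi>)"
    by (simp only: cayley_def one_plus_cis)
  then show ?thesis using assms by (simp add: tan_def field_simps)
qed

lemma tendsto_cayley_radial:
  assumes "cos \<phi> \<noteq> 0" and "r \<longlonglongrightarrow> (1::real)"
  shows "(\<lambda>k. cayley (r k * cis (2 * \<phi>))) \<longlonglongrightarrow> complex_of_real (tan \<phi>)"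
proof -
  have "(\<lambda>k. of_real (r k) * cis (2 * \<phi>)) \<longlonglongrightarrow> of_real 1 * cis (2 * \<phi>)"
    by (intro tendsto_intros assms)
  moreover have "1 + cis (2 * \<phi>) \<noteq> 0" using assms by (simp add: one_plus_cis)
  ultimately have "(\<lambda>k. \<i> * (1 - of_real (r k) * cis (2 * \<phi>)) / (1 + of_real (r k) * cis (2 * \<phi>)))
      \<longlonglongrightarrow> \<i> * (1 - cis (2 * \<phi>)) / (1 + cis (2 * \<phi>))"
    by (intro tendsto_intros) auto
  then show ?thesis
    using cayley_cis[OF assms(1)] by (simp add: cayley_def)
qed

text \<open>
  The tube together with its Shilov boundary \<open>\<real>\<^sup>n\<close>, not the topological closure.
\<close>

definition tube_closure :: "(complex ^ 'n::{finite,one}) set" where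
  "tube_closure = tube_domain \<union> range (\<lambda>x. re_im_vec x 0)"

lemma re_im_vec_in_tube: "y \<in> lorentz_cone \<Longrightarrow> re_im_vec x y \<in> tube_domain"
  by (auto simp: tube_domain_def)

lemma spectral_complex_in_tube:
  "0 < spatial_norm u \<Longrightarrow> 0 < Im l \<Longrightarrow> 0 < Im m \<Longrightarrow> spectral_complex u l m \<in> tube_domain"
  unfolding spectral_complex_def by (intro re_im_vec_in_tube spectral_in_cone)

lemma spectral_complex_of_real: "spectral_complex u (of_real l) (of_real m) = re_im_vec (spectral u l m) 0"
  by (simp add: spectral_complex_def vec_eq_iff re_im_vec_def complex_eq_iff)

lemma spectral_complex_ii: "spectral_complex u \<i> \<i> = re_im_vec 0 time_axis"
proof -
  have "spectral u 0 0 = 0" by (simp add: vec_eq_iff)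
  then show ?thesis by (simp add: spectral_complex_def spectral_one)
qed

lemma tendsto_spectral_complex:
  fixes u :: "(real, 'n::{finite,one}) vec"
  assumes "(l \<longlongrightarrow> a) F" "(m \<longlongrightarrow> b) F"
  shows "((\<lambda>x. spectral_complex u (l x) (m x)) \<longlongrightarrow> spectral_complex u a b) F"
  by (rule vec_tendstoI) (auto simp: spectral_complex_nth simp del: of_real_divide intro!: tendsto_mult tendsto_divide tendsto_add tendsto_diff tendsto_const assms)

context
  fixes G :: "(complex, 'n::{finite,one}) vec \<Rightarrow> complex" and B :: real
  assumes n: "2 \<le> CARD('n)"
    and holo: "holomorphic_vec_on G tube_domain"
    and cont: "continuous_on tube_closure G"
    and bound: "\<And>u l m. 0 < spatial_norm u \<Longrightarrow> 0 < Im l \<Longrightarrow> 0 < Im m \<Longrightarrow> cmod (G (spectral_complex u l m)) \<le> B"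
begin

text \<open>
  The bound is only assumed at points with eigenvalues in the upper half-plane; a boundary point is a limit
  of such points.
\<close>

lemma boundary_value_bound_spectral:
  assumes u: "0 < spatial_norm u"
  shows "cmod (G (re_im_vec (spectral u l m) 0)) \<le> B"
proof -
  let ?p = "\<lambda>k. spectral_complex u (Complex l (1 / real (Suc k))) (Complex m (1 / real (Suc k)))"
  have 0: "(\<lambda>k. 1 / real (Suc k)) \<longlonglongrightarrow> 0" by (rule lim_1_over_n[THEN LIMSEQ_Suc])
  have "(\<lambda>k. Complex a (1 / real (Suc k))) \<longlonglongrightarrow> of_real a" for a
    using tendsto_Complex[OF tendsto_const 0, of a] by (simp add: complex_of_real_def)
  then have "?p \<longlonglongrightarrow> re_im_vec (spectral u l m) 0"
    unfolding spectral_complex_of_real[symmetric] by (intro tendsto_spectral_complex)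
  then have "(\<lambda>k. G (?p k)) \<longlonglongrightarrow> G (re_im_vec (spectral u l m) 0)"
  proof (rule continuous_on_tendsto_compose[OF cont])
    show "\<forall>\<^sub>F k in sequentially. ?p k \<in> tube_closure"
      unfolding tube_closure_def
      by (intro always_eventually allI UnI1 spectral_complex_in_tube[OF u]) auto
  qed (auto simp: tube_closure_def)
  then show ?thesis
    by (rule Lim_bounded[OF tendsto_norm]) (auto intro!: bound[OF u])
qed

lemma boundary_value_bound: "cmod (G (re_im_vec x 0)) \<le> B"
proof (cases "0 < spatial_norm x")
  case True
  have "spectral x (x $ 1 + spatial_norm x) (x $ 1 - spatial_norm x) = x"
    using True by (simp add: vec_eq_iff)
  with boundary_value_bound_spectral[OF True] show ?thesis by metis
next
  case False
  then have x0: "spatial_norm x = 0" using spatial_norm_nonneg[of x] by simp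
  have "\<exists>u::(real,'n) vec. 0 < spatial_norm u"
    using eventually_happens[OF AE_spatial_norm_pos[OF n]] by (auto simp: ae_filter_eq_bot_iff)
  then obtain u :: "(real,'n) vec" where u: "0 < spatial_norm u" by blast
  have "x $ i = 0" if "i \<noteq> 1" for i using abs_nth_le_spatial_norm[OF that, of x] x0 by simp
  then have "spectral u (x $ 1) (x $ 1) = x" by (simp add: vec_eq_iff)
  with boundary_value_bound_spectral[OF u] show ?thesis by metis
qed

lemma boundary_value_measurable: "(\<lambda>x. G (re_im_vec x 0)) \<in> borel_measurable borel"
  by (intro borel_measurable_continuous_onI continuous_on_compose2[OF cont])
     (auto intro!: continuous_intros simp: tube_closure_def)

text \<open>
  The one-dimensional heart of the Poisson formula. The map
  \<open>\<zeta> \<mapsto> (cayley \<zeta>, cayley (e\<^bsup>-2 i \<delta>\<^esup> \<zeta>))\<close> sends the disc into the product of two half-planes, hence into the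
  tube, and \<open>0\<close> to \<open>i e\<close>; its boundary values are the pairs \<open>(tan \<phi>, tan (\<phi> - \<delta>))\<close>. The mean value
  property on circles of radius \<open>r < 1\<close> passes to the limit by dominated convergence; at the two angles where
  a tangent is infinite nothing is claimed.
\<close>

lemma circle_mean_value_boundary:
  assumes u: "0 < spatial_norm u"
  shows "(\<integral>\<phi>. indicator quarter_turns \<phi> *\<^sub>R G (re_im_vec (spectral u (tan \<phi>) (tan (\<phi> - \<delta>))) 0) \<partial>lborel)
    = pi * G (re_im_vec 0 time_axis)"
proof -
  note [measurable] = boundary_value_measurable
  define h where "h \<zeta> = G (spectral_complex u (cayley \<zeta>) (cayley (\<zeta> * cis (- 2 * \<delta>))))" for \<zeta>
  define r where "r k = 1 - 1 / real (Suc (Suc k))" for k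
  have r: "0 < r k" "r k < 1" for k by (auto simp: r_def)
  have rlim: "r \<longlonglongrightarrow> 1"
    unfolding r_def using tendsto_diff[OF tendsto_const LIMSEQ_Suc[OF LIMSEQ_Suc[OF lim_1_over_n]], of "1::real"] by simp
  have ball: "\<zeta> * cis (- 2 * \<delta>) \<in> ball 0 1" if "\<zeta> \<in> ball 0 1" for \<zeta>
    using that by (simp add: norm_mult)
  have hol2: "(\<lambda>\<zeta>. cayley (\<zeta> * cis (- 2 * \<delta>))) holomorphic_on ball 0 1"
    by (rule holomorphic_on_compose_gen[OF _ holomorphic_on_cayley, unfolded o_def])
       (use ball in \<open>auto intro!: holomorphic_intros\<close>)
  have h: "h holomorphic_on ball 0 1"
    unfolding h_def
  proof (rule holomorphic_vec_on_compose_curve[OF holo])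
    show "(\<lambda>\<zeta>. spectral_complex u (cayley \<zeta>) (cayley (\<zeta> * cis (- 2 * \<delta>))) $ i) holomorphic_on ball 0 1" for i
      unfolding spectral_complex_nth using hol2
      by (cases "i = 1") (auto intro!: holomorphic_intros holomorphic_on_cayley)
    show "spectral_complex u (cayley \<zeta>) (cayley (\<zeta> * cis (- 2 * \<delta>))) \<in> tube_domain" if "\<zeta> \<in> ball 0 1" for \<zeta>
      using that ball[OF that] by (intro spectral_complex_in_tube u Im_cayley_pos) auto
  qed simp
  have hbound: "cmod (h \<zeta>) \<le> B" if "\<zeta> \<in> ball 0 1" for \<zeta>
    unfolding h_def using that ball[OF that] by (intro bound u Im_cayley_pos) auto
  have h0: "h 0 = G (re_im_vec 0 time_axis)" by (simp add: h_def spectral_complex_ii)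
  have inball: "r k * cis (2 * \<phi>) \<in> ball 0 1" for k \<phi> using r[of k] by (simp add: norm_mult)
  have "(\<lambda>k. \<integral>\<phi>. indicator quarter_turns \<phi> *\<^sub>R h (r k * cis (2 * \<phi>)) \<partial>lborel)
    \<longlonglongrightarrow> (\<integral>\<phi>. indicator quarter_turns \<phi> *\<^sub>R G (re_im_vec (spectral u (tan \<phi>) (tan (\<phi> - \<delta>))) 0) \<partial>lborel)"
  proof (rule integral_dominated_convergence[where w = "\<lambda>\<phi>. indicator quarter_turns \<phi> * B"])
    show "(\<lambda>\<phi>. indicator quarter_turns \<phi> *\<^sub>R h (r k * cis (2 * \<phi>))) \<in> borel_measurable lborel" for k
    proof -
      have "continuous_on UNIV (\<lambda>\<phi>. h (r k * cis (2 * \<phi>)))"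
        by (rule continuous_on_compose2[OF holomorphic_on_imp_continuous_on[OF h]])
           (use inball in \<open>auto intro!: continuous_intros\<close>)
      then have [measurable]: "(\<lambda>\<phi>. h (r k * cis (2 * \<phi>))) \<in> borel_measurable borel"
        by (rule borel_measurable_continuous_onI)
      show ?thesis by measurable
    qed
    show "(\<lambda>\<phi>. indicator quarter_turns \<phi> *\<^sub>R G (re_im_vec (spectral u (tan \<phi>) (tan (\<phi> - \<delta>))) 0)) \<in> borel_measurable lborel"
      by measurable
    show "integrable lborel (\<lambda>\<phi>. indicator quarter_turns \<phi> * B)"
      by (intro integrable_mult_left integrable_real_indicator) auto
    show "AE \<phi> in lborel. norm (indicator quarter_turns \<phi> *\<^sub>R h (r k * cis (2 * \<phi>))) \<le> indicator quarter_turns \<phi> * B" for k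
      using hbound[OF inball] by (auto simp: indicator_def)
    \<comment> \<open>where the second tangent is infinite the radial limit may fail to exist\<close>
    have "{\<phi>. cos (\<phi> - \<delta>) = 0} \<subseteq> range (\<lambda>k::int. real_of_int k * pi + pi / 2 + \<delta>)"
    proof
      fix \<phi> assume "\<phi> \<in> {\<phi>. cos (\<phi> - \<delta>) = 0}"
      then obtain k :: int where "\<phi> - \<delta> = of_int k * pi + pi / 2" by (auto simp: cos_zero_iff_int2)
      then show "\<phi> \<in> range (\<lambda>k::int. real_of_int k * pi + pi / 2 + \<delta>)" by (auto intro!: range_eqI[of _ _ k])
    qed
    then have "countable {\<phi>. cos (\<phi> - \<delta>) = 0}" by (rule countable_subset) simp
    then have "AE \<phi> in lborel. \<phi> \<notin> {\<phi>. cos (\<phi> - \<delta>) = 0}"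
      by (intro AE_not_in countable_imp_null_set_lborel)
    then show "AE \<phi> in lborel. (\<lambda>k. indicator quarter_turns \<phi> *\<^sub>R h (r k * cis (2 * \<phi>)))
       \<longlonglongrightarrow> indicator quarter_turns \<phi> *\<^sub>R G (re_im_vec (spectral u (tan \<phi>) (tan (\<phi> - \<delta>))) 0)"
    proof eventually_elim
      case (elim \<phi>)
      show ?case
      proof (cases "\<phi> \<in> quarter_turns")
        case True
        then have "cos \<phi> \<noteq> 0" using cos_gt_zero_pi[of \<phi>] by auto
        then have "(\<lambda>k. cayley (r k * cis (2 * \<phi>))) \<longlonglongrightarrow> complex_of_real (tan \<phi>)"
          using rlim by (rule tendsto_cayley_radial)
        moreover have "(\<lambda>k. cayley (r k * cis (2 * \<phi>) * cis (- 2 * \<delta>))) \<longlonglongrightarrow> complex_of_real (tan (\<phi> - \<delta>))"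
          using tendsto_cayley_radial[OF _ rlim, of "\<phi> - \<delta>"] elim by (simp add: cis_mult algebra_simps)
        ultimately have "(\<lambda>k. spectral_complex u (cayley (r k * cis (2 * \<phi>))) (cayley (r k * cis (2 * \<phi>) * cis (- 2 * \<delta>))))
           \<longlonglongrightarrow> re_im_vec (spectral u (tan \<phi>) (tan (\<phi> - \<delta>))) 0"
          unfolding spectral_complex_of_real[symmetric] by (rule tendsto_spectral_complex)
        then have "(\<lambda>k. h (r k * cis (2 * \<phi>))) \<longlonglongrightarrow> G (re_im_vec (spectral u (tan \<phi>) (tan (\<phi> - \<delta>))) 0)"
          unfolding h_def
        proof (rule continuous_on_tendsto_compose[OF cont])
          show "\<forall>\<^sub>F k in sequentially. spectral_complex u (cayley (r k * cis (2 * \<phi>))) (cayley (r k * cis (2 * \<phi>) * cis (- 2 * \<delta>))) \<in> tube_closure"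
            using inball ball[OF inball]
            by (intro always_eventually allI) (auto simp: tube_closure_def intro!: spectral_complex_in_tube u Im_cayley_pos)
        qed (auto simp: tube_closure_def)
        then show ?thesis using True by simp
      qed simp
    qed
  qed
  moreover have "(\<integral>\<phi>. indicator quarter_turns \<phi> *\<^sub>R h (r k * cis (2 * \<phi>)) \<partial>lborel) = pi * h 0" for k
    by (rule integral_quarter_turns_mean_value[OF h r])
  ultimately show ?thesis using h0 by (simp add: LIMSEQ_const_iff)
qed

end

definition poisson_measure :: "(real ^ 'n::{finite,one}) measure" where
  "poisson_measure = density lborel (\<lambda>u. ennreal (cmod (tube_det (re_im_vec u time_axis)) powr (- real CARD('n))))"

lemma emeasure_poisson_measure:
  "emeasure poisson_measure (space (poisson_measure :: (real,'n::{finite,one}) vec measure)) = tube_det_mass (real CARD('n)) TYPE('n)"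
  unfolding poisson_measure_def tube_det_mass_def by (subst emeasure_density) auto

text \<open>
  Integrate the mean value property over all circles of the fibration.
\<close>

lemma poisson_formula:
  fixes G :: "(complex, 'n::{finite,one}) vec \<Rightarrow> complex" and B :: real
  assumes n: "2 \<le> CARD('n)"
    and holo: "holomorphic_vec_on G tube_domain"
    and cont: "continuous_on tube_closure G"
    and bound: "\<And>u l m. 0 < spatial_norm u \<Longrightarrow> 0 < Im l \<Longrightarrow> 0 < Im m \<Longrightarrow> cmod (G (spectral_complex u l m)) \<le> B"
  shows "(\<integral>u. G (re_im_vec u 0) \<partial>poisson_measure)
    = measure poisson_measure (space (poisson_measure :: (real,'n) vec measure)) * G (re_im_vec 0 time_axis)"
proof -
  note [measurable] = boundary_value_measurable[OF n holo cont bound]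
  define k where "k = CARD('n) - 2"
  \<comment> \<open>the parameters of the circles and the angle along a circle\<close>
  define N1 :: "((real,'n) vec \<times> real) measure" where
    "N1 = density (lborel \<Otimes>\<^sub>M lborel) (\<lambda>(u, \<delta>). ennreal (spectral_const TYPE('n)) * (indicator spectral_base u * (indicator quarter_turns \<delta> * ennreal (\<bar>sin \<delta>\<bar> ^ k))))"
  define N2 :: "real measure" where "N2 = density lborel (indicator quarter_turns)"
  define \<Psi> :: "((real,'n) vec \<times> real) \<times> real \<Rightarrow> (real,'n) vec" where
    "\<Psi> = (\<lambda>q. spectral (fst (fst q)) (tan (snd q)) (tan (snd q - snd (fst q))))"
  have [simp]: "sets N1 = sets (borel \<Otimes>\<^sub>M borel)" "sets N2 = sets borel" "space N1 = UNIV" "space N2 = UNIV"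
    by (auto simp: N1_def N2_def space_pair_measure cong: sets_pair_measure_cong)
  have [measurable_cong]: "sets N1 = sets (borel \<Otimes>\<^sub>M borel)" "sets N2 = sets borel" by simp_all
  have \<Psi>[measurable]: "\<Psi> \<in> borel_measurable ((borel \<Otimes>\<^sub>M borel) \<Otimes>\<^sub>M borel)"
    unfolding \<Psi>_def by measurable
  have "emeasure N2 (space N2) = emeasure lborel quarter_turns"
    unfolding N2_def by (subst emeasure_density) auto
  also have "\<dots> = ennreal pi" by simp
  finally have N2: "emeasure N2 (space N2) = ennreal pi" .
  interpret N2: finite_measure N2 by (rule finite_measureI) (use N2 in simp)
  have intN1: "(\<integral>\<^sup>+ p. g p \<partial>N1) = ennreal (spectral_const TYPE('n)) *
      (\<integral>\<^sup>+ u. indicator spectral_base u * (\<integral>\<^sup>+ \<delta>. indicator quarter_turns \<delta> * ennreal (\<bar>sin \<delta>\<bar> ^ k) * g (u, \<delta>) \<partial>lborel) \<partial>lborel)"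
    if [measurable]: "g \<in> borel_measurable (borel \<Otimes>\<^sub>M borel)" for g
  proof -
    have "(\<integral>\<^sup>+ p. g p \<partial>N1) = (\<integral>\<^sup>+ p. (case p of (u, \<delta>) \<Rightarrow> ennreal (spectral_const TYPE('n)) * (indicator spectral_base u * (indicator quarter_turns \<delta> * ennreal (\<bar>sin \<delta>\<bar> ^ k)))) * g p \<partial>(lborel \<Otimes>\<^sub>M lborel))"
      unfolding N1_def by (rule nn_integral_density) measurable
    also have "\<dots> = (\<integral>\<^sup>+ u. \<integral>\<^sup>+ \<delta>. ennreal (spectral_const TYPE('n)) * (indicator spectral_base u * (indicator quarter_turns \<delta> * ennreal (\<bar>sin \<delta>\<bar> ^ k) * g (u, \<delta>))) \<partial>lborel \<partial>lborel)"
      by (subst lborel.nn_integral_fst[symmetric]) (auto simp: mult_ac)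
    also have "\<dots> = ennreal (spectral_const TYPE('n)) *
      (\<integral>\<^sup>+ u. indicator spectral_base u * (\<integral>\<^sup>+ \<delta>. indicator quarter_turns \<delta> * ennreal (\<bar>sin \<delta>\<bar> ^ k) * g (u, \<delta>) \<partial>lborel) \<partial>lborel)"
      by (simp add: nn_integral_cmult)
    finally show ?thesis .
  qed
  have fib: "(\<integral>\<^sup>+ u. g u \<partial>poisson_measure) = (\<integral>\<^sup>+ p. \<integral>\<^sup>+ \<phi>. g (\<Psi> (p, \<phi>)) \<partial>N2 \<partial>N1)"
    if [measurable]: "g \<in> borel_measurable borel" for g :: "(real,'n) vec \<Rightarrow> ennreal"
  proof -
    have inner: "(\<integral>\<^sup>+ \<phi>. g (\<Psi> (p, \<phi>)) \<partial>N2) = (\<integral>\<^sup>+ \<phi>. indicator quarter_turns \<phi> * g (\<Psi> (p, \<phi>)) \<partial>lborel)" for p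
    proof -
      have "(\<lambda>\<phi>. \<Psi> (p, \<phi>)) \<in> borel_measurable lborel" by (simp add: \<Psi>_def)
      from measurable_compose[OF this that] show ?thesis
        unfolding N2_def by (intro nn_integral_density) simp_all
    qed
    have "(\<integral>\<^sup>+ u. g u \<partial>poisson_measure)
      = (\<integral>\<^sup>+ u. ennreal (cmod (tube_det (re_im_vec u time_axis)) powr (- real CARD('n))) * g u \<partial>lborel)"
      unfolding poisson_measure_def by (rule nn_integral_density) measurable
    also have "\<dots> = ennreal (spectral_const TYPE('n)) *
      (\<integral>\<^sup>+ u. indicator spectral_base u * (\<integral>\<^sup>+ \<delta>. indicator quarter_turns \<delta> * ennreal (\<bar>sin \<delta>\<bar> ^ k) *
      (\<integral>\<^sup>+ \<phi>. indicator quarter_turns \<phi> * g (spectral u (tan \<phi>) (tan (\<phi> - \<delta>))) \<partial>lborel) \<partial>lborel) \<partial>lborel)"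
      unfolding k_def by (rule nn_integral_circle_fibration[OF n]) measurable
    also have "\<dots> = (\<integral>\<^sup>+ p. \<integral>\<^sup>+ \<phi>. indicator quarter_turns \<phi> * g (\<Psi> (p, \<phi>)) \<partial>lborel \<partial>N1)"
      by (subst intN1) (simp_all add: \<Psi>_def)
    finally show ?thesis by (simp add: inner)
  qed
  have massN1: "emeasure poisson_measure (space (poisson_measure :: (real,'n) vec measure)) = ennreal pi * emeasure N1 (space N1)"
    using fib[of "\<lambda>_. 1"] N2 by (simp add: nn_integral_cmult[symmetric] mult.commute)
  have mass: "tube_det_mass (real CARD('n)) TYPE('n) < \<infinity>"
    by (rule tube_det_mass_finite[OF n]) simp
  have N1fin: "emeasure N1 (space N1) < \<infinity>"
    using massN1 mass unfolding emeasure_poisson_measure by (auto simp: ennreal_mult_less_top)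
  interpret N1: finite_measure N1 by (rule finite_measureI) (use N1fin in auto)
  interpret P: pair_sigma_finite N1 N2 ..
  have "UNIV \<in> sets N1" "UNIV \<in> sets N2"
    using sets.top[of N1] sets.top[of N2] by simp_all
  then have "emeasure (N1 \<Otimes>\<^sub>M N2) (UNIV \<times> UNIV) = emeasure N1 UNIV * emeasure N2 UNIV"
    by (rule N2.emeasure_pair_measure_Times)
  then have "emeasure (N1 \<Otimes>\<^sub>M N2) (space (N1 \<Otimes>\<^sub>M N2)) < \<infinity>"
    using N1fin N2 by (simp add: space_pair_measure ennreal_mult_less_top)
  then interpret PF: finite_measure "N1 \<Otimes>\<^sub>M N2" by (intro finite_measureI) auto
  have meas_eq: "distr (N1 \<Otimes>\<^sub>M N2) borel \<Psi> = poisson_measure"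
  proof (rule measure_eqI)
    show "sets (distr (N1 \<Otimes>\<^sub>M N2) borel \<Psi>) = sets poisson_measure" by (simp add: poisson_measure_def)
    fix A assume "A \<in> sets (distr (N1 \<Otimes>\<^sub>M N2) borel \<Psi>)"
    then have [measurable]: "A \<in> sets borel" by simp
    have "emeasure (distr (N1 \<Otimes>\<^sub>M N2) borel \<Psi>) A = (\<integral>\<^sup>+ u. indicator A u \<partial>distr (N1 \<Otimes>\<^sub>M N2) borel \<Psi>)" by simp
    also have "\<dots> = (\<integral>\<^sup>+ p. indicator A (\<Psi> p) \<partial>(N1 \<Otimes>\<^sub>M N2))" by (rule nn_integral_distr) measurable
    also have "\<dots> = (\<integral>\<^sup>+ p. \<integral>\<^sup>+ \<phi>. indicator A (\<Psi> (p, \<phi>)) \<partial>N2 \<partial>N1)"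
      by (rule N2.nn_integral_fst[symmetric]) measurable
    also have "\<dots> = (\<integral>\<^sup>+ u. indicator A u \<partial>poisson_measure)" by (rule fib[symmetric]) measurable
    also have "\<dots> = emeasure poisson_measure A" by (simp add: poisson_measure_def)
    finally show "emeasure (distr (N1 \<Otimes>\<^sub>M N2) borel \<Psi>) A = emeasure poisson_measure A" .
  qed
  let ?c = "pi * G (re_im_vec 0 time_axis)"
  have "(\<integral>u. G (re_im_vec u 0) \<partial>poisson_measure) = (\<integral>p. G (re_im_vec (\<Psi> p) 0) \<partial>(N1 \<Otimes>\<^sub>M N2))"
    unfolding meas_eq[symmetric] by (rule integral_distr) measurable
  also have "\<dots> = (\<integral>p. \<integral>\<phi>. G (re_im_vec (\<Psi> (p, \<phi>)) 0) \<partial>N2 \<partial>N1)"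
    by (rule P.integral_fst'[symmetric], rule PF.integrable_const_bound[where B = B])
       (auto intro!: boundary_value_bound[OF n holo cont bound])
  also have "\<dots> = (\<integral>p. ?c \<partial>N1)"
  proof (rule integral_cong_AE)
    have "AE p in N1. fst p \<in> spectral_base"
      unfolding N1_def by (subst AE_density) (auto intro!: AE_I2 simp: indicator_def split: if_splits, rule ccontr, simp)
    then show "AE p in N1. (\<integral>\<phi>. G (re_im_vec (\<Psi> (p, \<phi>)) 0) \<partial>N2) = ?c"
    proof eventually_elim
      case (elim p)
      obtain u \<delta> where p: "p = (u, \<delta>)" by fastforce
      have u: "0 < spatial_norm u" using elim p by (auto simp: spectral_base_def)
      have "(\<integral>\<phi>. G (re_im_vec (\<Psi> (p, \<phi>)) 0) \<partial>N2)
        = (\<integral>\<phi>. indicator quarter_turns \<phi> *\<^sub>R G (re_im_vec (spectral u (tan \<phi>) (tan (\<phi> - \<delta>))) 0) \<partial>lborel)"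
        unfolding N2_def p \<Psi>_def
        using integral_density[of "\<lambda>\<phi>. G (re_im_vec (spectral u (tan \<phi>) (tan (\<phi> - \<delta>))) 0)" lborel "indicator quarter_turns"]
        by (simp add: ennreal_indicator)
      also have "\<dots> = ?c" by (rule circle_mean_value_boundary[OF n holo cont bound u])
      finally show ?case .
    qed
  qed measurable
  also have "\<dots> = measure N1 (space N1) * ?c" by (simp add: scaleR_conv_of_real)
  also have "\<dots> = (pi * measure N1 (space N1)) * G (re_im_vec 0 time_axis)" by simp
  also have "pi * measure N1 (space N1) = measure poisson_measure (space (poisson_measure :: (real,'n) vec measure))"
    unfolding measure_def massN1 by (simp add: enn2real_mult)
  finally show ?thesis .
qed

section \<open>Holomorphic powers of the determinant\<close>

text \<open>
  The holomorphic power \<open>\<Delta>(z / i)\<^bsup>s\<^esup>\<close>; for \<open>s = - n / 2\<close> it is, up to a constant, the Szego kernel.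
\<close>

definition tube_power :: "real \<Rightarrow> complex ^ 'n::{finite,one} \<Rightarrow> complex" where
  "tube_power s z = tube_det z powr complex_of_real s"

lemma tube_domainE:
  assumes "z \<in> tube_domain"
  obtains x y where "z = re_im_vec x y" "y \<in> lorentz_cone"
  using assms by (auto simp: tube_domain_def)

lemma tube_det_in_tube: "z \<in> tube_domain \<Longrightarrow> tube_det z \<notin> \<real>\<^sub>\<le>\<^sub>0"
  by (auto elim!: tube_domainE simp: tube_det_not_nonpos_Reals)

lemma tube_det_nonzero: "z \<in> tube_domain \<Longrightarrow> tube_det z \<noteq> 0"
  using tube_det_in_tube by force

lemma norm_tube_power: "cmod (tube_power s z) = cmod (tube_det z) powr s"
  by (simp add: tube_power_def norm_powr_real_powr')

lemma tube_power_add: "tube_power (s + t) z = tube_power s z * tube_power t z"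
  by (simp add: tube_power_def powr_add)

lemma tube_power_minus: "z \<in> tube_domain \<Longrightarrow> tube_power s z * tube_power (- s) z = 1"
  using tube_power_add[of s "- s" z] tube_det_nonzero[of z] by (simp add: tube_power_def)

lemma continuous_on_tube_power [continuous_intros]:
  assumes "continuous_on S f" "\<And>x. x \<in> S \<Longrightarrow> f x \<in> tube_domain"
  shows "continuous_on S (\<lambda>x. tube_power s (f x))"
proof -
  have "continuous_on S (\<lambda>x. exp (complex_of_real s * Ln (tube_det (f x))))"
    by (intro continuous_intros assms) (use tube_det_in_tube assms(2) in blast)
  also have "?this \<longleftrightarrow> continuous_on S (\<lambda>x. tube_power s (f x))"
    by (intro continuous_on_cong refl) (simp add: tube_power_def powr_def tube_det_nonzero assms(2))
  finally show ?thesis .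
qed

lemma tube_power_measurable [measurable]: "tube_power s \<in> borel_measurable borel"
  unfolding tube_power_def[abs_def] powr_def by measurable

lemma cnj_measurable [measurable]: "cnj \<in> borel_measurable borel"
  by (intro borel_measurable_continuous_onI continuous_intros)

lemma re_im_vec_scaleR: "complex_of_real a *s re_im_vec x y = re_im_vec (a *\<^sub>R x) (a *\<^sub>R y)"
  by (simp add: vec_eq_iff re_im_vec_def complex_eq_iff)

text \<open>
  Adding a point of the tube moves boundary points inside.
\<close>

lemma tube_closure_shift:
  assumes w: "w \<in> tube_closure" and b: "b \<in> tube_domain" and a: "0 \<le> a"
  shows "complex_of_real a *s w + b \<in> tube_domain"
proof -
  obtain p q where b': "b = re_im_vec p q" "q \<in> lorentz_cone" using b by (rule tube_domainE)
  from w consider x y where "w = re_im_vec x y" "y \<in> lorentz_cone" | x where "w = re_im_vec x 0"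
    unfolding tube_closure_def by (auto elim: tube_domainE)
  then show ?thesis
  proof cases
    case 1
    have "a *\<^sub>R y + q \<in> lorentz_cone"
      using a 1 b' by (cases "a = 0") (auto intro!: lorentz_cone_add lorentz_cone_scaleR)
    then show ?thesis by (simp add: 1 b' re_im_vec_scaleR re_im_vec_add re_im_vec_in_tube)
  next
    case 2
    then show ?thesis by (simp add: b' re_im_vec_scaleR re_im_vec_add re_im_vec_in_tube)
  qed
qed

lemma continuous_on_affine_vec [continuous_intros]:
  fixes f :: "'b::topological_space \<Rightarrow> (complex, 'n::finite) vec"
  shows "continuous_on S f \<Longrightarrow> continuous_on S (\<lambda>x. c *s f x)"
  unfolding vector_scalar_mult_def by (intro continuous_intros)

lemma tube_det_has_derivative: "(tube_det has_derivative (\<lambda>v. - 2 * lorentz_form z v)) (at z)"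
proof -
  have 1: "((\<lambda>z. z $ i * z $ i) has_derivative (\<lambda>v. z $ i * v $ i + v $ i * z $ i)) (at z)" for i
    by (intro has_derivative_mult bounded_linear.has_derivative[OF bounded_linear_vec_nth] has_derivative_ident)
  have "(tube_det has_derivative (\<lambda>v. - ((z $ 1 * v $ 1 + v $ 1 * z $ 1) - (\<Sum>i\<in>UNIV - {1}. z $ i * v $ i + v $ i * z $ i)))) (at z)"
    unfolding tube_det_def[abs_def] lorentz_form_def
    by (intro has_derivative_minus has_derivative_diff has_derivative_sum 1)
  moreover have "(\<lambda>v. - ((z $ 1 * v $ 1 + v $ 1 * z $ 1) - (\<Sum>i\<in>UNIV - {1}. z $ i * v $ i + v $ i * z $ i))) = (\<lambda>v. - 2 * lorentz_form z v)"
    by (simp add: fun_eq_iff lorentz_form_def algebra_simps sum.distrib sum_distrib_left mult.commute sum_negf)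
  ultimately show ?thesis by simp
qed

lemma holomorphic_vec_on_tube_power:
  assumes b: "b \<in> tube_domain" and a: "0 \<le> a"
  shows "holomorphic_vec_on (\<lambda>w. tube_power s (complex_of_real a *s w + b)) tube_domain"
  unfolding holomorphic_vec_on_def
proof
  fix z :: "(complex, 'a) vec" assume "z \<in> tube_domain"
  then have w: "complex_of_real a *s z + b \<in> tube_domain" (is "?w \<in> _")
    by (intro tube_closure_shift b a) (simp add: tube_closure_def)
  have sc: "((*s) (complex_of_real a)) = ((*\<^sub>R) a :: (complex, 'a) vec \<Rightarrow> _)"
    by (simp add: fun_eq_iff vec_eq_iff) (simp add: scaleR_conv_of_real)
  have "((\<lambda>w. complex_of_real a *s w + b) has_derivative (\<lambda>v. complex_of_real a *s v)) (at z)"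
    unfolding sc by (auto intro!: derivative_eq_intros)
  then have 1: "((\<lambda>w. tube_det (complex_of_real a *s w + b)) has_derivative (\<lambda>v. - 2 * lorentz_form ?w (complex_of_real a *s v))) (at z)"
    by (rule has_derivative_compose) (rule tube_det_has_derivative)
  define P where "P = of_real s * tube_det ?w powr (of_real s - 1)"
  have "((\<lambda>t. t powr of_real s) has_field_derivative P) (at (tube_det ?w))"
    unfolding P_def by (rule has_field_derivative_powr) (rule tube_det_in_tube[OF w])
  then have "((\<lambda>t. t powr of_real s) has_derivative (*) P) (at (tube_det ?w))"
    by (simp add: has_field_derivative_def)
  from has_derivative_compose[OF 1 this]
  have "((\<lambda>w. tube_power s (complex_of_real a *s w + b)) has_derivative (\<lambda>v. P * (- 2 * lorentz_form ?w (complex_of_real a *s v)))) (at z)"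
    unfolding tube_power_def .
  moreover have "P * (- 2 * lorentz_form ?w (complex_of_real a *s (c *s v))) = c * (P * (- 2 * lorentz_form ?w (complex_of_real a *s v)))" for c v
    by (simp add: lorentz_form_def algebra_simps sum_distrib_left)
  ultimately show "\<exists>D. ((\<lambda>w. tube_power s (complex_of_real a *s w + b)) has_derivative D) (at z) \<and> (\<forall>c v. D (c *s v) = c * D v)"
    by blast
qed

lemma holomorphic_vec_on_mult:
  assumes "holomorphic_vec_on f S" "holomorphic_vec_on g S"
  shows "holomorphic_vec_on (\<lambda>z. f z * g z) S"
  unfolding holomorphic_vec_on_def
proof
  fix z assume z: "z \<in> S"
  obtain D where D: "(f has_derivative D) (at z)" "\<And>c v. D (c *s v) = c * D v"
    using assms(1) z unfolding holomorphic_vec_on_def by blast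
  obtain E where E: "(g has_derivative E) (at z)" "\<And>c v. E (c *s v) = c * E v"
    using assms(2) z unfolding holomorphic_vec_on_def by blast
  have "((\<lambda>z. f z * g z) has_derivative (\<lambda>v. f z * E v + D v * g z)) (at z)"
    by (rule has_derivative_mult[OF D(1) E(1)])
  moreover have "f z * E (c *s v) + D (c *s v) * g z = c * (f z * E v + D v * g z)" for c v
    by (simp add: D(2) E(2) algebra_simps)
  ultimately show "\<exists>D. ((\<lambda>z. f z * g z) has_derivative D) (at z) \<and> (\<forall>c v. D (c *s v) = c * D v)"
    by blast
qed

lemma tube_det_time_axis: "tube_det (re_im_vec 0 (a *\<^sub>R time_axis)) = complex_of_real (a\<^sup>2)"
  by (simp add: tube_det_re_im lorentz_det_scaleR lorentz_det_eq_form[of 0] lorentz_form_def complex_eq_iff)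

section \<open>The Szego formula\<close>

text \<open>
  The factor \<open>4\<^bsup>n/2\<^esup>\<close> is \<open>\<Delta>(2 e)\<^bsup>n/2\<^esup>\<close>, the value at \<open>i e\<close> of the power by which the function is
  multiplied in the proof of the Szego formula.
\<close>

definition szego_const :: "'n::{finite,one} itself \<Rightarrow> real" where
  "szego_const _ = measure poisson_measure (space (poisson_measure :: (real,'n) vec measure)) * 4 powr (real CARD('n) / 2)"

lemma szego_const_pos:
  assumes n: "2 \<le> CARD('n::{finite,one})"
  shows "0 < szego_const TYPE('n)"
proof -
  have "tube_det_mass (real CARD('n)) TYPE('n) \<noteq> 0"
  proof
    assume "tube_det_mass (real CARD('n)) TYPE('n) = 0"
    then have "AE x::(real,'n) vec in lborel. ennreal (cmod (tube_det (re_im_vec x time_axis)) powr (- real CARD('n))) = 0"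
      unfolding tube_det_mass_def by (subst (asm) nn_integral_0_iff_AE) auto
    then have "AE x::(real,'n) vec in lborel. False"
    proof eventually_elim
      case (elim x)
      have "tube_det (re_im_vec x time_axis) \<noteq> 0" by (intro tube_det_nonzero re_im_vec_in_tube) simp
      with elim show False by simp
    qed
    then show False by (simp add: ae_filter_eq_bot_iff eventually_False)
  qed
  moreover have "tube_det_mass (real CARD('n)) TYPE('n) < \<infinity>"
    by (rule tube_det_mass_finite[OF n]) simp
  ultimately have "0 < measure poisson_measure (space (poisson_measure :: (real,'n) vec measure))"
    unfolding measure_def emeasure_poisson_measure by (simp add: enn2real_positive_iff zero_less_iff_neq_zero)
  then show ?thesis unfolding szego_const_def by simp
qed

text \<open>
  The regularising factor in the Szego formula compares \<open>l + i\<close> with \<open>\<eta> l + i\<close>; the constant \<open>1 / \<eta>\<close> is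
  harmless since only boundedness is needed.
\<close>

lemma norm_add_i_scale_le:
  fixes l :: complex
  assumes "0 < Im l" "0 < \<eta>" "\<eta> \<le> 1"
  shows "\<eta> * cmod (l + \<i>) \<le> cmod (\<eta> * l + \<i>)"
proof -
  have "\<eta> * cmod (l + \<i>) = cmod (of_real \<eta> * l + of_real \<eta> * \<i>)"
    using assms by (simp add: distrib_left[symmetric] norm_mult)
  also have "\<dots> \<le> cmod (of_real \<eta> * l + \<i>)"
    using assms by (simp add: cmod_def power_mono)
  finally show ?thesis .
qed

lemma mult_le_sum_squares:
  fixes a b :: real
  assumes "0 \<le> a" "0 \<le> b"
  shows "a * b \<le> a\<^sup>2 + b\<^sup>2"
  using sum_squares_bound[of a b] mult_nonneg_nonneg[OF assms] by linarith

lemma integrable_mult_of_square_integrable: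
  fixes f g :: "'a \<Rightarrow> complex"
  assumes [measurable]: "f \<in> borel_measurable M" "g \<in> borel_measurable M"
    and "(\<integral>\<^sup>+ x. ennreal ((cmod (f x))\<^sup>2) \<partial>M) < \<infinity>" "(\<integral>\<^sup>+ x. ennreal ((cmod (g x))\<^sup>2) \<partial>M) < \<infinity>"
  shows "integrable M (\<lambda>x. f x * g x)"
proof (rule integrableI_bounded)
  have "(\<integral>\<^sup>+ x. ennreal (norm (f x * g x)) \<partial>M) \<le> (\<integral>\<^sup>+ x. ennreal ((cmod (f x))\<^sup>2) + ennreal ((cmod (g x))\<^sup>2) \<partial>M)"
  proof (rule nn_integral_mono)
    fix x
    have "cmod (f x) * cmod (g x) \<le> (cmod (f x))\<^sup>2 + (cmod (g x))\<^sup>2"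
      by (intro mult_le_sum_squares) auto
    then show "ennreal (norm (f x * g x)) \<le> ennreal ((cmod (f x))\<^sup>2) + ennreal ((cmod (g x))\<^sup>2)"
      by (simp add: norm_mult ennreal_plus[symmetric] ennreal_leI del: ennreal_plus)
  qed
  also have "\<dots> < \<infinity>" using assms by (subst nn_integral_add) auto
  finally show "(\<integral>\<^sup>+ x. ennreal (norm (f x * g x)) \<partial>M) < \<infinity>" .
qed simp

text \<open>
  Apply the Poisson formula to \<open>g(w) \<Delta>((w + i e) / i)\<^bsup>n/2\<^esup>\<close>: on \<open>\<real>\<^sup>n\<close> the Poisson density times this
  power is \<open>\<bar>\<Delta>\<bar>\<^bsup>-n\<^esup> \<Delta>\<^bsup>n/2\<^esup>\<close>, the complex conjugate of \<open>\<Delta>\<^bsup>-n/2\<^esup>\<close>. The product is unbounded, so it is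
  first multiplied by \<open>R = \<Delta>((\<eta> w + i e) / i)\<^bsup>-n/2\<^esup>\<close>, which is bounded by 1 on \<open>\<real>\<^sup>n\<close> and tends to 1 as \<open>\<eta> \<rightarrow> 0\<close>.
  Square integrability of \<open>g\<close> and of the kernel gives the dominating function.
\<close>

lemma szego_formula_base:
  fixes g :: "(complex, 'n::{finite,one}) vec \<Rightarrow> complex"
  assumes n: "2 \<le> CARD('n)"
    and holo: "holomorphic_vec_on g tube_domain"
    and cont: "continuous_on tube_closure g"
    and bound: "\<And>z. z \<in> tube_domain \<Longrightarrow> cmod (g z) \<le> B"
    and L2: "(\<integral>\<^sup>+ u. ennreal ((cmod (g (re_im_vec u 0)))\<^sup>2) \<partial>lborel) < \<infinity>"
  shows "(\<integral>u. g (re_im_vec u 0) * cnj (tube_power (- (real CARD('n) / 2)) (re_im_vec u time_axis)) \<partial>lborel)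
    = szego_const TYPE('n) * g (re_im_vec 0 time_axis)"
proof -
  let ?s = "real CARD('n) / 2"
  define b :: "(complex,'n) vec" where "b = re_im_vec 0 time_axis"
  have b: "b \<in> tube_domain" by (simp add: b_def re_im_vec_in_tube)
  define \<eta> where "\<eta> k = 1 / real (Suc k)" for k
  have \<eta>: "0 < \<eta> k" "\<eta> k \<le> 1" for k by (auto simp: \<eta>_def)
  have \<eta>lim: "\<eta> \<longlonglongrightarrow> 0" unfolding \<eta>_def by (rule LIMSEQ_Suc[OF lim_1_over_n])
  define R where "R k w = tube_power (- ?s) (complex_of_real (\<eta> k) *s w + b)" for k w
  define G where "G k w = g w * tube_power ?s (complex_of_real 1 *s w + b) * R k w" for k w
  have Gholo: "holomorphic_vec_on (G k) tube_domain" for k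
    unfolding G_def R_def using \<eta>[of k]
    by (intro holomorphic_vec_on_mult holo holomorphic_vec_on_tube_power b) auto
  have Gcont: "continuous_on tube_closure (G k)" for k
    unfolding G_def R_def using \<eta>[of k]
    by (intro continuous_intros cont tube_closure_shift b) auto
  have Gbound: "cmod (G k (spectral_complex u l m)) \<le> B * (1 / (\<eta> k)\<^sup>2) powr ?s"
    if u: "0 < spatial_norm u" and l: "0 < Im l" and m: "0 < Im m" for k u l m
  proof -
    have s1: "complex_of_real a *s spectral_complex u l m + b = spectral_complex u (of_real a * l + \<i>) (of_real a * m + \<i>)" for a
      unfolding b_def spectral_complex_ii[symmetric, of u]
      by (simp add: vec_eq_iff spectral_complex_nth algebra_simps add_divide_distrib diff_divide_distrib del: of_real_divide)
    define X where "X = cmod (l + \<i>) * cmod (m + \<i>)"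
    define Y where "Y = cmod (of_real (\<eta> k) * l + \<i>) * cmod (of_real (\<eta> k) * m + \<i>)"
    have ne: "complex_of_real a * w + \<i> \<noteq> 0" if "0 < Im w" "0 < a" for a w
    proof
      assume "complex_of_real a * w + \<i> = 0"
      then have "Im (complex_of_real a * w + \<i>) = 0" by simp
      with that show False by (simp add: add_pos_pos order_less_imp_not_eq2)
    qed
    have Y: "Y > 0" using ne[OF l \<eta>(1)] ne[OF m \<eta>(1)] by (simp add: Y_def)
    have XY: "(\<eta> k)\<^sup>2 * X \<le> Y"
      using mult_mono[OF norm_add_i_scale_le[OF l \<eta>] norm_add_i_scale_le[OF m \<eta>], of k k] \<eta>[of k]
      by (simp add: X_def Y_def power2_eq_square mult_ac)
    have td: "cmod (tube_det (complex_of_real 1 *s spectral_complex u l m + b)) = X"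
      "cmod (tube_det (complex_of_real (\<eta> k) *s spectral_complex u l m + b)) = Y"
      unfolding s1 tube_det_spectral_complex[OF u] X_def Y_def by (simp_all add: norm_mult)
    have "cmod (G k (spectral_complex u l m)) = cmod (g (spectral_complex u l m)) * (X powr ?s * Y powr (- ?s))"
      unfolding G_def R_def by (simp only: norm_mult norm_tube_power td mult.assoc)
    also have "\<dots> \<le> B * (1 / (\<eta> k)\<^sup>2) powr ?s"
    proof (rule mult_mono)
      show "cmod (g (spectral_complex u l m)) \<le> B" by (intro bound spectral_complex_in_tube u l m)
      then show "0 \<le> B" using norm_ge_zero order_trans by blast
      have "X \<le> 1 / (\<eta> k)\<^sup>2 * Y" using XY \<eta>[of k] by (simp add: field_simps)
      then have "X powr ?s \<le> (1 / (\<eta> k)\<^sup>2 * Y) powr ?s" by (intro powr_mono2) (auto simp: X_def)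
      also have "\<dots> = (1 / (\<eta> k)\<^sup>2) powr ?s * Y powr ?s" by (rule powr_mult)
      finally have "X powr ?s * Y powr (- ?s) \<le> (1 / (\<eta> k)\<^sup>2) powr ?s * Y powr ?s * Y powr (- ?s)"
        by (intro mult_right_mono) auto
      also have "\<dots> = (1 / (\<eta> k)\<^sup>2) powr ?s" using Y by (simp add: mult.assoc powr_add[symmetric])
      finally show "X powr ?s * Y powr (- ?s) \<le> (1 / (\<eta> k)\<^sup>2) powr ?s" .
    qed simp
    finally show ?thesis .
  qed
  let ?S = "\<lambda>u::(real,'n) vec. cnj (tube_power (- ?s) (re_im_vec u time_axis))"
  have gm [measurable]: "(\<lambda>u. g (re_im_vec u 0)) \<in> borel_measurable borel"
    by (intro borel_measurable_continuous_onI continuous_on_compose2[OF cont])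
       (auto intro!: continuous_intros simp: tube_closure_def)
  have real_shift: "complex_of_real a *s re_im_vec u 0 + b = re_im_vec (a *\<^sub>R u) time_axis" for a and u :: "(real,'n) vec"
    by (simp add: b_def re_im_vec_scaleR re_im_vec_add)
  have tubeu: "re_im_vec u time_axis \<in> tube_domain" for u :: "(real,'n) vec" by (simp add: re_im_vec_in_tube)
  \<comment> \<open>\<open>\<bar>a\<bar>\<^bsup>-n\<^esup> a\<^bsup>n/2\<^esup>\<close> is the conjugate of \<open>a\<^bsup>-n/2\<^esup>\<close>\<close>
  have conj: "(cmod (tube_det (re_im_vec u time_axis)) powr (- real CARD('n))) *\<^sub>R tube_power ?s (re_im_vec u time_axis) = ?S u" for u :: "(real,'n) vec"
  proof -
    let ?a = "tube_power ?s (re_im_vec u time_axis)" and ?b = "tube_power (- ?s) (re_im_vec u time_axis)"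
    have "cmod (tube_det (re_im_vec u time_axis)) powr (- real CARD('n)) = (cmod ?b)\<^sup>2"
      by (simp add: norm_tube_power power2_eq_square powr_add[symmetric])
    then have "(cmod (tube_det (re_im_vec u time_axis)) powr (- real CARD('n))) *\<^sub>R ?a = ?b * cnj ?b * ?a"
      by (simp only: scaleR_conv_of_real complex_norm_square)
    also have "\<dots> = (?a * ?b) * cnj ?b" by (simp only: mult_ac)
    also have "\<dots> = cnj ?b" by (simp only: tube_power_minus[OF tubeu] mult_1)
    finally show ?thesis .
  qed
  have lhs: "(\<integral>u. G k (re_im_vec u 0) \<partial>poisson_measure) = (\<integral>u. g (re_im_vec u 0) * ?S u * R k (re_im_vec u 0) \<partial>lborel)" for k
  proof -
    have [measurable]: "(\<lambda>u. R k (re_im_vec u 0)) \<in> borel_measurable borel"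
      unfolding R_def real_shift by measurable
    have Gm: "(\<lambda>u. G k (re_im_vec u 0)) \<in> borel_measurable lborel"
      unfolding G_def real_shift by measurable
    have "(\<integral>u. G k (re_im_vec u 0) \<partial>poisson_measure)
      = (\<integral>u. (cmod (tube_det (re_im_vec u time_axis)) powr (- real CARD('n))) *\<^sub>R G k (re_im_vec u 0) \<partial>lborel)"
      unfolding poisson_measure_def by (rule integral_density[OF Gm]) auto
    also have "\<dots> = (\<integral>u. g (re_im_vec u 0) * ?S u * R k (re_im_vec u 0) \<partial>lborel)"
      by (intro Bochner_Integration.integral_cong refl)
         (simp add: G_def real_shift[of 1] conj[symmetric] del: of_real_1)
    finally show ?thesis .
  qed
  have Rb: "cmod (R k (re_im_vec u 0)) \<le> 1" for k and u :: "(real,'n) vec"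
  proof -
    have "1 \<le> cmod (tube_det (re_im_vec (\<eta> k *\<^sub>R u) time_axis))"
      using norm_tube_det_ge[of "time_axis::(real,'n) vec" "\<eta> k *\<^sub>R u"] by simp
    then have "cmod (tube_det (re_im_vec (\<eta> k *\<^sub>R u) time_axis)) powr (- ?s) \<le> 1 powr (- ?s)"
      by (intro powr_mono2') auto
    then show ?thesis by (simp add: R_def real_shift norm_tube_power)
  qed
  have one: "tube_power s b = 1" for s
    using tube_det_time_axis[of 1, where 'a = 'n] by (simp add: tube_power_def b_def)
  have Rlim: "(\<lambda>k. R k w) \<longlonglongrightarrow> 1" if w: "w \<in> tube_closure" for w
  proof -
    have "(\<lambda>k. complex_of_real (\<eta> k) *s w + b) \<longlonglongrightarrow> complex_of_real 0 *s w + b"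
      by (rule vec_tendstoI) (auto intro!: tendsto_intros \<eta>lim simp del: of_real_0)
    then have "(\<lambda>k. complex_of_real (\<eta> k) *s w + b) \<longlonglongrightarrow> b" by (simp add: vec_eq_iff)
    then have "(\<lambda>k. R k w) \<longlonglongrightarrow> tube_power (- ?s) b"
      unfolding R_def
    proof (rule continuous_on_tendsto_compose[rotated])
      show "continuous_on tube_domain (tube_power (- ?s) :: (complex,'n) vec \<Rightarrow> complex)"
        using continuous_on_tube_power[OF continuous_on_id, of tube_domain] by simp
      show "\<forall>\<^sub>F k in sequentially. complex_of_real (\<eta> k) *s w + b \<in> tube_domain"
        using \<eta> by (intro always_eventually allI tube_closure_shift w b) (simp add: less_imp_le)
    qed (rule b)
    then show ?thesis by (simp add: one)
  qed
  have S2: "(\<integral>\<^sup>+ u. ennreal ((cmod (?S u))\<^sup>2) \<partial>lborel) < \<infinity>"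
  proof -
    have "(\<integral>\<^sup>+ u. ennreal ((cmod (?S u))\<^sup>2) \<partial>lborel) = tube_det_mass (real CARD('n)) TYPE('n)"
      unfolding tube_det_mass_def
      by (intro nn_integral_cong) (simp add: norm_tube_power power2_eq_square powr_add[symmetric])
    also have "\<dots> < \<infinity>" by (rule tube_det_mass_finite[OF n]) simp
    finally show ?thesis .
  qed
  have int: "integrable lborel (\<lambda>u. g (re_im_vec u 0) * ?S u)"
    by (rule integrable_mult_of_square_integrable) (use L2 S2 in simp_all)
  have lim1: "(\<lambda>k. \<integral>u. g (re_im_vec u 0) * ?S u * R k (re_im_vec u 0) \<partial>lborel)
     \<longlonglongrightarrow> (\<integral>u. g (re_im_vec u 0) * ?S u \<partial>lborel)"
  proof (rule integral_dominated_convergence[where w = "\<lambda>u. cmod (g (re_im_vec u 0) * ?S u)"])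
    show "integrable lborel (\<lambda>u. cmod (g (re_im_vec u 0) * ?S u))" using int by (rule integrable_norm)
    show "AE u in lborel. (\<lambda>k. g (re_im_vec u 0) * ?S u * R k (re_im_vec u 0)) \<longlonglongrightarrow> g (re_im_vec u 0) * ?S u"
    proof (rule AE_I2)
      fix u :: "(real,'n) vec"
      have "(\<lambda>k. R k (re_im_vec u 0)) \<longlonglongrightarrow> 1" by (rule Rlim) (auto simp: tube_closure_def)
      from tendsto_mult_left[OF this, of "g (re_im_vec u 0) * ?S u"]
      show "(\<lambda>k. g (re_im_vec u 0) * ?S u * R k (re_im_vec u 0)) \<longlonglongrightarrow> g (re_im_vec u 0) * ?S u" by simp
    qed
    show "AE u in lborel. norm (g (re_im_vec u 0) * ?S u * R k (re_im_vec u 0)) \<le> cmod (g (re_im_vec u 0) * ?S u)" for k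
      using Rb by (intro AE_I2) (simp add: norm_mult mult_left_le)
    show "(\<lambda>u. g (re_im_vec u 0) * ?S u * R k (re_im_vec u 0)) \<in> borel_measurable lborel" for k
      unfolding R_def real_shift by measurable
  qed measurable
  have eq: "(\<integral>u. g (re_im_vec u 0) * ?S u * R k (re_im_vec u 0) \<partial>lborel)
    = measure poisson_measure (space (poisson_measure :: (real,'n) vec measure)) * G k b" for k
    unfolding lhs[symmetric] b_def by (rule poisson_formula[OF n Gholo Gcont Gbound])
  have lim2: "(\<lambda>k. measure poisson_measure (space (poisson_measure :: (real,'n) vec measure)) * G k b)
     \<longlonglongrightarrow> measure poisson_measure (space (poisson_measure :: (real,'n) vec measure)) * (g b * tube_power ?s (complex_of_real 1 *s b + b) * 1)"
    unfolding G_def using b by (intro tendsto_intros Rlim) (auto simp: tube_closure_def)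
  have val: "tube_power ?s (complex_of_real 1 *s b + b) = of_real (4 powr ?s)"
  proof -
    have "complex_of_real 1 *s b + b = re_im_vec 0 (2 *\<^sub>R time_axis)"
      by (simp add: b_def re_im_vec_add scaleR_2)
    then have "tube_power ?s (complex_of_real 1 *s b + b) = complex_of_real (2\<^sup>2) powr complex_of_real ?s"
      by (simp only: tube_power_def tube_det_time_axis)
    also have "\<dots> = of_real ((2\<^sup>2) powr ?s)" by (rule powr_of_real) simp
    also have "(2::real)\<^sup>2 = 4" by simp
    finally show ?thesis .
  qed
  have "(\<integral>u. g (re_im_vec u 0) * ?S u \<partial>lborel)
    = measure poisson_measure (space (poisson_measure :: (real,'n) vec measure)) * (g b * of_real (4 powr ?s) * 1)"
    using LIMSEQ_unique[OF lim1[unfolded eq] lim2] unfolding val .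
  then show ?thesis by (simp add: szego_const_def b_def mult_ac)
qed

lemma conformal_map_measurable [measurable]: "conformal_map y \<in> borel_measurable borel"
  using linear_conformal_map
  by (intro borel_measurable_continuous_onI linear_continuous_on) (simp add: linear_conv_bounded_linear)

lemma lebesgue_integral_conformal_map:
  fixes y :: "(real, 'n::{finite,one}) vec" and h :: "(real, 'n) vec \<Rightarrow> complex"
  assumes y: "y \<in> lorentz_cone" and [measurable]: "h \<in> borel_measurable borel"
  shows "(\<integral>u. h (conformal_map y u) \<partial>lborel) = complex_of_real (lorentz_det y powr (- (real CARD('n) / 2))) * (\<integral>u. h u \<partial>lborel)"
proof -
  let ?c = "lorentz_det y powr (real CARD('n) / 2)"
  have d: "lorentz_det y > 0" using y by (rule lorentz_coneD)
  have "lborel = density (distr lborel borel (conformal_map y)) (\<lambda>_. ennreal ?c)"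
  proof (rule measure_eqI)
    fix A :: "(real,'n) vec set" assume "A \<in> sets lborel"
    then have [measurable]: "A \<in> sets borel" by simp
    have "emeasure lborel A = (\<integral>\<^sup>+ u. indicator A u \<partial>lborel)" by simp
    also have "\<dots> = ennreal ?c * (\<integral>\<^sup>+ u. indicator A (conformal_map y u) \<partial>lborel)"
      by (rule nn_integral_conformal_map[OF y]) measurable
    also have "\<dots> = emeasure (density (distr lborel borel (conformal_map y)) (\<lambda>_. ennreal ?c)) A"
      by (subst emeasure_density, simp, simp, subst nn_integral_cmult, simp, subst nn_integral_distr) simp_all
    finally show "emeasure lborel A = emeasure (density (distr lborel borel (conformal_map y)) (\<lambda>_. ennreal ?c)) A" .
  qed simp
  then have "(\<integral>u. h u \<partial>lborel) = (\<integral>u. h u \<partial>density (distr lborel borel (conformal_map y)) (\<lambda>_. ennreal ?c))" by simp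
  also have "\<dots> = (\<integral>u. ?c *\<^sub>R h u \<partial>distr lborel borel (conformal_map y))" by (rule integral_density) auto
  also have "\<dots> = (\<integral>u. ?c *\<^sub>R h (conformal_map y u) \<partial>lborel)" by (rule integral_distr) measurable
  also have "\<dots> = ?c *\<^sub>R (\<integral>u. h (conformal_map y u) \<partial>lborel)" by simp
  finally have *: "(\<integral>u. h u \<partial>lborel) = complex_of_real ?c * (\<integral>u. h (conformal_map y u) \<partial>lborel)"
    by (simp only: scaleR_conv_of_real)
  have "complex_of_real (lorentz_det y powr (- (real CARD('n) / 2))) * complex_of_real ?c
    = complex_of_real (lorentz_det y powr (- (real CARD('n) / 2)) * ?c)"
    by (rule of_real_mult[symmetric])
  also have "lorentz_det y powr (- (real CARD('n) / 2)) * ?c = 1" using d by (simp add: powr_add[symmetric])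
  finally show ?thesis unfolding * mult.assoc[symmetric] by simp
qed

text \<open>
  The complex affine automorphism of the tube that takes \<open>i e\<close> to \<open>x + i y\<close>.
\<close>

definition affine_tube_map :: "real ^ 'n::{finite,one} \<Rightarrow> real ^ 'n::{finite,one} \<Rightarrow> complex ^ 'n::{finite,one} \<Rightarrow> complex ^ 'n::{finite,one}" where
  "affine_tube_map x y w = re_im_vec (x + conformal_map y (\<chi> i. Re (w $ i))) (conformal_map y (\<chi> i. Im (w $ i)))"

lemma affine_tube_map_re_im: "affine_tube_map x y (re_im_vec u v) = re_im_vec (x + conformal_map y u) (conformal_map y v)"
  by (simp add: affine_tube_map_def re_im_vec_def)

lemma holomorphic_vec_on_affine_tube_map:
  assumes holo: "holomorphic_vec_on g tube_domain" and y: "y \<in> lorentz_cone"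
  shows "holomorphic_vec_on (\<lambda>w. g (affine_tube_map x y w)) tube_domain"
  unfolding holomorphic_vec_on_def
proof
  fix z :: "(complex,'a) vec" assume "z \<in> tube_domain"
  then have "affine_tube_map x y z \<in> tube_domain"
    using conformal_map_in_cone[OF y] by (auto elim!: tube_domainE simp: affine_tube_map_re_im re_im_vec_in_tube)
  then obtain D where D: "(g has_derivative D) (at (affine_tube_map x y z))" "\<And>c v. D (c *s v) = c * D v"
    using holo unfolding holomorphic_vec_on_def by blast
  note lin = linear_add[OF linear_conformal_map] linear_cmul[OF linear_conformal_map] linear_diff[OF linear_conformal_map]
  define L where "L w = affine_tube_map 0 y w" for w :: "(complex,'a) vec"
  have Lc: "L (c *s w) = c *s L w" for c w
  proof -
    have "(\<chi> i. Re ((c *s w) $ i)) = Re c *\<^sub>R (\<chi> i. Re (w $ i)) - Im c *\<^sub>R (\<chi> i. Im (w $ i))"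
      "(\<chi> i. Im ((c *s w) $ i)) = Re c *\<^sub>R (\<chi> i. Im (w $ i)) + Im c *\<^sub>R (\<chi> i. Re (w $ i))"
      by (simp_all add: vec_eq_iff)
    then show ?thesis
      unfolding L_def affine_tube_map_def
      by (simp only: lin add_0) (simp add: vec_eq_iff re_im_vec_def complex_eq_iff)
  qed
  have La: "L (v + w) = L v + L w" for v w
  proof -
    have "(\<chi> i. Re ((v + w) $ i)) = (\<chi> i. Re (v $ i)) + (\<chi> i. Re (w $ i))"
      "(\<chi> i. Im ((v + w) $ i)) = (\<chi> i. Im (v $ i)) + (\<chi> i. Im (w $ i))"
      by (simp_all add: vec_eq_iff)
    then show ?thesis unfolding L_def affine_tube_map_def
      by (simp only: lin add_0 re_im_vec_add)
  qed
  have "linear L"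
  proof (rule linearI)
    show "L (r *\<^sub>R w) = r *\<^sub>R L w" for r w
      using Lc[of "of_real r" w] by (simp add: vector_scalar_mult_def scaleR_vec_def scaleR_conv_of_real)
  qed (rule La)
  then have Lb: "bounded_linear L" by (simp add: linear_conv_bounded_linear)
  have aff: "affine_tube_map x y w = re_im_vec x 0 + L w" for w
    by (simp add: L_def affine_tube_map_def re_im_vec_add)
  have "((\<lambda>w. re_im_vec x 0 + L w) has_derivative L) (at z)"
    using bounded_linear_imp_has_derivative[OF Lb] by (auto intro!: derivative_eq_intros)
  then have "((\<lambda>w. g (affine_tube_map x y w)) has_derivative (\<lambda>v. D (L v))) (at z)"
    unfolding aff[symmetric] by (rule has_derivative_compose) (rule D(1))
  moreover have "D (L (c *s v)) = c * D (L v)" for c v by (simp add: Lc D(2))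
  ultimately show "\<exists>D. ((\<lambda>w. g (affine_tube_map x y w)) has_derivative D) (at z) \<and> (\<forall>c v. D (c *s v) = c * D v)"
    by blast
qed

lemma lebesgue_integral_translate:
  fixes h :: "'a::euclidean_space \<Rightarrow> complex"
  assumes [measurable]: "h \<in> borel_measurable borel"
  shows "(\<integral>u. h (c + u) \<partial>lborel) = (\<integral>u. h u \<partial>lborel)"
  by (subst (2) lborel_distr_plus[of c, symmetric]) (simp add: integral_distr)

text \<open>
  The formula at \<open>i e\<close>, transported by the affine automorphism that takes \<open>i e\<close> to \<open>x + i y\<close>. The constant
  does not change: the kernel is homogeneous of degree \<open>-n/2\<close> in \<open>\<Delta>(y)\<close>, which cancels the Jacobian
  \<open>\<Delta>(y)\<^bsup>n/2\<^esup>\<close>.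
\<close>

theorem szego_formula:
  fixes g :: "(complex, 'n::{finite,one}) vec \<Rightarrow> complex"
  assumes n: "2 \<le> CARD('n)"
    and holo: "holomorphic_vec_on g tube_domain"
    and cont: "continuous_on tube_closure g"
    and bound: "\<And>z. z \<in> tube_domain \<Longrightarrow> cmod (g z) \<le> B"
    and L2: "(\<integral>\<^sup>+ u. ennreal ((cmod (g (re_im_vec u 0)))\<^sup>2) \<partial>lborel) < \<infinity>"
    and y: "y \<in> lorentz_cone"
  shows "(\<integral>u. g (re_im_vec u 0) * cnj (tube_power (- (real CARD('n) / 2)) (re_im_vec (u - x) y)) \<partial>lborel)
    = szego_const TYPE('n) * g (re_im_vec x y)"
proof -
  let ?s = "real CARD('n) / 2" and ?A = "conformal_map y" and ?d = "lorentz_det y"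
  let ?f = "\<lambda>w. g (affine_tube_map x y w)"
  have d: "?d > 0" using y by (rule lorentz_coneD)
  have gm [measurable]: "(\<lambda>u. g (re_im_vec u 0)) \<in> borel_measurable borel"
    by (intro borel_measurable_continuous_onI continuous_on_compose2[OF cont])
       (auto intro!: continuous_intros simp: tube_closure_def)
  have A0: "?A 0 = 0" using linear_0[OF linear_conformal_map] .
  have cl: "affine_tube_map x y w \<in> tube_closure" if "w \<in> tube_closure" for w
    using that conformal_map_in_cone[OF y]
    by (auto simp: tube_closure_def affine_tube_map_re_im A0 re_im_vec_in_tube elim!: tube_domainE)
  have tu: "affine_tube_map x y w \<in> tube_domain" if "w \<in> tube_domain" for w
    using that conformal_map_in_cone[OF y]
    by (auto simp: affine_tube_map_re_im re_im_vec_in_tube elim!: tube_domainE)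
  have A: "continuous_on UNIV ?A"
    using linear_conformal_map by (intro linear_continuous_on) (simp add: linear_conv_bounded_linear)
  have "continuous_on UNIV (\<lambda>w::(complex,'n) vec. ?A (\<chi> i. Re (w $ i)))"
    by (rule continuous_on_compose2[OF A]) (auto intro!: continuous_on_vec_lambda continuous_intros)
  moreover have "continuous_on UNIV (\<lambda>w::(complex,'n) vec. ?A (\<chi> i. Im (w $ i)))"
    by (rule continuous_on_compose2[OF A]) (auto intro!: continuous_on_vec_lambda continuous_intros)
  ultimately have "continuous_on UNIV (affine_tube_map x y)"
    unfolding affine_tube_map_def[abs_def]
    by (intro continuous_on_re_im_vec continuous_on_add continuous_on_const)
  then have cont': "continuous_on tube_closure ?f"
    using cl by (intro continuous_on_compose2[OF cont]) (auto intro: continuous_on_subset)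
  have "(\<integral>\<^sup>+ u. ennreal ((cmod (g (re_im_vec u 0)))\<^sup>2) \<partial>lborel)
    = (\<integral>\<^sup>+ u. ennreal ((cmod (g (re_im_vec (x + u) 0)))\<^sup>2) \<partial>lborel)"
    by (rule nn_integral_lborel_translate[symmetric]) measurable
  also have "\<dots> = ennreal (?d powr ?s) * (\<integral>\<^sup>+ u. ennreal ((cmod (g (re_im_vec (x + ?A u) 0)))\<^sup>2) \<partial>lborel)"
    by (rule nn_integral_conformal_map[OF y]) measurable
  finally have L2': "(\<integral>\<^sup>+ u. ennreal ((cmod (?f (re_im_vec u 0)))\<^sup>2) \<partial>lborel) < \<infinity>"
    using L2 d by (auto simp: affine_tube_map_re_im A0 ennreal_mult_less_top)
  have "(\<integral>u. ?f (re_im_vec u 0) * cnj (tube_power (- ?s) (re_im_vec u time_axis)) \<partial>lborel)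
    = szego_const TYPE('n) * ?f (re_im_vec 0 time_axis)"
    by (rule szego_formula_base[OF n holomorphic_vec_on_affine_tube_map[OF holo y] cont' bound[OF tu] L2'])
  also have "?f (re_im_vec 0 time_axis) = g (re_im_vec x y)"
    by (simp add: affine_tube_map_re_im A0 conformal_map_time_axis[OF y])
  also have "(\<integral>u. ?f (re_im_vec u 0) * cnj (tube_power (- ?s) (re_im_vec u time_axis)) \<partial>lborel)
    = (\<integral>u. of_real (?d powr ?s) * (g (re_im_vec (x + ?A u) 0) * cnj (tube_power (- ?s) (re_im_vec (?A u) y))) \<partial>lborel)"
  proof (rule Bochner_Integration.integral_cong[OF refl])
    fix u :: "(real,'n) vec"
    have "tube_det (re_im_vec (?A u) y) = of_real ?d * tube_det (re_im_vec u time_axis)"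
      using tube_det_conformal_map[OF y, of u time_axis] by (simp add: conformal_map_time_axis[OF y])
    then have "tube_power (- ?s) (re_im_vec (?A u) y) = of_real ?d powr of_real (- ?s) * tube_power (- ?s) (re_im_vec u time_axis)"
      using d unfolding tube_power_def by (subst powr_times_real_left[symmetric]) auto
    also have "of_real ?d powr complex_of_real (- ?s) = of_real (?d powr (- ?s))"
      using d by (intro powr_of_real) auto
    finally have "of_real (?d powr ?s) * tube_power (- ?s) (re_im_vec (?A u) y) = (of_real (?d powr ?s * ?d powr (- ?s))) * tube_power (- ?s) (re_im_vec u time_axis)"
      by simp
    then have e: "tube_power (- ?s) (re_im_vec u time_axis) = of_real (?d powr ?s) * tube_power (- ?s) (re_im_vec (?A u) y)"
      using d by (simp add: powr_add[symmetric] del: of_real_mult)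
    show "?f (re_im_vec u 0) * cnj (tube_power (- ?s) (re_im_vec u time_axis))
      = of_real (?d powr ?s) * (g (re_im_vec (x + ?A u) 0) * cnj (tube_power (- ?s) (re_im_vec (?A u) y)))"
      unfolding e by (simp add: affine_tube_map_re_im A0)
  qed
  also have "\<dots> = of_real (?d powr ?s) * (\<integral>u. g (re_im_vec (x + ?A u) 0) * cnj (tube_power (- ?s) (re_im_vec (?A u) y)) \<partial>lborel)"
    by simp
  also have "(\<integral>u. g (re_im_vec (x + ?A u) 0) * cnj (tube_power (- ?s) (re_im_vec (?A u) y)) \<partial>lborel)
    = of_real (?d powr (- ?s)) * (\<integral>u. g (re_im_vec (x + u) 0) * cnj (tube_power (- ?s) (re_im_vec u y)) \<partial>lborel)"
    by (rule lebesgue_integral_conformal_map[OF y]) measurable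
  also have "(\<integral>u. g (re_im_vec (x + u) 0) * cnj (tube_power (- ?s) (re_im_vec u y)) \<partial>lborel)
    = (\<integral>u. g (re_im_vec u 0) * cnj (tube_power (- ?s) (re_im_vec (u - x) y)) \<partial>lborel)"
    using lebesgue_integral_translate[of "\<lambda>u. g (re_im_vec u 0) * cnj (tube_power (- ?s) (re_im_vec (u - x) y))" x] by simp
  finally have *: "of_real (?d powr ?s) * (of_real (?d powr (- ?s)) * (\<integral>u. g (re_im_vec u 0) * cnj (tube_power (- ?s) (re_im_vec (u - x) y)) \<partial>lborel))
    = szego_const TYPE('n) * g (re_im_vec x y)" .
  have "complex_of_real (?d powr ?s) * complex_of_real (?d powr (- ?s)) = complex_of_real (?d powr ?s * ?d powr (- ?s))"
    by (rule of_real_mult[symmetric])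
  also have "?d powr ?s * ?d powr (- ?s) = 1" using d by (simp add: powr_add[symmetric])
  finally show ?thesis using * unfolding mult.assoc[symmetric] by simp
qed

lemma nn_integral_tube_power_sq:
  fixes y :: "(real, 'n::{finite,one}) vec"
  assumes y: "y \<in> lorentz_cone"
  shows "(\<integral>\<^sup>+ u. ennreal ((cmod (tube_power (- (real CARD('n) / 2)) (re_im_vec (u - x) y)))\<^sup>2) \<partial>lborel)
    = tube_det_mass (real CARD('n)) TYPE('n) * ennreal (lorentz_det y powr (- (real CARD('n) / 2)))"
proof -
  have "(\<integral>\<^sup>+ u. ennreal ((cmod (tube_power (- (real CARD('n) / 2)) (re_im_vec (u - x) y)))\<^sup>2) \<partial>lborel)
    = (\<integral>\<^sup>+ u. ennreal (cmod (tube_det (re_im_vec (- x + u) y)) powr (- real CARD('n))) \<partial>lborel)"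
    by (intro nn_integral_cong) (simp add: norm_tube_power power2_eq_square powr_add[symmetric])
  also have "\<dots> = (\<integral>\<^sup>+ u. ennreal (cmod (tube_det (re_im_vec u y)) powr (- real CARD('n))) \<partial>lborel)"
    by (rule nn_integral_lborel_translate) measurable
  finally show ?thesis by (simp add: nn_integral_tube_det_powr[OF y])
qed

text \<open>
  The Szego formula applied to the kernel itself: it computes all inner products of kernels.
\<close>

lemma szego_kernel_reproducing:
  fixes y v :: "(real, 'n::{finite,one}) vec"
  assumes n: "2 \<le> CARD('n)" and y: "y \<in> lorentz_cone" and v: "v \<in> lorentz_cone"
  shows "(\<integral>u. tube_power (- (real CARD('n) / 2)) (re_im_vec (u - x') v) * cnj (tube_power (- (real CARD('n) / 2)) (re_im_vec (u - x) y)) \<partial>lborel)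
    = szego_const TYPE('n) * tube_power (- (real CARD('n) / 2)) (re_im_vec (x - x') (y + v))"
proof -
  let ?s = "real CARD('n) / 2"
  define g where "g w = tube_power (- ?s) (complex_of_real 1 *s w + re_im_vec (- x') v)" for w
  have b: "re_im_vec (- x') v \<in> tube_domain" using v by (rule re_im_vec_in_tube)
  have gre: "g (re_im_vec p q) = tube_power (- ?s) (re_im_vec (p - x') (q + v))" for p q
    by (simp add: g_def re_im_vec_add)
  have "(\<integral>u. g (re_im_vec u 0) * cnj (tube_power (- ?s) (re_im_vec (u - x) y)) \<partial>lborel) = szego_const TYPE('n) * g (re_im_vec x y)"
  proof (rule szego_formula[OF n _ _ _ _ y])
    show "holomorphic_vec_on g tube_domain"
      unfolding g_def by (intro holomorphic_vec_on_tube_power b) simp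
    show "continuous_on tube_closure g"
      unfolding g_def by (intro continuous_intros tube_closure_shift b) auto
    show "cmod (g z) \<le> lorentz_det v powr (- ?s)" if z: "z \<in> tube_domain" for z
    proof -
      obtain p q where pq: "z = re_im_vec p q" "q \<in> lorentz_cone" using z by (rule tube_domainE)
      have "lorentz_det v \<le> lorentz_det (v + q)" by (rule lorentz_det_add_ge[OF v pq(2)])
      also have "\<dots> \<le> cmod (tube_det (re_im_vec (p - x') (v + q)))"
        by (rule norm_tube_det_ge[OF lorentz_cone_add[OF v pq(2)]])
      finally show ?thesis
        using lorentz_coneD(1)[OF v] unfolding pq(1) gre norm_tube_power
        by (intro powr_mono2') (auto simp: add.commute)
    qed
    show "(\<integral>\<^sup>+ u. ennreal ((cmod (g (re_im_vec u 0)))\<^sup>2) \<partial>lborel) < \<infinity>"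
      unfolding gre add_0 nn_integral_tube_power_sq[OF v]
      using tube_det_mass_finite[OF n, of "real CARD('n)"] by (simp add: ennreal_mult_less_top)
  qed
  then show ?thesis by (simp add: gre)
qed

section \<open>Hardy functions are bounded at positive height\<close>

lemma nn_integral_shear_fst:
  fixes G :: "'a::euclidean_space \<Rightarrow> 'a \<Rightarrow> ennreal"
  assumes [measurable]: "case_prod G \<in> borel_measurable (borel \<Otimes>\<^sub>M borel)"
  shows "(\<integral>\<^sup>+ \<xi>. \<integral>\<^sup>+ \<eta>. G (\<xi> + a *\<^sub>R \<eta>) \<eta> \<partial>lborel \<partial>lborel) = (\<integral>\<^sup>+ \<xi>. \<integral>\<^sup>+ \<eta>. G \<xi> \<eta> \<partial>lborel \<partial>lborel)"
proof -
  note [measurable (raw)] = measurable_case_prod_compose[OF assms(1)]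
  have "(\<integral>\<^sup>+ \<xi>. \<integral>\<^sup>+ \<eta>. G (\<xi> + a *\<^sub>R \<eta>) \<eta> \<partial>lborel \<partial>lborel) = (\<integral>\<^sup>+ \<eta>. \<integral>\<^sup>+ \<xi>. G (\<xi> + a *\<^sub>R \<eta>) \<eta> \<partial>lborel \<partial>lborel)"
    by (intro lborel_pair.Fubini') measurable
  also have "\<dots> = (\<integral>\<^sup>+ \<eta>. \<integral>\<^sup>+ \<xi>. G \<xi> \<eta> \<partial>lborel \<partial>lborel)"
  proof (rule nn_integral_cong)
    fix \<eta> :: 'a
    show "(\<integral>\<^sup>+ \<xi>. G (\<xi> + a *\<^sub>R \<eta>) \<eta> \<partial>lborel) = (\<integral>\<^sup>+ \<xi>. G \<xi> \<eta> \<partial>lborel)"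
      using nn_integral_lborel_translate[of "\<lambda>\<xi>. G \<xi> \<eta>" "a *\<^sub>R \<eta>"] by (simp add: add.commute)
  qed
  also have "\<dots> = (\<integral>\<^sup>+ \<xi>. \<integral>\<^sup>+ \<eta>. G \<xi> \<eta> \<partial>lborel \<partial>lborel)"
    by (intro lborel_pair.Fubini') measurable
  finally show ?thesis .
qed

lemma nn_integral_shear_snd:
  fixes G :: "'a::euclidean_space \<Rightarrow> 'a \<Rightarrow> ennreal"
  assumes [measurable]: "case_prod G \<in> borel_measurable (borel \<Otimes>\<^sub>M borel)"
  shows "(\<integral>\<^sup>+ \<xi>. \<integral>\<^sup>+ \<eta>. G \<xi> (\<eta> + b *\<^sub>R \<xi>) \<partial>lborel \<partial>lborel) = (\<integral>\<^sup>+ \<xi>. \<integral>\<^sup>+ \<eta>. G \<xi> \<eta> \<partial>lborel \<partial>lborel)"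
proof (rule nn_integral_cong)
  fix \<xi> :: 'a
  have "(\<lambda>\<eta>. case_prod G (\<xi>, \<eta>)) \<in> borel_measurable borel" by measurable
  then have [measurable]: "G \<xi> \<in> borel_measurable borel" by simp
  show "(\<integral>\<^sup>+ \<eta>. G \<xi> (\<eta> + b *\<^sub>R \<xi>) \<partial>lborel) = (\<integral>\<^sup>+ \<eta>. G \<xi> \<eta> \<partial>lborel)"
    using nn_integral_lborel_translate[of "G \<xi>" "b *\<^sub>R \<xi>"] by (simp add: add.commute)
qed

text \<open>
  A rotation is a product of three shears, and a shear preserves the measure because it is a translation in
  one of the two variables.
\<close>

lemma nn_integral_rotation:
  fixes G :: "'a::euclidean_space \<Rightarrow> 'a \<Rightarrow> ennreal"
  assumes G [measurable]: "case_prod G \<in> borel_measurable (borel \<Otimes>\<^sub>M borel)" and cs: "c\<^sup>2 + s\<^sup>2 = 1" "s \<noteq> 0"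
  shows "(\<integral>\<^sup>+ \<xi>. \<integral>\<^sup>+ \<eta>. G (c *\<^sub>R \<xi> - s *\<^sub>R \<eta>) (s *\<^sub>R \<xi> + c *\<^sub>R \<eta>) \<partial>lborel \<partial>lborel) = (\<integral>\<^sup>+ \<xi>. \<integral>\<^sup>+ \<eta>. G \<xi> \<eta> \<partial>lborel \<partial>lborel)"
proof -
  \<comment> \<open>the first and the last shear have slope \<open>a\<close>, the middle one has slope \<open>s\<close>\<close>
  define a where "a = (c - 1) / s"
  have as: "1 + a * s = c" using cs by (simp add: a_def)
  have "a * (1 + c) = - s"
    using cs by (simp add: a_def field_simps power2_eq_square)
  moreover have "a + (a + a * (a * s)) = a * (1 + (1 + a * s))" by (simp add: algebra_simps)
  ultimately have aas: "a + (a + a * (a * s)) = - s" by (simp only: as)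
  note [measurable (raw)] = measurable_case_prod_compose[OF assms(1)]
  have "(\<integral>\<^sup>+ \<xi>. \<integral>\<^sup>+ \<eta>. G \<xi> \<eta> \<partial>lborel \<partial>lborel) = (\<integral>\<^sup>+ \<xi>. \<integral>\<^sup>+ \<eta>. G (\<xi> + a *\<^sub>R \<eta>) \<eta> \<partial>lborel \<partial>lborel)"
    by (rule nn_integral_shear_fst[symmetric]) measurable
  also have "\<dots> = (\<integral>\<^sup>+ \<xi>. \<integral>\<^sup>+ \<eta>. G (\<xi> + a *\<^sub>R (\<eta> + s *\<^sub>R \<xi>)) (\<eta> + s *\<^sub>R \<xi>) \<partial>lborel \<partial>lborel)"
    by (rule nn_integral_shear_snd[symmetric, of "\<lambda>\<xi> \<eta>. G (\<xi> + a *\<^sub>R \<eta>) \<eta>"]) measurable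
  also have "\<dots> = (\<integral>\<^sup>+ \<xi>. \<integral>\<^sup>+ \<eta>. G ((\<xi> + a *\<^sub>R \<eta>) + a *\<^sub>R (\<eta> + s *\<^sub>R (\<xi> + a *\<^sub>R \<eta>))) (\<eta> + s *\<^sub>R (\<xi> + a *\<^sub>R \<eta>)) \<partial>lborel \<partial>lborel)"
    by (rule nn_integral_shear_fst[symmetric, of "\<lambda>\<xi> \<eta>. G (\<xi> + a *\<^sub>R (\<eta> + s *\<^sub>R \<xi>)) (\<eta> + s *\<^sub>R \<xi>)"]) measurable
  also have "\<dots> = (\<integral>\<^sup>+ \<xi>. \<integral>\<^sup>+ \<eta>. G (c *\<^sub>R \<xi> - s *\<^sub>R \<eta>) (s *\<^sub>R \<xi> + c *\<^sub>R \<eta>) \<partial>lborel \<partial>lborel)"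
  proof (rule nn_integral_cong, rule nn_integral_cong)
    fix \<xi> \<eta> :: 'a
    have "\<eta> + s *\<^sub>R (\<xi> + a *\<^sub>R \<eta>) = s *\<^sub>R \<xi> + (1 + a * s) *\<^sub>R \<eta>" by (simp add: algebra_simps)
    moreover have "(\<xi> + a *\<^sub>R \<eta>) + a *\<^sub>R (\<eta> + s *\<^sub>R (\<xi> + a *\<^sub>R \<eta>)) = (1 + a * s) *\<^sub>R \<xi> + (a + (a + a * (a * s))) *\<^sub>R \<eta>"
      by (simp only: scaleR_right_distrib scaleR_left_distrib scaleR_scaleR scaleR_one add_ac mult_ac)
    ultimately show "G ((\<xi> + a *\<^sub>R \<eta>) + a *\<^sub>R (\<eta> + s *\<^sub>R (\<xi> + a *\<^sub>R \<eta>))) (\<eta> + s *\<^sub>R (\<xi> + a *\<^sub>R \<eta>)) = G (c *\<^sub>R \<xi> - s *\<^sub>R \<eta>) (s *\<^sub>R \<xi> + c *\<^sub>R \<eta>)"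
      unfolding as aas by simp
  qed
  finally show ?thesis by (rule sym)
qed

lemma spatial_norm_le_norm: "spatial_norm u \<le> norm u"
proof -
  have "(\<Sum>i\<in>UNIV - {1}. (u $ i)\<^sup>2) \<le> (\<Sum>i\<in>UNIV. (u $ i)\<^sup>2)" by (rule sum_mono2) auto
  then show ?thesis by (simp add: spatial_norm_def norm_vec_def L2_set_def)
qed

lemma lorentz_cone_ball:
  assumes "norm \<eta> < \<epsilon> / 2"
  shows "\<epsilon> *\<^sub>R time_axis + \<eta> \<in> lorentz_cone"
proof -
  have "spatial_norm (\<epsilon> *\<^sub>R time_axis + \<eta>) = spatial_norm \<eta>" by (rule spatial_norm_cong) simp
  also have "\<dots> < \<epsilon> / 2" using spatial_norm_le_norm[of \<eta>] assms by simp
  also have "\<epsilon> / 2 < (\<epsilon> *\<^sub>R time_axis + \<eta>) $ 1"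
    using component_le_norm_cart[of \<eta> 1] assms by (simp add: abs_le_iff)
  finally show ?thesis by (simp add: lorentz_cone_iff)
qed

lemma holomorphic_vec_on_imp_continuous_on:
  "holomorphic_vec_on f S \<Longrightarrow> continuous_on S f"
  unfolding holomorphic_vec_on_def
  by (intro continuous_at_imp_continuous_on ballI) (blast dest: has_derivative_continuous)

lemma tube_function_measurable:
  fixes f :: "(complex, 'n::{finite,one}) vec \<Rightarrow> complex"
  assumes f: "continuous_on tube_domain f"
  shows "(\<lambda>(x, y). indicator lorentz_cone y *\<^sub>R f (re_im_vec x y)) \<in> borel_measurable (borel \<Otimes>\<^sub>M borel)"
proof -
  have "continuous_on (UNIV \<times> lorentz_cone) (\<lambda>p. f (re_im_vec (fst p) (snd p)))"
    by (rule continuous_on_compose2[OF f]) (auto intro!: continuous_intros re_im_vec_in_tube)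
  then have "(\<lambda>p. indicator (UNIV \<times> lorentz_cone) p *\<^sub>R f (re_im_vec (fst p) (snd p))) \<in> borel_measurable borel"
    by (intro borel_measurable_continuous_on_indicator) (auto intro!: borel_open open_Times open_lorentz_cone)
  moreover have "(\<lambda>p. indicator (UNIV \<times> lorentz_cone) p *\<^sub>R f (re_im_vec (fst p) (snd p))) = (\<lambda>(x, y). indicator lorentz_cone y *\<^sub>R f (re_im_vec x y))"
    by (auto simp: fun_eq_iff indicator_def)
  ultimately show ?thesis by (simp add: borel_prod)
qed

lemma norm_sq_le_circle_mean:
  fixes f :: "complex \<Rightarrow> complex"
  assumes f: "f holomorphic_on cball 0 1"
  shows "ennreal ((cmod (f 0))\<^sup>2) \<le> (\<integral>\<^sup>+ t. indicator {0..1} t * ennreal ((cmod (f (exp (2 * of_real pi * \<i> * of_real t))))\<^sup>2) \<partial>lborel)"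
proof -
  have f2: "(\<lambda>z. (f z)\<^sup>2) holomorphic_on cball 0 1" by (intro holomorphic_intros f)
  have "ennreal ((cmod (f 0))\<^sup>2) = ennreal (norm ((f 0)\<^sup>2))" by (simp add: norm_power)
  also have "(f 0)\<^sup>2 = (\<integral>t. indicator {0..1} t *\<^sub>R (f (0 + of_real 1 * exp (2 * of_real pi * \<i> * of_real t)))\<^sup>2 \<partial>lborel)"
    using lebesgue_integral_circle_mean_value(2)[OF f2, of] by simp
  also have "ennreal (norm \<dots>) \<le> (\<integral>\<^sup>+ t. ennreal (norm (indicator {0..1} t *\<^sub>R (f (0 + of_real 1 * exp (2 * of_real pi * \<i> * of_real t)))\<^sup>2)) \<partial>lborel)"
    by (rule integral_norm_bound_ennreal) (rule lebesgue_integral_circle_mean_value(1)[OF f2], simp)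
  also have "\<dots> = (\<integral>\<^sup>+ t. indicator {0..1} t * ennreal ((cmod (f (exp (2 * of_real pi * \<i> * of_real t))))\<^sup>2) \<partial>lborel)"
    by (intro nn_integral_cong) (simp add: norm_power indicator_def)
  finally show ?thesis .
qed

text \<open>
  For \<open>c + i s = \<tau>\<close> the two vectors are the real and imaginary parts of \<open>\<tau> (\<xi> + i \<eta>)\<close>.
\<close>

lemma norm_re_im_combination:
  fixes \<xi> \<eta> :: "'a::real_inner"
  shows "(norm (c *\<^sub>R \<xi> - s *\<^sub>R \<eta>))\<^sup>2 + (norm (s *\<^sub>R \<xi> + c *\<^sub>R \<eta>))\<^sup>2 = (c\<^sup>2 + s\<^sup>2) * ((norm \<xi>)\<^sup>2 + (norm \<eta>)\<^sup>2)"
  unfolding power2_norm_eq_inner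
  by (simp add: inner_diff_left inner_diff_right inner_add_left inner_add_right
      inner_commute power2_eq_square algebra_simps)

text \<open>
  Sub-mean-value inequality over a ball of \<open>\<complex>\<^sup>n\<close>. For each \<open>\<zeta> = \<xi> + i \<eta>\<close> of norm less than \<open>r\<close>,
  \<open>\<bar>f(z)\<bar>\<^sup>2\<close> is at most the mean of \<open>\<bar>f(z + e\<^bsup>2 \<pi> i t\<^esup> \<zeta>)\<bar>\<^sup>2\<close> over \<open>t\<close>. Integrate over the ball of all
  \<open>\<zeta>\<close>: the ball is invariant under \<open>\<zeta> \<mapsto> e\<^bsup>2 \<pi> i t\<^esup> \<zeta>\<close>, so the mean over \<open>t\<close> disappears, and the integral over
  each horizontal slice is controlled by \<open>M\<close>.
\<close>

lemma hardy_interior_estimate: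
  fixes f :: "(complex, 'n::{finite,one}) vec \<Rightarrow> complex"
  assumes holo: "holomorphic_vec_on f tube_domain"
    and M: "\<And>t. t \<in> lorentz_cone \<Longrightarrow> (\<integral>\<^sup>+ x. ennreal ((cmod (f (re_im_vec x t)))\<^sup>2) \<partial>lborel) \<le> M"
    and r: "0 < r" "\<And>\<eta>. norm \<eta> < r \<Longrightarrow> y + \<eta> \<in> lorentz_cone"
  shows "ennreal ((cmod (f (re_im_vec x y)))\<^sup>2) * (\<integral>\<^sup>+ \<xi>. \<integral>\<^sup>+ \<eta>. indicator {..<r\<^sup>2} ((norm (\<xi>::(real,'n) vec))\<^sup>2 + (norm (\<eta>::(real,'n) vec))\<^sup>2) \<partial>lborel \<partial>lborel)
    \<le> M * emeasure lborel (ball (0::(real,'n) vec) r)"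
proof -
  define D :: "(real,'n) vec \<Rightarrow> (real,'n) vec \<Rightarrow> ennreal" where "D \<xi> \<eta> = indicator {..<r\<^sup>2} ((norm \<xi>)\<^sup>2 + (norm \<eta>)\<^sup>2)" for \<xi> \<eta>
  define F where "F p q = ennreal ((cmod (indicator lorentz_cone q *\<^sub>R f (re_im_vec p q)))\<^sup>2)" for p q :: "(real,'n) vec"
  have Fpair: "case_prod F \<in> borel_measurable (borel \<Otimes>\<^sub>M borel)"
  proof -
    note [measurable] = tube_function_measurable[OF holomorphic_vec_on_imp_continuous_on[OF holo]]
    have "(\<lambda>p. ennreal ((cmod (case p of (x, y) \<Rightarrow> indicator lorentz_cone y *\<^sub>R f (re_im_vec x y)))\<^sup>2)) \<in> borel_measurable (borel \<Otimes>\<^sub>M borel)"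
      by measurable
    then show ?thesis by (simp only: F_def case_prod_beta')
  qed
  note [measurable] = Fpair
  note [measurable (raw)] = measurable_case_prod_compose[OF Fpair]
  have [measurable]: "(\<lambda>x. D (f x) (g x)) \<in> borel_measurable M"
    if [measurable]: "f \<in> borel_measurable M" "g \<in> borel_measurable M" for f g and M :: "'x measure"
    unfolding D_def by measurable
  define H where "H \<xi> \<eta> = D \<xi> \<eta> * F (x + \<xi>) (y + \<eta>)" for \<xi> \<eta>
  have Hpair: "case_prod H \<in> borel_measurable (borel \<Otimes>\<^sub>M borel)"
    unfolding H_def[abs_def] by measurable
  let ?c = "\<lambda>t::real. cos (2 * pi * t)" and ?s = "\<lambda>t::real. sin (2 * pi * t)"
  have pointwise: "ennreal ((cmod (f (re_im_vec x y)))\<^sup>2) * D \<xi> \<eta>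
    \<le> (\<integral>\<^sup>+ t. indicator {0..1} t * H (?c t *\<^sub>R \<xi> - ?s t *\<^sub>R \<eta>) (?s t *\<^sub>R \<xi> + ?c t *\<^sub>R \<eta>) \<partial>lborel)" for \<xi> \<eta>
  proof (cases "(norm \<xi>)\<^sup>2 + (norm \<eta>)\<^sup>2 < r\<^sup>2")
    case True
    have rot: "(norm (c *\<^sub>R \<xi> - s *\<^sub>R \<eta>))\<^sup>2 + (norm (s *\<^sub>R \<xi> + c *\<^sub>R \<eta>))\<^sup>2 < r\<^sup>2"
      if "(c\<^sup>2 + s\<^sup>2) * ((norm \<xi>)\<^sup>2 + (norm \<eta>)\<^sup>2) < r\<^sup>2" for c s
      using that by (simp add: norm_re_im_combination)
    have cone: "y + (s *\<^sub>R \<xi> + c *\<^sub>R \<eta>) \<in> lorentz_cone" if "(c\<^sup>2 + s\<^sup>2) * ((norm \<xi>)\<^sup>2 + (norm \<eta>)\<^sup>2) < r\<^sup>2" for c s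
    proof (rule r(2))
      have "(norm (s *\<^sub>R \<xi> + c *\<^sub>R \<eta>))\<^sup>2 < r\<^sup>2"
        using rot[OF that] zero_le_power2[of "norm (c *\<^sub>R \<xi> - s *\<^sub>R \<eta>)"] by linarith
      then show "norm (s *\<^sub>R \<xi> + c *\<^sub>R \<eta>) < r" using r(1) by (intro power2_less_imp_less[of _ r]) auto
    qed
    define \<gamma> where "\<gamma> \<tau> = re_im_vec x y + \<tau> *s re_im_vec \<xi> \<eta>" for \<tau>
    have \<gamma>: "\<gamma> \<tau> = re_im_vec (x + (Re \<tau> *\<^sub>R \<xi> - Im \<tau> *\<^sub>R \<eta>)) (y + (Im \<tau> *\<^sub>R \<xi> + Re \<tau> *\<^sub>R \<eta>))" for \<tau>
      by (simp add: \<gamma>_def vec_eq_iff re_im_vec_def complex_eq_iff)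
    \<comment> \<open>a disc slightly larger than the unit disc\<close>
    define U where "U = {\<tau>. (cmod \<tau>)\<^sup>2 * ((norm \<xi>)\<^sup>2 + (norm \<eta>)\<^sup>2) < r\<^sup>2}"
    have "open U" unfolding U_def by (intro open_Collect_less continuous_intros)
    then have "(\<lambda>\<tau>. f (\<gamma> \<tau>)) holomorphic_on U"
    proof (rule holomorphic_vec_on_compose_curve[OF holo])
      show "(\<lambda>\<tau>. \<gamma> \<tau> $ i) holomorphic_on U" for i
        unfolding \<gamma>_def by (simp, intro holomorphic_intros)
      show "\<gamma> \<tau> \<in> tube_domain" if "\<tau> \<in> U" for \<tau>
        unfolding \<gamma> using that by (intro re_im_vec_in_tube cone) (simp add: U_def cmod_power2)
    qed
    moreover have "cball 0 1 \<subseteq> U"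
    proof
      fix \<tau> :: complex assume "\<tau> \<in> cball 0 1"
      then have "(cmod \<tau>)\<^sup>2 \<le> 1" by (simp add: power_le_one)
      then have "(cmod \<tau>)\<^sup>2 * ((norm \<xi>)\<^sup>2 + (norm \<eta>)\<^sup>2) \<le> 1 * ((norm \<xi>)\<^sup>2 + (norm \<eta>)\<^sup>2)"
        by (intro mult_right_mono) auto
      with True show "\<tau> \<in> U" by (simp add: U_def)
    qed
    ultimately have "(\<lambda>\<tau>. f (\<gamma> \<tau>)) holomorphic_on cball 0 1" by (rule holomorphic_on_subset)
    from norm_sq_le_circle_mean[OF this]
    have "ennreal ((cmod (f (re_im_vec x y)))\<^sup>2) \<le> (\<integral>\<^sup>+ t. indicator {0..1} t * ennreal ((cmod (f (\<gamma> (exp (2 * of_real pi * \<i> * of_real t)))))\<^sup>2) \<partial>lborel)"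
      by (simp add: \<gamma>)
    also have "\<dots> = (\<integral>\<^sup>+ t. indicator {0..1} t * H (?c t *\<^sub>R \<xi> - ?s t *\<^sub>R \<eta>) (?s t *\<^sub>R \<xi> + ?c t *\<^sub>R \<eta>) \<partial>lborel)"
    proof (rule nn_integral_cong)
      fix t :: real
      have e: "exp (2 * of_real pi * \<i> * of_real t) = cis (2 * pi * t)" by (simp add: cis_conv_exp mult_ac)
      have 1: "((?c t)\<^sup>2 + (?s t)\<^sup>2) * ((norm \<xi>)\<^sup>2 + (norm \<eta>)\<^sup>2) < r\<^sup>2" using True by simp
      show "indicator {0..1} t * ennreal ((cmod (f (\<gamma> (exp (2 * of_real pi * \<i> * of_real t)))))\<^sup>2)
        = indicator {0..1} t * H (?c t *\<^sub>R \<xi> - ?s t *\<^sub>R \<eta>) (?s t *\<^sub>R \<xi> + ?c t *\<^sub>R \<eta>)"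
        using rot[OF 1] cone[OF 1] by (simp add: e \<gamma> H_def D_def F_def)
    qed
    finally show ?thesis using True by (simp add: D_def)
  qed (simp add: D_def)
  have "ennreal ((cmod (f (re_im_vec x y)))\<^sup>2) * (\<integral>\<^sup>+ \<xi>. \<integral>\<^sup>+ \<eta>. D \<xi> \<eta> \<partial>lborel \<partial>lborel)
    = (\<integral>\<^sup>+ \<xi>. \<integral>\<^sup>+ \<eta>. ennreal ((cmod (f (re_im_vec x y)))\<^sup>2) * D \<xi> \<eta> \<partial>lborel \<partial>lborel)"
    by (simp add: nn_integral_cmult)
  also have "\<dots> \<le> (\<integral>\<^sup>+ \<xi>. \<integral>\<^sup>+ \<eta>. \<integral>\<^sup>+ t. indicator {0..1} t * H (?c t *\<^sub>R \<xi> - ?s t *\<^sub>R \<eta>) (?s t *\<^sub>R \<xi> + ?c t *\<^sub>R \<eta>) \<partial>lborel \<partial>lborel \<partial>lborel)"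
    by (intro nn_integral_mono pointwise)
  also have "\<dots> = (\<integral>\<^sup>+ \<xi>. \<integral>\<^sup>+ t. \<integral>\<^sup>+ \<eta>. indicator {0..1} t * H (?c t *\<^sub>R \<xi> - ?s t *\<^sub>R \<eta>) (?s t *\<^sub>R \<xi> + ?c t *\<^sub>R \<eta>) \<partial>lborel \<partial>lborel \<partial>lborel)"
    unfolding H_def by (rule nn_integral_cong, rule lborel_pair.Fubini') measurable
  also have "\<dots> = (\<integral>\<^sup>+ t. \<integral>\<^sup>+ \<xi>. \<integral>\<^sup>+ \<eta>. indicator {0..1} t * H (?c t *\<^sub>R \<xi> - ?s t *\<^sub>R \<eta>) (?s t *\<^sub>R \<xi> + ?c t *\<^sub>R \<eta>) \<partial>lborel \<partial>lborel \<partial>lborel)"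
    unfolding H_def by (rule lborel_pair.Fubini') measurable
  also have "\<dots> = (\<integral>\<^sup>+ t. indicator {0..1::real} t * (\<integral>\<^sup>+ \<xi>. \<integral>\<^sup>+ \<eta>. H \<xi> \<eta> \<partial>lborel \<partial>lborel) \<partial>lborel)"
  proof (rule nn_integral_cong_AE)
    have "{t. sin (2 * pi * t) = 0} \<subseteq> range (\<lambda>k::int. of_int k / 2)"
    proof
      fix t assume "t \<in> {t. sin (2 * pi * t) = 0}"
      then obtain k :: int where "2 * pi * t = of_int k * pi" by (auto simp: sin_zero_iff_int2)
      then show "t \<in> range (\<lambda>k::int. of_int k / 2)" by (auto intro!: range_eqI[of _ _ k])
    qed
    then have "countable {t. sin (2 * pi * t) = 0}" by (rule countable_subset) simp
    then have "AE t in lborel. t \<notin> {t. sin (2 * pi * t) = 0}" by (intro AE_not_in countable_imp_null_set_lborel)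
    then show "AE t in lborel. (\<integral>\<^sup>+ \<xi>. \<integral>\<^sup>+ \<eta>. indicator {0..1} t * H (?c t *\<^sub>R \<xi> - ?s t *\<^sub>R \<eta>) (?s t *\<^sub>R \<xi> + ?c t *\<^sub>R \<eta>) \<partial>lborel \<partial>lborel)
      = indicator {0..1} t * (\<integral>\<^sup>+ \<xi>. \<integral>\<^sup>+ \<eta>. H \<xi> \<eta> \<partial>lborel \<partial>lborel)"
    proof eventually_elim
      case (elim t)
      have "(\<integral>\<^sup>+ \<xi>. \<integral>\<^sup>+ \<eta>. H (?c t *\<^sub>R \<xi> - ?s t *\<^sub>R \<eta>) (?s t *\<^sub>R \<xi> + ?c t *\<^sub>R \<eta>) \<partial>lborel \<partial>lborel) = (\<integral>\<^sup>+ \<xi>. \<integral>\<^sup>+ \<eta>. H \<xi> \<eta> \<partial>lborel \<partial>lborel)"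
        by (rule nn_integral_rotation[OF Hpair]) (use elim in auto)
      then show ?case by (auto simp: indicator_def)
    qed
  qed
  also have "\<dots> = (\<integral>\<^sup>+ \<xi>. \<integral>\<^sup>+ \<eta>. H \<xi> \<eta> \<partial>lborel \<partial>lborel)"
    by (subst nn_integral_multc) auto
  also have "\<dots> = (\<integral>\<^sup>+ \<eta>. \<integral>\<^sup>+ \<xi>. H \<xi> \<eta> \<partial>lborel \<partial>lborel)"
    unfolding H_def by (rule lborel_pair.Fubini') measurable
  also have "\<dots> \<le> (\<integral>\<^sup>+ \<eta>. M * indicator (ball (0::(real,'n) vec) r) \<eta> \<partial>lborel)"
  proof (rule nn_integral_mono)
    fix \<eta> :: "(real,'n) vec"
    show "(\<integral>\<^sup>+ \<xi>. H \<xi> \<eta> \<partial>lborel) \<le> M * indicator (ball 0 r) \<eta>"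
    proof (cases "norm \<eta> < r")
      case True
      then have c: "y + \<eta> \<in> lorentz_cone" by (rule r(2))
      have [measurable]: "(\<lambda>p. F p (y + \<eta>)) \<in> borel_measurable borel" by measurable
      have "(\<integral>\<^sup>+ \<xi>. H \<xi> \<eta> \<partial>lborel) \<le> (\<integral>\<^sup>+ \<xi>. F (x + \<xi>) (y + \<eta>) \<partial>lborel)"
        by (intro nn_integral_mono) (auto simp: H_def D_def indicator_def)
      also have "\<dots> = (\<integral>\<^sup>+ \<xi>. F \<xi> (y + \<eta>) \<partial>lborel)"
        by (rule nn_integral_lborel_translate[of "\<lambda>p. F p (y + \<eta>)"]) measurable
      also have "\<dots> \<le> M" using M[OF c] c by (simp add: F_def)
      finally show ?thesis using True by simp
    next
      case False
      then have "r\<^sup>2 \<le> (norm \<eta>)\<^sup>2" using r(1) by (intro power_mono) auto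
      then have "\<not> (norm \<xi>)\<^sup>2 + (norm \<eta>)\<^sup>2 < r\<^sup>2" for \<xi> :: "(real,'n) vec"
        using zero_le_power2[of "norm \<xi>"] by linarith
      then have "D \<xi> \<eta> = 0" for \<xi> by (simp add: D_def)
      then show ?thesis by (simp add: H_def)
    qed
  qed
  also have "\<dots> = M * emeasure lborel (ball (0::(real,'n) vec) r)"
    by (rule nn_integral_cmult_indicator) simp
  finally show ?thesis unfolding D_def .
qed

text \<open>
  A ball of radius \<open>\<epsilon> / 2\<close> around \<open>v + \<epsilon> e\<close> stays in the cone, so the interior estimate applies with the same
  constants at every point. This makes the Poisson and Szego formulas applicable to \<open>f(\<cdot> + i \<epsilon> e)\<close>.
\<close>

lemma hardy2_bounded_above_height:
  fixes f :: "(complex, 'n::{finite,one}) vec \<Rightarrow> complex"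
  assumes f: "f \<in> hardy2_space" and \<epsilon>: "0 < \<epsilon>"
  obtains B where "\<And>z. z \<in> tube_closure \<Longrightarrow> cmod (f (z + re_im_vec 0 (\<epsilon> *\<^sub>R time_axis))) \<le> B"
proof -
  have holo: "holomorphic_vec_on f tube_domain" and fin: "hardy2_integral f < \<infinity>"
    using f by (auto simp: hardy2_space_def)
  let ?M = "hardy2_integral f"
  define r where "r = \<epsilon> / 2"
  have r: "0 < r" using \<epsilon> by (simp add: r_def)
  define V where "V = (\<integral>\<^sup>+ \<xi>. \<integral>\<^sup>+ \<eta>. indicator {..<r\<^sup>2} ((norm (\<xi>::(real,'n) vec))\<^sup>2 + (norm (\<eta>::(real,'n) vec))\<^sup>2) \<partial>lborel \<partial>lborel)"
  define W where "W = emeasure lborel (ball (0::(real,'n) vec) r)"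
  have W: "W < \<infinity>" unfolding W_def by (rule emeasure_lborel_ball_finite)
  have V: "V \<noteq> 0"
  proof -
    let ?b = "ball (0::(real,'n) vec) (r / 2)"
    have "emeasure lborel ?b * emeasure lborel ?b = (\<integral>\<^sup>+ \<xi>. \<integral>\<^sup>+ \<eta>. indicator ?b \<xi> * indicator ?b \<eta> \<partial>lborel \<partial>lborel)"
    proof -
      have [measurable]: "(indicator ?b :: _ \<Rightarrow> ennreal) \<in> borel_measurable borel"
        by (intro borel_measurable_indicator) simp
      show ?thesis by (simp add: nn_integral_cmult nn_integral_multc)
    qed
    also have "\<dots> \<le> V"
      unfolding V_def
    proof (intro nn_integral_mono)
      fix \<xi> \<eta> :: "(real,'n) vec"
      have "(norm \<xi>)\<^sup>2 + (norm \<eta>)\<^sup>2 < r\<^sup>2" if "norm \<xi> < r / 2" "norm \<eta> < r / 2"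
      proof -
        have "(norm \<xi>)\<^sup>2 < (r / 2)\<^sup>2" "(norm \<eta>)\<^sup>2 < (r / 2)\<^sup>2" using that by (auto intro!: power_strict_mono)
        moreover have "(r / 2)\<^sup>2 + (r / 2)\<^sup>2 \<le> r\<^sup>2" by (simp add: power2_eq_square)
        ultimately show ?thesis by linarith
      qed
      then show "(indicator ?b \<xi> * indicator ?b \<eta> :: ennreal) \<le> indicator {..<r\<^sup>2} ((norm \<xi>)\<^sup>2 + (norm \<eta>)\<^sup>2)"
        by (auto simp: indicator_def)
    qed
    finally have "emeasure lborel ?b * emeasure lborel ?b \<le> V" .
    moreover have "emeasure lborel ?b \<noteq> 0"
    proof -
      have "0 < measure lborel ?b" using content_ball_pos[of "r / 2" "0::(real,'n) vec"] r by (simp add: measure_completion)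
      then show ?thesis by (auto simp: measure_def)
    qed
    ultimately show ?thesis by (metis le_zero_eq mult_eq_0_iff)
  qed
  have bound: "ennreal ((cmod (f (re_im_vec x (v + \<epsilon> *\<^sub>R time_axis))))\<^sup>2) * V \<le> ?M * W"
    if v: "v = 0 \<or> v \<in> lorentz_cone" for x v
    unfolding V_def W_def
  proof (rule hardy_interior_estimate[OF holo _ r])
    show "(\<integral>\<^sup>+ x. ennreal ((cmod (f (re_im_vec x t)))\<^sup>2) \<partial>lborel) \<le> ?M" if "t \<in> lorentz_cone" for t
      unfolding hardy2_integral_def by (rule SUP_upper[OF that])
    fix \<eta> :: "(real,'n) vec" assume "norm \<eta> < r"
    then have "\<epsilon> *\<^sub>R time_axis + \<eta> \<in> lorentz_cone" by (intro lorentz_cone_ball) (simp add: r_def)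
    then show "v + \<epsilon> *\<^sub>R time_axis + \<eta> \<in> lorentz_cone"
      using v lorentz_cone_add[of v "\<epsilon> *\<^sub>R time_axis + \<eta>"] by (auto simp: add.assoc)
  qed
  define K where "K = ?M * W"
  have K: "K < \<infinity>" using fin W by (simp add: K_def ennreal_mult_less_top)
  \<comment> \<open>the volume of the ball, capped so that one may divide by it\<close>
  define V' where "V' = min V 1"
  have "V' \<le> 1" by (simp add: V'_def)
  then have V': "V' \<noteq> 0" "V' < \<infinity>" using V by (auto simp: V'_def min_def intro: le_less_trans)
  define q where "q = enn2real (K / V')"
  have "cmod (f (z + re_im_vec 0 (\<epsilon> *\<^sub>R time_axis))) \<le> sqrt q" if z: "z \<in> tube_closure" for z
  proof -
    obtain x v where xv: "z = re_im_vec x v" "v = 0 \<or> v \<in> lorentz_cone"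
      using z unfolding tube_closure_def by (auto elim!: tube_domainE)
    let ?a = "(cmod (f (re_im_vec x (v + \<epsilon> *\<^sub>R time_axis))))\<^sup>2"
    have "ennreal ?a * V' \<le> ennreal ?a * V" by (intro mult_left_mono) (auto simp: V'_def)
    also have "\<dots> \<le> K" unfolding K_def by (rule bound[OF xv(2)])
    finally have "ennreal ?a * V' / V' \<le> K / V'" by (rule divide_right_mono_ennreal)
    then have "ennreal ?a \<le> K / V'" using V' by (simp add: mult_divide_eq_ennreal)
    moreover have "K / V' \<noteq> top" using K V'(1) by (auto simp: ennreal_divide_eq_top_iff)
    then have "K / V' < \<infinity>" by (simp add: top.not_eq_extremum)
    ultimately have "enn2real (ennreal ?a) \<le> enn2real (K / V')"
      by (intro enn2real_mono) auto
    then have "?a \<le> q" unfolding q_def by simp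
    then show ?thesis by (simp add: xv re_im_vec_add real_le_rsqrt)
  qed
  then show thesis by (rule that)
qed

section \<open>An integral over the cone\<close>

text \<open>
  The squared norm of the coordinates transverse to the null directions \<open>e\<^sub>1 \<plusminus> e\<^sub>k\<close>.
\<close>

definition rest_sq :: "'n \<Rightarrow> real ^ 'n::{finite,one} \<Rightarrow> real" where
  "rest_sq k u = (\<Sum>i\<in>UNIV - {1, k}. (u $ i)\<^sup>2)"

lemma lorentz_det_null_coords:
  assumes "k \<noteq> 1"
  shows "lorentz_det u = (u $ 1 + u $ k) * (u $ 1 - u $ k) - rest_sq k u"
proof -
  have "UNIV - {1} - {k} = UNIV - {1, k}" by auto
  then have "(\<Sum>i\<in>UNIV - {1}. (u $ i)\<^sup>2) = (u $ k)\<^sup>2 + rest_sq k u"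
    unfolding rest_sq_def using assms by (subst sum.remove[of _ k]) auto
  then show ?thesis by (simp add: lorentz_det_def power2_eq_square algebra_simps)
qed

lemma lorentz_cone_null_coords:
  assumes k: "k \<noteq> 1"
  shows "u \<in> lorentz_cone \<longleftrightarrow> 0 < u $ 1 + u $ k \<and> 0 < lorentz_det u"
proof
  assume u: "u \<in> lorentz_cone"
  then have "\<bar>u $ k\<bar> < u $ 1" using abs_nth_le_spatial_norm[OF k, of u] by (simp add: lorentz_cone_iff)
  then show "0 < u $ 1 + u $ k \<and> 0 < lorentz_det u" using lorentz_coneD[OF u] by (simp add: abs_less_iff)
next
  assume *: "0 < u $ 1 + u $ k \<and> 0 < lorentz_det u"
  have "0 \<le> rest_sq k u" by (simp add: rest_sq_def sum_nonneg)
  with * have "0 < (u $ 1 + u $ k) * (u $ 1 - u $ k)" by (simp add: lorentz_det_null_coords[OF k])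
  with * have "0 < u $ 1 - u $ k" by (simp add: zero_less_mult_iff)
  with * show "u \<in> lorentz_cone" by (simp add: lorentz_cone_def)
qed

text \<open>
  The vector with null coordinates \<open>u\<^sub>1 + u\<^sub>k = p\<close>, \<open>u\<^sub>1 - u\<^sub>k = q\<close> and the transverse coordinates of \<open>v\<close>, so
  that \<open>\<Delta> = p q - rest_sq k v\<close>.
\<close>

definition null_coords :: "'n \<Rightarrow> real \<Rightarrow> real \<Rightarrow> real ^ 'n::{finite,one} \<Rightarrow> real ^ 'n::{finite,one}" where
  "null_coords k p q v = set_coord 1 ((p + q) / 2) (set_coord k ((p - q) / 2) v)"

lemma null_coords_measurable [measurable (raw)]:
  fixes h :: "_ \<Rightarrow> (real, 'n::{finite,one}) vec"
  assumes [measurable]: "f \<in> borel_measurable M" "g \<in> borel_measurable M" "h \<in> borel_measurable M"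
  shows "(\<lambda>x. null_coords k (f x) (g x) (h x)) \<in> borel_measurable M"
  unfolding null_coords_def by measurable

lemma rest_sq_measurable [measurable]: "rest_sq k \<in> borel_measurable borel"
  unfolding rest_sq_def[abs_def] by measurable

lemma null_coords_nth:
  assumes "k \<noteq> 1"
  shows "null_coords k p q v $ i = (if i = 1 then (p + q) / 2 else if i = k then (p - q) / 2 else v $ i)"
  by (simp add: null_coords_def)

lemma rest_sq_null_coords [simp]: "rest_sq k (null_coords k p q v) = rest_sq k v"
  unfolding rest_sq_def by (intro sum.cong) (auto simp: null_coords_def)

lemma null_coords_sum_diff:
  assumes "k \<noteq> 1"
  shows "null_coords k p q v $ 1 + null_coords k p q v $ k = p" "null_coords k p q v $ 1 - null_coords k p q v $ k = q"
  using assms by (simp_all add: null_coords_nth field_simps)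

text \<open>
  The substitution \<open>q = rest_sq k v / p + t\<close> is made so that \<open>\<Delta> = p t\<close> and the cone becomes the quadrant
  \<open>p, t > 0\<close>: these are coordinates of the triangular group acting on the cone.
\<close>

lemma nn_integral_null_coords:
  fixes g :: "(real, 'n::{finite,one}) vec \<Rightarrow> ennreal"
  assumes k: "k \<noteq> 1" and [measurable]: "g \<in> borel_measurable borel"
  shows "(\<integral>\<^sup>+ v. g v \<partial>lborel) = ennreal (1 / 2) *
    (\<integral>\<^sup>+ p. \<integral>\<^sup>+ t. \<integral>\<^sup>+ v. indicator {0<..<1} (v $ 1) * (indicator {0<..<1} (v $ k) * g (null_coords k p (rest_sq k v / p + t) v)) \<partial>lborel \<partial>lborel \<partial>lborel)"
proof -
  let ?I = "indicator {0<..<1::real} :: real \<Rightarrow> ennreal"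
  have "(\<integral>\<^sup>+ v. g v \<partial>lborel) = (\<integral>\<^sup>+ v. ?I (v $ 1) * (\<integral>\<^sup>+ r. g (set_coord 1 r v) \<partial>lborel) \<partial>lborel)"
    by (rule nn_integral_average_coord) measurable
  also have "\<dots> = (\<integral>\<^sup>+ v. ?I (v $ k) * (\<integral>\<^sup>+ s. ?I (set_coord k s v $ 1) * (\<integral>\<^sup>+ r. g (set_coord 1 r (set_coord k s v)) \<partial>lborel) \<partial>lborel) \<partial>lborel)"
    by (rule nn_integral_average_coord) measurable
  also have "\<dots> = (\<integral>\<^sup>+ v. ennreal (1 / 2) * (\<integral>\<^sup>+ p. \<integral>\<^sup>+ t. ?I (v $ 1) * (?I (v $ k) * g (null_coords k p (rest_sq k v / p + t) v)) \<partial>lborel \<partial>lborel) \<partial>lborel)"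
  proof (rule nn_integral_cong)
    fix v :: "(real,'n) vec"
    have "(\<integral>\<^sup>+ s. ?I (set_coord k s v $ 1) * (\<integral>\<^sup>+ r. g (set_coord 1 r (set_coord k s v)) \<partial>lborel) \<partial>lborel)
      = ?I (v $ 1) * (\<integral>\<^sup>+ s. \<integral>\<^sup>+ r. g (set_coord 1 r (set_coord k s v)) \<partial>lborel \<partial>lborel)"
      using k by (simp add: nn_integral_cmult)
    also have "(\<integral>\<^sup>+ s. \<integral>\<^sup>+ r. g (set_coord 1 r (set_coord k s v)) \<partial>lborel \<partial>lborel)
      = ennreal (1 / 2) * (\<integral>\<^sup>+ p. \<integral>\<^sup>+ q. g (null_coords k p q v) \<partial>lborel \<partial>lborel)"
      unfolding null_coords_def by (rule nn_integral_light_cone_coords) measurable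
    also have "(\<integral>\<^sup>+ p. \<integral>\<^sup>+ q. g (null_coords k p q v) \<partial>lborel \<partial>lborel)
      = (\<integral>\<^sup>+ p. \<integral>\<^sup>+ t. g (null_coords k p (rest_sq k v / p + t) v) \<partial>lborel \<partial>lborel)"
      by (intro nn_integral_cong nn_integral_lborel_translate[symmetric]) measurable
    finally show "?I (v $ k) * (\<integral>\<^sup>+ s. ?I (set_coord k s v $ 1) * (\<integral>\<^sup>+ r. g (set_coord 1 r (set_coord k s v)) \<partial>lborel) \<partial>lborel)
      = ennreal (1 / 2) * (\<integral>\<^sup>+ p. \<integral>\<^sup>+ t. ?I (v $ 1) * (?I (v $ k) * g (null_coords k p (rest_sq k v / p + t) v)) \<partial>lborel \<partial>lborel)"
      by (simp add: nn_integral_cmult mult_ac)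
  qed
  also have "\<dots> = ennreal (1 / 2) * (\<integral>\<^sup>+ v. \<integral>\<^sup>+ p. \<integral>\<^sup>+ t. ?I (v $ 1) * (?I (v $ k) * g (null_coords k p (rest_sq k v / p + t) v)) \<partial>lborel \<partial>lborel \<partial>lborel)"
    by (rule nn_integral_cmult) measurable
  also have "(\<integral>\<^sup>+ v. \<integral>\<^sup>+ p. \<integral>\<^sup>+ t. ?I (v $ 1) * (?I (v $ k) * g (null_coords k p (rest_sq k v / p + t) v)) \<partial>lborel \<partial>lborel \<partial>lborel)
    = (\<integral>\<^sup>+ p. \<integral>\<^sup>+ v. \<integral>\<^sup>+ t. ?I (v $ 1) * (?I (v $ k) * g (null_coords k p (rest_sq k v / p + t) v)) \<partial>lborel \<partial>lborel \<partial>lborel)"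
    by (rule lborel_pair.Fubini') measurable
  also have "\<dots> = (\<integral>\<^sup>+ p. \<integral>\<^sup>+ t. \<integral>\<^sup>+ v. ?I (v $ 1) * (?I (v $ k) * g (null_coords k p (rest_sq k v / p + t) v)) \<partial>lborel \<partial>lborel \<partial>lborel)"
    by (rule nn_integral_cong, rule lborel_pair.Fubini') measurable
  finally show ?thesis .
qed

lemma lorentz_det_null_coords_shift:
  assumes k: "k \<noteq> 1" and p: "p \<noteq> 0"
  shows "lorentz_det (null_coords k p (rest_sq k v / p + t) v) = p * t"
  using p by (simp add: lorentz_det_null_coords[OF k] null_coords_sum_diff[OF k] field_simps)

text \<open>
  Completing the square: the determinant of a sum again factors, up to a square measuring the distance of
  the transverse slopes \<open>y\<^sub>i / P\<close> and \<open>v\<^sub>i / p\<close>.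
\<close>

lemma lorentz_det_add_null_coords:
  assumes k: "k \<noteq> 1" and p: "0 < p" and P: "P = y $ 1 + y $ k" "0 < P" and T: "T = lorentz_det y / P"
  shows "lorentz_det (y + null_coords k p (rest_sq k v / p + t) v)
    = (P + p) * (T + t + P * p / (P + p) * (\<Sum>i\<in>UNIV - {1, k}. (y $ i / P - v $ i / p)\<^sup>2))"
proof -
  define Q where "Q = y $ 1 - y $ k"
  let ?u = "null_coords k p (rest_sq k v / p + t) v"
  have T': "T = Q - rest_sq k y / P" using P by (simp add: T lorentz_det_null_coords[OF k] Q_def diff_divide_distrib)
  have J: "rest_sq k (y + ?u) = (\<Sum>i\<in>UNIV - {1, k}. (y $ i + v $ i)\<^sup>2)"
    unfolding rest_sq_def by (intro sum.cong) (auto simp: null_coords_nth[OF k])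
  have "(y + ?u) $ 1 + (y + ?u) $ k = P + p" "(y + ?u) $ 1 - (y + ?u) $ k = Q + (rest_sq k v / p + t)"
    using null_coords_sum_diff[OF k, of p "rest_sq k v / p + t" v] by (simp_all add: P(1) Q_def)
  then have "lorentz_det (y + ?u) = (P + p) * (Q + (rest_sq k v / p + t)) - (\<Sum>i\<in>UNIV - {1, k}. (y $ i + v $ i)\<^sup>2)"
    by (simp add: lorentz_det_null_coords[OF k] J)
  also have "\<dots> = (P + p) * (T + t) + ((P + p) * (rest_sq k y / P + rest_sq k v / p) - (\<Sum>i\<in>UNIV - {1, k}. (y $ i + v $ i)\<^sup>2))"
    by (simp add: T' algebra_simps)
  also have "(P + p) * (rest_sq k y / P + rest_sq k v / p) - (\<Sum>i\<in>UNIV - {1, k}. (y $ i + v $ i)\<^sup>2)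
    = (\<Sum>i\<in>UNIV - {1, k}. (P + p) * ((y $ i)\<^sup>2 / P + (v $ i)\<^sup>2 / p) - (y $ i + v $ i)\<^sup>2)"
    by (simp only: rest_sq_def sum_divide_distrib sum.distrib[symmetric] sum_distrib_left sum_subtractf)
  also have "\<dots> = (\<Sum>i\<in>UNIV - {1, k}. P * p * (y $ i / P - v $ i / p)\<^sup>2)"
    using p P(2) by (intro sum.cong refl) (simp add: field_simps power2_eq_square)
  also have "\<dots> = (P + p) * (P * p / (P + p) * (\<Sum>i\<in>UNIV - {1, k}. (y $ i / P - v $ i / p)\<^sup>2))"
    using p P(2) by (simp add: sum_distrib_left)
  finally show ?thesis by (simp only: distrib_left)
qed

text \<open>
  The power \<open>(1 + rest_sq k w)\<^bsup>-a\<^esup>\<close> is at most the product over the \<open>m = n - 2\<close> transverse coordinates of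
  \<open>(1 + w\<^sub>i\<^sup>2)\<^bsup>-a/m\<^esup>\<close>, and each factor is integrable since \<open>2 a / m > 1\<close>.
\<close>

lemma nn_integral_transverse_finite:
  fixes a :: real
  assumes k: "k \<noteq> (1::'n::{finite,one})" and a: "real (CARD('n) - 2) / 2 < a"
  shows "(\<integral>\<^sup>+ w. indicator {0<..<1} (w $ 1) * (indicator {0<..<1} (w $ k) * ennreal ((1 + rest_sq k w) powr (- a))) \<partial>lborel) < \<infinity>"
proof -
  let ?I = "indicator {0<..<1::real} :: real \<Rightarrow> ennreal"
  define J where "J = UNIV - {1, k}"
  define m where "m = CARD('n) - 2"
  have m: "card J = m" using k by (simp add: J_def m_def card_Diff_subset)
  define f where "f i = (if i \<in> J then (\<lambda>t. ennreal ((1 + t\<^sup>2) powr (- (2 * a / m / 2)))) else ?I)" for i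
  have [measurable]: "f i \<in> borel_measurable borel" for i by (simp add: f_def)
  have fin: "(\<integral>\<^sup>+ t. f i t \<partial>lborel) < \<infinity>" for i
  proof (cases "i \<in> J")
    case True
    then have "m > 0" using m by (metis card_gt_0_iff empty_iff finite)
    then have "1 < 2 * a / m" using a by (simp add: m_def field_simps)
    from nn_integral_even_decay_finite[OF this] show ?thesis using True by (simp add: f_def)
  qed (simp add: f_def)
  have bound: "(1 + rest_sq k w) powr (- a) \<le> (\<Prod>i\<in>J. (1 + (w $ i)\<^sup>2) powr (- (2 * a / m / 2)))" for w :: "(real,'n) vec"
  proof (cases "J = {}")
    case True
    show ?thesis unfolding rest_sq_def J_def[symmetric] True by simp
  next
    case False
    then have mpos: "m > 0" using m by (metis card_gt_0_iff finite)
    have apos: "a > 0" using a by (smt (verit) divide_nonneg_nonneg of_nat_0_le_iff)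
    let ?R = "1 + rest_sq k w"
    have R: "1 + (w $ i)\<^sup>2 \<le> ?R" if "i \<in> J" for i
      unfolding rest_sq_def J_def[symmetric] using that by (simp add: member_le_sum[of i J "\<lambda>i. (w $ i)\<^sup>2"])
    have R1: "?R \<ge> 1" by (simp add: rest_sq_def sum_nonneg)
    have "?R powr (- a) = (?R powr (- (a / m))) ^ m"
      using R1 mpos by (simp add: powr_power)
    also have "\<dots> = (\<Prod>i\<in>J. ?R powr (- (a / m)))" by (simp add: m)
    also have "\<dots> \<le> (\<Prod>i\<in>J. (1 + (w $ i)\<^sup>2) powr (- (2 * a / m / 2)))"
    proof (intro prod_mono conjI)
      fix i assume i: "i \<in> J"
      have "?R powr (- (a / m)) \<le> (1 + (w $ i)\<^sup>2) powr (- (a / m))"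
        using R[OF i] apos mpos by (intro powr_mono2') (auto simp: add_pos_nonneg)
      then show "?R powr (- (a / m)) \<le> (1 + (w $ i)\<^sup>2) powr (- (2 * a / m / 2))" by simp
    qed auto
    finally show ?thesis .
  qed
  \<comment> \<open>the factors, indexed by basis vectors instead of coordinates\<close>
  define C where "C = (\<lambda>b::(real,'n) vec. f (SOME i. b = axis i 1))"
  have C [simp]: "C (axis i 1) = f i" for i by (simp add: C_def axis_eq_axis)
  have Basis: "(Basis :: (real,'n) vec set) = range (\<lambda>i. axis i 1)" by (auto simp: Basis_vec_def)
  have reidx: "(\<Prod>b\<in>Basis. h b) = (\<Prod>i\<in>UNIV. h (axis i (1::real)))" for h :: "(real,'n) vec \<Rightarrow> ennreal"
    unfolding Basis by (subst prod.reindex) (auto simp: inj_on_def axis_eq_axis)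
  have "(\<integral>\<^sup>+ w. ?I (w $ 1) * (?I (w $ k) * ennreal ((1 + rest_sq k w) powr (- a))) \<partial>lborel)
    \<le> (\<integral>\<^sup>+ w. (\<Prod>b\<in>Basis. C b (w \<bullet> b)) \<partial>(lborel :: (real,'n) vec measure))"
  proof (rule nn_integral_mono)
    fix w :: "(real,'n) vec"
    have U: "UNIV = insert 1 (insert k J)" "1 \<notin> insert k J" "k \<notin> J" using k by (auto simp: J_def)
    have "(\<Prod>b\<in>Basis. C b (w \<bullet> b)) = (\<Prod>i\<in>UNIV. f i (w $ i))"
      unfolding reidx by (simp add: inner_axis)
    also have "\<dots> = f 1 (w $ 1) * (f k (w $ k) * (\<Prod>i\<in>J. f i (w $ i)))"
      unfolding U(1) using U(2,3) by (simp add: J_def)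
    also have "\<dots> = ?I (w $ 1) * (?I (w $ k) * (\<Prod>i\<in>J. ennreal ((1 + (w $ i)\<^sup>2) powr (- (2 * a / m / 2)))))"
      using U by (simp add: f_def)
    also have "(\<Prod>i\<in>J. ennreal ((1 + (w $ i)\<^sup>2) powr (- (2 * a / m / 2)))) = ennreal (\<Prod>i\<in>J. (1 + (w $ i)\<^sup>2) powr (- (2 * a / m / 2)))"
      by (rule prod_ennreal) simp
    finally show "?I (w $ 1) * (?I (w $ k) * ennreal ((1 + rest_sq k w) powr (- a))) \<le> (\<Prod>b\<in>Basis. C b (w \<bullet> b))"
      using bound[of w] by (simp add: mult_left_mono ennreal_leI)
  qed
  also have "\<dots> = (\<Prod>b\<in>(Basis::(real,'n) vec set). \<integral>\<^sup>+ t. C b t \<partial>lborel)"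
    by (rule nn_integral_lborel_prod) (auto simp: C_def)
  also have "\<dots> = (\<Prod>i\<in>UNIV. \<integral>\<^sup>+ t. f i t \<partial>lborel)" unfolding reidx by simp
  also have "\<dots> < \<infinity>" using fin by (auto simp: less_top[symmetric] ennreal_prod_eq_top)
  finally show ?thesis .
qed

lemma nn_integral_powr_ratio_scale:
  fixes \<sigma> P :: real
  assumes P: "0 < P"
  shows "(\<integral>\<^sup>+ p. ennreal ((P + p) powr (- 2 * \<sigma>) * p powr (\<sigma> - 1)) * indicator {0<..} p \<partial>lborel)
    = ennreal (P powr (- \<sigma>)) * (\<integral>\<^sup>+ p. ennreal ((1 + p) powr (- 2 * \<sigma>) * p powr (\<sigma> - 1)) * indicator {0<..} p \<partial>lborel)"
proof -
  have "(\<integral>\<^sup>+ p. ennreal ((P + p) powr (- 2 * \<sigma>) * p powr (\<sigma> - 1)) * indicator {0<..} p \<partial>lborel)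
    = ennreal P * (\<integral>\<^sup>+ p. ennreal ((P + P * p) powr (- 2 * \<sigma>) * (P * p) powr (\<sigma> - 1)) * indicator {0<..} (P * p) \<partial>lborel)"
    using P by (subst nn_integral_real_affine[where c = P and t = 0]) simp_all
  also have "\<dots> = (\<integral>\<^sup>+ p. ennreal P * (ennreal ((P + P * p) powr (- 2 * \<sigma>) * (P * p) powr (\<sigma> - 1)) * indicator {0<..} (P * p)) \<partial>lborel)"
    by (rule nn_integral_cmult[symmetric]) measurable
  also have "\<dots> = (\<integral>\<^sup>+ p. ennreal (P powr (- \<sigma>)) * (ennreal ((1 + p) powr (- 2 * \<sigma>) * p powr (\<sigma> - 1)) * indicator {0<..} p) \<partial>lborel)"
  proof (rule nn_integral_cong)
    fix p :: real
    show "ennreal P * (ennreal ((P + P * p) powr (- 2 * \<sigma>) * (P * p) powr (\<sigma> - 1)) * indicator {0<..} (P * p))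
      = ennreal (P powr (- \<sigma>)) * (ennreal ((1 + p) powr (- 2 * \<sigma>) * p powr (\<sigma> - 1)) * indicator {0<..} p)"
    proof (cases "p > 0")
      case True
      have "P + P * p = P * (1 + p)" by (simp add: algebra_simps)
      then have "P * ((P + P * p) powr (- 2 * \<sigma>) * (P * p) powr (\<sigma> - 1))
        = (P powr 1 * P powr (- 2 * \<sigma>) * P powr (\<sigma> - 1)) * ((1 + p) powr (- 2 * \<sigma>) * p powr (\<sigma> - 1))"
        using P by (simp add: powr_mult)
      also have "P powr 1 * P powr (- 2 * \<sigma>) * P powr (\<sigma> - 1) = P powr (- \<sigma>)"
        by (simp only: powr_add[symmetric]) simp
      finally show ?thesis using True P by (simp add: ennreal_mult[symmetric])
    next
      case False
      then show ?thesis using P by (simp add: zero_less_mult_iff)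
    qed
  qed
  also have "\<dots> = ennreal (P powr (- \<sigma>)) * (\<integral>\<^sup>+ p. ennreal ((1 + p) powr (- 2 * \<sigma>) * p powr (\<sigma> - 1)) * indicator {0<..} p \<partial>lborel)"
    by (rule nn_integral_cmult) measurable
  finally show ?thesis .
qed

text \<open>
  Integrating out the transverse coordinates. The affine substitution centres them at \<open>p y\<^sub>i / P\<close> and scales
  them by \<open>h\<close>, chosen so that the bracket becomes \<open>(T + t) (1 + rest_sq k w)\<close>. The exponents are such that
  the variables \<open>p\<close> and \<open>t\<close> end up with the same weight.
\<close>

lemma nn_integral_transverse:
  fixes y :: "(real,'n::{finite,one}) vec"
  assumes n: "2 \<le> CARD('n)" and k: "k \<noteq> 1" and \<sigma>: "0 < \<sigma>" and p: "0 < p" and t: "0 < t"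
    and P: "0 < P" and T: "0 < T"
  defines "m \<equiv> CARD('n) - 2"
  defines "a \<equiv> 2 * \<sigma> + real m / 2"
  shows "(\<integral>\<^sup>+ v. indicator {0<..<1} (v $ 1) * (indicator {0<..<1} (v $ k) *
      ennreal (((P + p) * (T + t + P * p / (P + p) * (\<Sum>i\<in>UNIV - {1, k}. (y $ i / P - v $ i / p)\<^sup>2))) powr (- a)
        * p powr (- (real m / 2)) * (p * t) powr (\<sigma> - 1))) \<partial>lborel)
    = (\<integral>\<^sup>+ w. indicator {0<..<1} ((w::(real,'n) vec) $ 1) * (indicator {0<..<1} (w $ k) * ennreal ((1 + rest_sq k w) powr (- a))) \<partial>lborel)
      * ennreal (P powr (- (real m / 2)) * ((P + p) powr (- 2 * \<sigma>) * p powr (\<sigma> - 1)) * ((T + t) powr (- 2 * \<sigma>) * t powr (\<sigma> - 1)))"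
proof -
  let ?X = "P powr (- (real m / 2)) * ((P + p) powr (- 2 * \<sigma>) * p powr (\<sigma> - 1)) * ((T + t) powr (- 2 * \<sigma>) * t powr (\<sigma> - 1))"
  let ?I = "indicator {0<..<1::real} :: real \<Rightarrow> ennreal"
  define J where "J = UNIV - {1, k}"
  have m: "card J = m" using k by (simp add: J_def m_def card_Diff_subset)
  define c where "c = P * p / (P + p)"
  have c: "c > 0" using P p by (simp add: c_def)
  \<comment> \<open>the scale of the transverse substitution\<close>
  define h where "h = p * sqrt ((T + t) / c)"
  have h: "h > 0" using p t T c by (simp add: h_def)
  let ?g = "\<lambda>v. ?I (v $ 1) * (?I (v $ k) *
      ennreal (((P + p) * (T + t + c * (\<Sum>i\<in>J. (y $ i / P - v $ i / p)\<^sup>2))) powr (- a)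
        * p powr (- (real m / 2)) * (p * t) powr (\<sigma> - 1)))"
  have prod: "(\<Prod>i\<in>UNIV. \<bar>if i \<in> J then h else 1\<bar>) = h ^ m"
  proof -
    have "(\<Prod>i\<in>UNIV. \<bar>if i \<in> J then h else 1\<bar>) = (\<Prod>i\<in>J. h)"
      using h by (intro prod.mono_neutral_cong_right) auto
    then show ?thesis by (simp add: m)
  qed
  let ?A = "\<lambda>w::(real,'n) vec. \<chi> i. (if i \<in> J then p * y $ i / P else 0) + (if i \<in> J then h else 1) * w $ i"
  have "(\<integral>\<^sup>+ v. ?g v \<partial>lborel) = ennreal (h ^ m) * (\<integral>\<^sup>+ w. ?g (?A w) \<partial>lborel)"
    unfolding prod[symmetric] using h by (intro nn_integral_lborel_affine_vec) auto
  also have "\<dots> = (\<integral>\<^sup>+ w. ennreal (h ^ m) * ?g (?A w) \<partial>lborel)"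
  proof (rule nn_integral_cmult[symmetric])
    have "?A w = (\<Sum>i\<in>UNIV. ((if i \<in> J then p * y $ i / P else 0) + (if i \<in> J then h else 1) * w $ i) *\<^sub>R axis i 1)" for w
      by (simp add: vec_eq_iff axis_def if_distrib[of "\<lambda>x. _ * x"] cong: if_cong)
    then have [measurable]: "?A \<in> borel_measurable borel" by simp
    show "(\<lambda>w. ?g (?A w)) \<in> borel_measurable lborel"
      using measurable_compose[OF \<open>?A \<in> borel_measurable borel\<close>, of ?g borel] by simp
  qed
  also have "\<dots> = (\<integral>\<^sup>+ w. (?I (w $ 1) * (?I (w $ k) * ennreal ((1 + rest_sq k w) powr (- a))))
      * ennreal ?X \<partial>lborel)"
  proof (rule nn_integral_cong)
    fix w :: "(real,'n) vec"
    define R where "R = 1 + rest_sq k w"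
    have R: "R > 0" unfolding R_def rest_sq_def by (simp add: add_pos_nonneg sum_nonneg)
    have hp: "(h / p)\<^sup>2 = (T + t) / c" using p t T c by (simp add: h_def)
    have "(\<Sum>i\<in>J. (y $ i / P - ?A w $ i / p)\<^sup>2) = (\<Sum>i\<in>J. (h / p)\<^sup>2 * (w $ i)\<^sup>2)"
    proof (intro sum.cong refl)
      fix i assume i: "i \<in> J"
      have "y $ i / P - ?A w $ i / p = - (h / p * w $ i)"
        using i p by (simp add: add_divide_distrib)
      then show "(y $ i / P - ?A w $ i / p)\<^sup>2 = (h / p)\<^sup>2 * (w $ i)\<^sup>2" by (simp only: power2_minus power_mult_distrib)
    qed
    also have "\<dots> = (T + t) / c * rest_sq k w"
      by (simp only: hp sum_distrib_left[symmetric] rest_sq_def J_def)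
    finally have X: "(\<Sum>i\<in>J. (y $ i / P - ?A w $ i / p)\<^sup>2) = (T + t) / c * rest_sq k w" .
    have "c * ((T + t) / c * rest_sq k w) = (T + t) * rest_sq k w" using c by simp
    then have S: "T + t + c * (\<Sum>i\<in>J. (y $ i / P - ?A w $ i / p)\<^sup>2) = (T + t) * R"
      unfolding X R_def by (simp only: distrib_left mult_1_right)
    have pos: "P + p > 0" "T + t > 0" using P p T t by auto
    have "h ^ m * (((P + p) * ((T + t) * R)) powr (- a) * p powr (- (real m / 2)) * (p * t) powr (\<sigma> - 1))
      = R powr (- a) * ?X"
    proof -
      have lnh: "ln h = ln p + (ln (T + t) - (ln P + ln p - ln (P + p))) / 2"
        using P p pos c by (simp add: h_def ln_mult ln_sqrt ln_div c_def)
      have hm: "h ^ m = exp (real m * ln h)" using h by (simp add: exp_of_nat_mult)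
      show ?thesis
        using P p t T R pos
        unfolding hm powr_def
        by (simp add: ln_mult exp_add[symmetric] lnh a_def) (simp add: algebra_simps diff_divide_distrib add_divide_distrib)
    qed
    note eq = this
    have "(?A w) $ 1 = w $ 1" "(?A w) $ k = w $ k" by (auto simp: J_def)
    then have "ennreal (h ^ m) * ?g (?A w) = ?I (w $ 1) * (?I (w $ k) * (ennreal (h ^ m) *
       ennreal (((P + p) * ((T + t) * R)) powr (- a) * p powr (- (real m / 2)) * (p * t) powr (\<sigma> - 1))))"
      unfolding S by (simp only: mult_ac)
    also have "ennreal (h ^ m) * ennreal (((P + p) * ((T + t) * R)) powr (- a) * p powr (- (real m / 2)) * (p * t) powr (\<sigma> - 1))
      = ennreal (R powr (- a) * ?X)"
      unfolding eq[symmetric] using h by (intro ennreal_mult[symmetric]) auto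
    also have "\<dots> = ennreal (R powr (- a)) * ennreal ?X"
      by (intro ennreal_mult) auto
    finally show "ennreal (h ^ m) * ?g (?A w) = (?I (w $ 1) * (?I (w $ k) * ennreal ((1 + rest_sq k w) powr (- a))))
      * ennreal ?X"
      unfolding R_def by (simp only: mult.assoc)
  qed
  also have "\<dots> = (\<integral>\<^sup>+ w. ?I (w $ 1) * (?I (w $ k) * ennreal ((1 + rest_sq k w) powr (- a))) \<partial>(lborel::(real,'n) vec measure))
      * ennreal ?X"
    by (rule nn_integral_multc) measurable
  finally show ?thesis unfolding c_def J_def .
qed

definition cone_const :: "'n::{finite,one} \<Rightarrow> real \<Rightarrow> ennreal" where
  "cone_const k \<sigma> = ennreal (1 / 2) *
    (\<integral>\<^sup>+ w. indicator {0<..<1} ((w::(real,'n) vec) $ 1) * (indicator {0<..<1} (w $ k) *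
      ennreal ((1 + rest_sq k w) powr (- (2 * \<sigma> + real (CARD('n) - 2) / 2)))) \<partial>lborel) *
    (\<integral>\<^sup>+ p. ennreal ((1 + p) powr (- 2 * \<sigma>) * p powr (\<sigma> - 1)) * indicator {0<..} p \<partial>lborel) *
    (\<integral>\<^sup>+ p. ennreal ((1 + p) powr (- 2 * \<sigma>) * p powr (\<sigma> - 1)) * indicator {0<..} p \<partial>lborel)"

lemma cone_const_finite:
  assumes "k \<noteq> 1" "0 < \<sigma>"
  shows "cone_const k \<sigma> < \<infinity>"
  unfolding cone_const_def
  using nn_integral_transverse_finite[OF assms(1), of "2 * \<sigma> + real (CARD('a) - 2) / 2"] nn_integral_powr_ratio_finite[OF assms(2)] assms(2) ennreal_less_top[of "1 / 2"]
  by (auto simp: ennreal_mult_less_top)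

text \<open>
  After integrating out the transverse coordinates, the integral is a product of two copies of
  \<open>\<integral> (P + p)\<^bsup>-2\<sigma>\<^esup> p\<^bsup>\<sigma>-1\<^esup> dp = const \<cdot> P\<^bsup>-\<sigma>\<^esup>\<close>, at \<open>P = y\<^sub>1 + y\<^sub>k\<close> and \<open>T = \<Delta>(y) / P\<close>.
\<close>

lemma nn_integral_cone_power:
  fixes y :: "(real,'n::{finite,one}) vec"
  assumes n: "2 \<le> CARD('n)" and k: "k \<noteq> 1" and \<sigma>: "0 < \<sigma>" and y: "y \<in> lorentz_cone"
  defines "m \<equiv> CARD('n) - 2"
  shows "(\<integral>\<^sup>+ v. indicator lorentz_cone v * ennreal (lorentz_det (y + v) powr (- (2 * \<sigma> + real m / 2))
      * (v $ 1 + v $ k) powr (- (real m / 2)) * lorentz_det v powr (\<sigma> - 1)) \<partial>lborel)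
    = cone_const k \<sigma> * ennreal ((y $ 1 + y $ k) powr (- (real m / 2)) * lorentz_det y powr (- \<sigma>))"
proof -
  let ?I = "indicator {0<..<1::real} :: real \<Rightarrow> ennreal"
  define a where "a = 2 * \<sigma> + real m / 2"
  define P where "P = y $ 1 + y $ k"
  define T where "T = lorentz_det y / P"
  have P: "P > 0" using y by (simp add: P_def lorentz_cone_null_coords[OF k])
  have T: "T > 0" using P lorentz_coneD[OF y] by (simp add: T_def)
  let ?g = "\<lambda>v. indicator lorentz_cone v * ennreal (lorentz_det (y + v) powr (- a)
      * (v $ 1 + v $ k) powr (- (real m / 2)) * lorentz_det v powr (\<sigma> - 1))"
  let ?K = "\<integral>\<^sup>+ w. ?I ((w::(real,'n) vec) $ 1) * (?I (w $ k) * ennreal ((1 + rest_sq k w) powr (- a))) \<partial>lborel"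
  let ?j = "\<lambda>P p. ennreal ((P + p) powr (- 2 * \<sigma>) * p powr (\<sigma> - 1)) * indicator {0<..} p :: ennreal"
  have inner: "(\<integral>\<^sup>+ v. ?I (v $ 1) * (?I (v $ k) * ?g (null_coords k p (rest_sq k v / p + t) v)) \<partial>lborel)
    = ?K * ennreal (P powr (- (real m / 2))) * (?j P p * ?j T t)" for p t
  proof (cases "p > 0 \<and> t > 0")
    case True
    then have p: "p > 0" and t: "t > 0" by auto
    have "?g (null_coords k p (rest_sq k v / p + t) v) =
       ennreal (((P + p) * (T + t + P * p / (P + p) * (\<Sum>i\<in>UNIV - {1, k}. (y $ i / P - v $ i / p)\<^sup>2))) powr (- a)
        * p powr (- (real m / 2)) * (p * t) powr (\<sigma> - 1))" for v
    proof -
      have "null_coords k p (rest_sq k v / p + t) v \<in> lorentz_cone"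
        using p t by (simp add: lorentz_cone_null_coords[OF k] null_coords_sum_diff[OF k] lorentz_det_null_coords_shift[OF k])
      then show ?thesis
        using p by (simp add: null_coords_sum_diff[OF k] lorentz_det_null_coords_shift[OF k]
          lorentz_det_add_null_coords[OF k p P_def P T_def])
    qed
    then have "(\<integral>\<^sup>+ v. ?I (v $ 1) * (?I (v $ k) * ?g (null_coords k p (rest_sq k v / p + t) v)) \<partial>lborel)
      = ?K * ennreal (P powr (- (real m / 2)) * ((P + p) powr (- 2 * \<sigma>) * p powr (\<sigma> - 1)) * ((T + t) powr (- 2 * \<sigma>) * t powr (\<sigma> - 1)))"
      using nn_integral_transverse[OF n k \<sigma> p t P T, of y] unfolding a_def m_def by simp
    also have "ennreal (P powr (- (real m / 2)) * ((P + p) powr (- 2 * \<sigma>) * p powr (\<sigma> - 1)) * ((T + t) powr (- 2 * \<sigma>) * t powr (\<sigma> - 1)))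
      = ennreal (P powr (- (real m / 2))) * (?j P p * ?j T t)"
      using p t by (simp add: ennreal_mult[symmetric] mult.assoc)
    finally show ?thesis by (simp only: mult.assoc)
  next
    case False
    have "?g (null_coords k p (rest_sq k v / p + t) v) = 0" for v
    proof -
      have "null_coords k p (rest_sq k v / p + t) v \<notin> lorentz_cone"
      proof
        assume "null_coords k p (rest_sq k v / p + t) v \<in> lorentz_cone"
        then have "p > 0" "0 < lorentz_det (null_coords k p (rest_sq k v / p + t) v)"
          by (simp_all add: lorentz_cone_null_coords[OF k] null_coords_sum_diff[OF k])
        then show False using False by (simp add: lorentz_det_null_coords_shift[OF k] zero_less_mult_iff)
      qed
      then show ?thesis by simp
    qed
    moreover have "?j P p * ?j T t = 0" using False by (auto simp: indicator_def)
    ultimately show ?thesis by (simp only: mult_zero_right mult_zero_left nn_integral_const)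
  qed
  have "(\<integral>\<^sup>+ v. ?g v \<partial>lborel) = ennreal (1 / 2) *
    (\<integral>\<^sup>+ p. \<integral>\<^sup>+ t. \<integral>\<^sup>+ v. ?I (v $ 1) * (?I (v $ k) * ?g (null_coords k p (rest_sq k v / p + t) v)) \<partial>lborel \<partial>lborel \<partial>lborel)"
    by (rule nn_integral_null_coords[OF k]) measurable
  also have "\<dots> = ennreal (1 / 2) * (\<integral>\<^sup>+ p. \<integral>\<^sup>+ t. ?K * ennreal (P powr (- (real m / 2))) * (?j P p * ?j T t) \<partial>lborel \<partial>lborel)"
    unfolding inner ..
  also have "(\<integral>\<^sup>+ p. \<integral>\<^sup>+ t. ?K * ennreal (P powr (- (real m / 2))) * (?j P p * ?j T t) \<partial>lborel \<partial>lborel)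
    = (\<integral>\<^sup>+ p. ?K * ennreal (P powr (- (real m / 2))) * (?j P p * (\<integral>\<^sup>+ t. ?j T t \<partial>lborel)) \<partial>lborel)"
    by (rule nn_integral_cong) (subst nn_integral_cmult, simp, subst nn_integral_cmult, simp_all)
  also have "\<dots> = ?K * ennreal (P powr (- (real m / 2))) * ((\<integral>\<^sup>+ p. ?j P p \<partial>lborel) * (\<integral>\<^sup>+ t. ?j T t \<partial>lborel))"
    by (subst nn_integral_cmult, simp, subst nn_integral_multc, simp_all)
  also have "(\<integral>\<^sup>+ p. ?j P p \<partial>lborel) = ennreal (P powr (- \<sigma>)) * (\<integral>\<^sup>+ p. ?j 1 p \<partial>lborel)"
    by (rule nn_integral_powr_ratio_scale[OF P])
  also have "(\<integral>\<^sup>+ t. ?j T t \<partial>lborel) = ennreal (T powr (- \<sigma>)) * (\<integral>\<^sup>+ p. ?j 1 p \<partial>lborel)"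
    by (rule nn_integral_powr_ratio_scale[OF T])
  also have "ennreal (1 / 2) * (?K * ennreal (P powr (- (real m / 2))) * (ennreal (P powr (- \<sigma>)) * (\<integral>\<^sup>+ p. ?j 1 p \<partial>lborel) * (ennreal (T powr (- \<sigma>)) * (\<integral>\<^sup>+ p. ?j 1 p \<partial>lborel))))
    = cone_const k \<sigma> * (ennreal (P powr (- (real m / 2))) * (ennreal (P powr (- \<sigma>)) * ennreal (T powr (- \<sigma>))))"
    unfolding cone_const_def a_def m_def by (simp only: mult_ac)
  also have "ennreal (P powr (- (real m / 2))) * (ennreal (P powr (- \<sigma>)) * ennreal (T powr (- \<sigma>)))
    = ennreal (P powr (- (real m / 2)) * (P powr (- \<sigma>) * T powr (- \<sigma>)))"
    by (simp add: ennreal_mult)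
  also have "P powr (- \<sigma>) * T powr (- \<sigma>) = lorentz_det y powr (- \<sigma>)"
    using P by (simp add: T_def powr_mult[symmetric])
  finally show ?thesis unfolding P_def a_def .
qed

section \<open>The Schur test function\<close>

text \<open>
  The generalised power of the cone that is attached to the half sum of the positive roots of the
  automorphism group. A power of \<open>\<Delta>\<close> alone, as test function, reaches only a smaller range of exponents.
\<close>

definition schur_weight :: "'n \<Rightarrow> real ^ 'n::{finite,one} \<Rightarrow> real" where
  "schur_weight k v = (v $ 1 + v $ k) powr (- (real (CARD('n) - 2) / 2)) * lorentz_det v powr ((real CARD('n) - 1) / 2)"

lemma schur_weight_pos: "k \<noteq> 1 \<Longrightarrow> v \<in> lorentz_cone \<Longrightarrow> 0 < schur_weight k v"
  by (auto simp: schur_weight_def lorentz_cone_null_coords)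

lemma schur_weight_measurable [measurable]: "schur_weight k \<in> borel_measurable borel"
  unfolding schur_weight_def[abs_def] by measurable

text \<open>
  The test function is an eigenfunction of the kernel
  \<open>\<Delta>(y)\<^bsup>s\<^esup> \<Delta>(v)\<^bsup>s\<^esup> \<bar>\<Delta>(z - w\<^sup>*)\<bar>\<^bsup>-2s\<^esup>\<close> on the tube, where \<open>w\<^sup>*\<close> is the conjugate of
  \<open>w = u + i v\<close>, with respect to the invariant measure
  \<open>\<Delta>(v)\<^bsup>-n\<^esup> du dv\<close>: the integral over \<open>u\<close> leaves a power of \<open>\<Delta>(y + v)\<close>, and the integral over \<open>v\<close> is the
  cone integral with \<open>\<sigma> = s - (n - 1) / 2\<close>.
\<close>

lemma schur_test_integral:
  fixes x y :: "(real,'n::{finite,one}) vec"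
  assumes n: "2 \<le> CARD('n)" and k: "k \<noteq> 1" and s: "(real CARD('n) - 1) / 2 < s" and y: "y \<in> lorentz_cone"
  shows "(\<integral>\<^sup>+ v. \<integral>\<^sup>+ u. indicator lorentz_cone v * ennreal (lorentz_det y powr s * lorentz_det v powr s
      * cmod (tube_det (re_im_vec (x - u) (y + v))) powr (- 2 * s) * schur_weight k v * lorentz_det v powr (- real CARD('n))) \<partial>lborel \<partial>lborel)
    = tube_det_mass (2 * s) TYPE('n) * cone_const k (s - (real CARD('n) - 1) / 2) * ennreal (schur_weight k y)"
proof -
  let ?k = "\<lambda>u v. lorentz_det y powr s * lorentz_det v powr s
      * cmod (tube_det (re_im_vec (x - u) (y + v))) powr (- 2 * s) * schur_weight k v * lorentz_det v powr (- real CARD('n))"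
  define m where "m = CARD('n) - 2"
  have m: "real m = real CARD('n) - 2" using n by (simp add: m_def)
  define \<sigma> where "\<sigma> = s - (real CARD('n) - 1) / 2"
  have \<sigma>: "\<sigma> > 0" using s by (simp add: \<sigma>_def)
  have d: "lorentz_det y > 0" using y by (rule lorentz_coneD)
  have inner: "(\<integral>\<^sup>+ u. indicator lorentz_cone v * ennreal (?k u v) \<partial>lborel)
    = (tube_det_mass (2 * s) TYPE('n) * ennreal (lorentz_det y powr s)) * (indicator lorentz_cone v * ennreal (lorentz_det (y + v) powr (- (2 * \<sigma> + real m / 2))
      * (v $ 1 + v $ k) powr (- (real m / 2)) * lorentz_det v powr (\<sigma> - 1)))" for v
  proof (cases "v \<in> lorentz_cone")
    case True
    then have dv: "lorentz_det v > 0" by (rule lorentz_coneD)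
    have yv: "y + v \<in> lorentz_cone" by (rule lorentz_cone_add[OF y True])
    let ?c = "lorentz_det y powr s * lorentz_det v powr s * schur_weight k v * lorentz_det v powr (- real CARD('n))"
    have c: "?c \<ge> 0" using schur_weight_pos[OF k True] by simp
    have "(\<integral>\<^sup>+ u. ennreal (?k u v) \<partial>lborel)
      = (\<integral>\<^sup>+ u. ennreal ?c * ennreal (cmod (tube_det (re_im_vec (x - u) (y + v))) powr (- (2 * s))) \<partial>lborel)"
      using c by (intro nn_integral_cong) (simp add: ennreal_mult[symmetric] mult_ac)
    also have "\<dots> = ennreal ?c * (\<integral>\<^sup>+ u. ennreal (cmod (tube_det (re_im_vec (x - u) (y + v))) powr (- (2 * s))) \<partial>lborel)"
      by (rule nn_integral_cmult) measurable
    also have "(\<integral>\<^sup>+ u. ennreal (cmod (tube_det (re_im_vec (x - u) (y + v))) powr (- (2 * s))) \<partial>lborel)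
      = (\<integral>\<^sup>+ u. ennreal (cmod (tube_det (re_im_vec (x + u) (y + v))) powr (- (2 * s))) \<partial>lborel)"
      using nn_integral_lborel_scale[of "\<lambda>u. ennreal (cmod (tube_det (re_im_vec (x + u) (y + v))) powr (- (2 * s)))" "-1"] by simp
    also have "\<dots> = (\<integral>\<^sup>+ u. ennreal (cmod (tube_det (re_im_vec u (y + v))) powr (- (2 * s))) \<partial>lborel)"
      by (rule nn_integral_lborel_translate) measurable
    also have "\<dots> = tube_det_mass (2 * s) TYPE('n) * ennreal (lorentz_det (y + v) powr (real CARD('n) / 2 - 2 * s))"
      by (rule nn_integral_tube_det_powr[OF yv])
    also have "ennreal ?c * (tube_det_mass (2 * s) TYPE('n) * ennreal (lorentz_det (y + v) powr (real CARD('n) / 2 - 2 * s)))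
      = tube_det_mass (2 * s) TYPE('n) * ennreal (?c * lorentz_det (y + v) powr (real CARD('n) / 2 - 2 * s))"
    proof -
      have "ennreal (?c * lorentz_det (y + v) powr (real CARD('n) / 2 - 2 * s)) = ennreal ?c * ennreal (lorentz_det (y + v) powr (real CARD('n) / 2 - 2 * s))"
        using c by (intro ennreal_mult) auto
      then show ?thesis by (simp only: mult_ac)
    qed
    also have "?c * lorentz_det (y + v) powr (real CARD('n) / 2 - 2 * s)
      = lorentz_det y powr s * (lorentz_det (y + v) powr (- (2 * \<sigma> + real m / 2)) * (v $ 1 + v $ k) powr (- (real m / 2)) * lorentz_det v powr (\<sigma> - 1))"
    proof -
      have e1: "lorentz_det v powr s * lorentz_det v powr ((real CARD('n) - 1) / 2) * lorentz_det v powr (- real CARD('n)) = lorentz_det v powr (\<sigma> - 1)"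
        unfolding powr_add[symmetric] by (rule arg_cong2[where f = "(powr)", OF refl]) (simp add: \<sigma>_def field_simps)
      have e2: "real CARD('n) / 2 - 2 * s = - (2 * \<sigma> + real m / 2)" by (simp add: \<sigma>_def m field_simps)
      show ?thesis unfolding e1[symmetric] e2 schur_weight_def m_def by (simp only: mult_ac)
    qed
    finally show ?thesis using True by (simp add: ennreal_mult mult_ac)
  qed simp
  have "(\<integral>\<^sup>+ v. \<integral>\<^sup>+ u. indicator lorentz_cone v * ennreal (?k u v) \<partial>lborel \<partial>lborel)
    = (tube_det_mass (2 * s) TYPE('n) * ennreal (lorentz_det y powr s)) * (\<integral>\<^sup>+ v. indicator lorentz_cone v * ennreal (lorentz_det (y + v) powr (- (2 * \<sigma> + real m / 2))
      * (v $ 1 + v $ k) powr (- (real m / 2)) * lorentz_det v powr (\<sigma> - 1)) \<partial>lborel)"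
    unfolding inner by (rule nn_integral_cmult) measurable
  also have "\<dots> = (tube_det_mass (2 * s) TYPE('n) * ennreal (lorentz_det y powr s)) *
      (cone_const k \<sigma> * ennreal ((y $ 1 + y $ k) powr (- (real m / 2)) * lorentz_det y powr (- \<sigma>)))"
    unfolding m_def nn_integral_cone_power[OF n k \<sigma> y] ..
  also have "\<dots> = tube_det_mass (2 * s) TYPE('n) * cone_const k \<sigma> * (ennreal (lorentz_det y powr s) * ennreal ((y $ 1 + y $ k) powr (- (real m / 2)) * lorentz_det y powr (- \<sigma>)))"
    by (simp only: mult_ac)
  also have "ennreal (lorentz_det y powr s) * ennreal ((y $ 1 + y $ k) powr (- (real m / 2)) * lorentz_det y powr (- \<sigma>))
    = ennreal (schur_weight k y)"
  proof -
    have e: "lorentz_det y powr s * lorentz_det y powr (- \<sigma>) = lorentz_det y powr ((real CARD('n) - 1) / 2)"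
      unfolding powr_add[symmetric] by (simp add: \<sigma>_def)
    have "lorentz_det y powr s * ((y $ 1 + y $ k) powr (- (real m / 2)) * lorentz_det y powr (- \<sigma>)) = schur_weight k y"
      unfolding schur_weight_def m_def e[symmetric] by (simp only: mult_ac)
    then show ?thesis by (simp add: ennreal_mult[symmetric])
  qed
  finally show ?thesis unfolding \<sigma>_def .
qed

section \<open>Schur test and adjoint operators\<close>

lemma norm_integral_le_nn_integral:
  fixes f :: "'a \<Rightarrow> 'b::{banach, second_countable_topology}"
  shows "ennreal (norm (\<integral>x. f x \<partial>M)) \<le> (\<integral>\<^sup>+ x. ennreal (norm (f x)) \<partial>M)"
  by (cases "integrable M f") (auto simp: integral_norm_bound_ennreal not_integrable_integral_eq)

text \<open>
  From \<open>a\<^sub>x a\<^sub>y \<le> a\<^sub>x\<^sup>2 w\<^sub>y / w\<^sub>x + a\<^sub>y\<^sup>2 w\<^sub>x / w\<^sub>y\<close>; by symmetry of the kernel both terms have the same integral.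
\<close>

lemma schur_test:
  fixes k :: "'a \<Rightarrow> 'a \<Rightarrow> ennreal" and a w :: "'a \<Rightarrow> real"
  assumes "sigma_finite_measure M"
    and k: "case_prod k \<in> borel_measurable (M \<Otimes>\<^sub>M M)"
    and [measurable]: "a \<in> borel_measurable M" "w \<in> borel_measurable M"
    and sym: "\<And>x y. k x y = k y x"
    and pos: "\<And>x. 0 < w x" "\<And>x. 0 \<le> a x"
    and bound: "\<And>x. x \<in> space M \<Longrightarrow> (\<integral>\<^sup>+ y. k x y * ennreal (w y) \<partial>M) \<le> C * ennreal (w x)"
  shows "(\<integral>\<^sup>+ x. \<integral>\<^sup>+ y. k x y * ennreal (a x * a y) \<partial>M \<partial>M) \<le> 2 * C * (\<integral>\<^sup>+ x. ennreal ((a x)\<^sup>2) \<partial>M)"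
proof -
  interpret M: sigma_finite_measure M by fact
  interpret MM: pair_sigma_finite M M ..
  note [measurable] = k
  have kx: "(\<lambda>y. k x y) \<in> borel_measurable M" if "x \<in> space M" for x
    using measurable_compose[OF measurable_Pair1'[OF that] k] by simp
  let ?T = "\<integral>\<^sup>+ x. \<integral>\<^sup>+ y. k x y * ennreal ((a x)\<^sup>2 * w y / w x) \<partial>M \<partial>M"
  have T: "?T \<le> C * (\<integral>\<^sup>+ x. ennreal ((a x)\<^sup>2) \<partial>M)"
  proof -
    have "?T \<le> (\<integral>\<^sup>+ x. C * ennreal ((a x)\<^sup>2) \<partial>M)"
    proof (rule nn_integral_mono)
      fix x assume x: "x \<in> space M"
      note [measurable] = kx[OF x]
      have "(\<integral>\<^sup>+ y. k x y * ennreal ((a x)\<^sup>2 * w y / w x) \<partial>M) = (\<integral>\<^sup>+ y. ennreal ((a x)\<^sup>2 / w x) * (k x y * ennreal (w y)) \<partial>M)"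
      proof (rule nn_integral_cong)
        fix y
        have "ennreal ((a x)\<^sup>2 * w y / w x) = ennreal ((a x)\<^sup>2 / w x * w y)" by simp
        also have "\<dots> = ennreal ((a x)\<^sup>2 / w x) * ennreal (w y)"
          using pos(1)[of x] pos(1)[of y] by (intro ennreal_mult) auto
        finally show "k x y * ennreal ((a x)\<^sup>2 * w y / w x) = ennreal ((a x)\<^sup>2 / w x) * (k x y * ennreal (w y))"
          by (simp only: mult_ac)
      qed
      also have "\<dots> = ennreal ((a x)\<^sup>2 / w x) * (\<integral>\<^sup>+ y. k x y * ennreal (w y) \<partial>M)"
        by (rule nn_integral_cmult) measurable
      also have "\<dots> \<le> ennreal ((a x)\<^sup>2 / w x) * (C * ennreal (w x))"
        by (intro mult_left_mono bound x) auto
      also have "\<dots> = C * (ennreal ((a x)\<^sup>2 / w x) * ennreal (w x))" by (simp only: mult_ac)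
      also have "ennreal ((a x)\<^sup>2 / w x) * ennreal (w x) = ennreal ((a x)\<^sup>2)"
        using pos(1)[of x] by (subst ennreal_mult[symmetric]) auto
      finally show "(\<integral>\<^sup>+ y. k x y * ennreal ((a x)\<^sup>2 * w y / w x) \<partial>M) \<le> C * ennreal ((a x)\<^sup>2)" .
    qed
    also have "\<dots> = C * (\<integral>\<^sup>+ x. ennreal ((a x)\<^sup>2) \<partial>M)" by (rule nn_integral_cmult) measurable
    finally show ?thesis .
  qed
  have m1: "(\<lambda>(x, y). k x y * ennreal ((a x)\<^sup>2 * w y / w x)) \<in> borel_measurable (M \<Otimes>\<^sub>M M)"
    by measurable
  have T': "(\<integral>\<^sup>+ x. \<integral>\<^sup>+ y. k x y * ennreal ((a y)\<^sup>2 * w x / w y) \<partial>M \<partial>M) = ?T"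
    using MM.Fubini'[OF m1] by (simp add: sym)
  have "(\<integral>\<^sup>+ x. \<integral>\<^sup>+ y. k x y * ennreal (a x * a y) \<partial>M \<partial>M)
    \<le> (\<integral>\<^sup>+ x. \<integral>\<^sup>+ y. k x y * ennreal ((a x)\<^sup>2 * w y / w x) + k x y * ennreal ((a y)\<^sup>2 * w x / w y) \<partial>M \<partial>M)"
  proof (rule nn_integral_mono, rule nn_integral_mono)
    fix x y
    define X Y where "X = (a x)\<^sup>2 * w y / w x" and "Y = (a y)\<^sup>2 * w x / w y"
    have XY: "X \<ge> 0" "Y \<ge> 0" using pos(1)[of x] pos(1)[of y] by (auto simp: X_def Y_def)
    have "(a x * a y)\<^sup>2 = X * Y"
      using pos(1)[of x] pos(1)[of y] by (simp add: X_def Y_def power_mult_distrib)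
    also have "\<dots> \<le> (X + Y)\<^sup>2" using XY by (simp add: power2_eq_square algebra_simps)
    finally have "a x * a y \<le> X + Y" using XY by (intro power2_le_imp_le[of "a x * a y"]) auto
    then have "ennreal (a x * a y) \<le> ennreal X + ennreal Y"
      using XY by (simp add: ennreal_plus[symmetric] ennreal_leI del: ennreal_plus)
    then have "k x y * ennreal (a x * a y) \<le> k x y * (ennreal X + ennreal Y)" by (rule mult_left_mono) simp
    then show "k x y * ennreal (a x * a y) \<le> k x y * ennreal ((a x)\<^sup>2 * w y / w x) + k x y * ennreal ((a y)\<^sup>2 * w x / w y)"
      by (simp only: X_def Y_def distrib_left)
  qed
  also have "\<dots> = (\<integral>\<^sup>+ x. (\<integral>\<^sup>+ y. k x y * ennreal ((a x)\<^sup>2 * w y / w x) \<partial>M) + (\<integral>\<^sup>+ y. k x y * ennreal ((a y)\<^sup>2 * w x / w y) \<partial>M) \<partial>M)"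
  proof (rule nn_integral_cong)
    fix x assume x: "x \<in> space M"
    note [measurable] = kx[OF x]
    show "(\<integral>\<^sup>+ y. k x y * ennreal ((a x)\<^sup>2 * w y / w x) + k x y * ennreal ((a y)\<^sup>2 * w x / w y) \<partial>M)
      = (\<integral>\<^sup>+ y. k x y * ennreal ((a x)\<^sup>2 * w y / w x) \<partial>M) + (\<integral>\<^sup>+ y. k x y * ennreal ((a y)\<^sup>2 * w x / w y) \<partial>M)"
      by (rule nn_integral_add) measurable
  qed
  also have "\<dots> = ?T + (\<integral>\<^sup>+ x. \<integral>\<^sup>+ y. k x y * ennreal ((a y)\<^sup>2 * w x / w y) \<partial>M \<partial>M)"
    by (rule nn_integral_add) measurable
  also have "\<dots> = 2 * ?T" unfolding T' by (simp only: mult_2)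
  also have "\<dots> \<le> 2 * (C * (\<integral>\<^sup>+ x. ennreal ((a x)\<^sup>2) \<partial>M))" by (rule mult_left_mono[OF T]) simp
  finally show ?thesis by (simp only: mult.assoc)
qed

text \<open>
  The operator \<open>T g (z) = \<integral> g(u) cnj (S z u) du\<close> is studied through its adjoint
  \<open>(T\<^sup>* h)\<^sup>* (u) = \<integral> h(z) cnj (S z u) dz\<close>, applied to one bounded multiplier \<open>h\<close>. Finiteness of \<open>M\<close> makes all
  the integrals absolutely convergent.
\<close>

context
  fixes M :: "'z measure" and N :: "'u measure" and S :: "'z \<Rightarrow> 'u \<Rightarrow> complex" and h :: "'z \<Rightarrow> complex"
    and b B :: real
  assumes fin: "finite_measure M" and sig: "sigma_finite_measure N"
    and S [measurable]: "case_prod S \<in> borel_measurable (M \<Otimes>\<^sub>M N)"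
    and h [measurable]: "h \<in> borel_measurable M"
    and hb: "\<And>z. cmod (h z) \<le> b"
    and SB: "\<And>z. z \<in> space M \<Longrightarrow> (\<integral>\<^sup>+ u. ennreal ((cmod (S z u))\<^sup>2) \<partial>N) \<le> ennreal B"
begin

lemma kernel_section_measurable: "z \<in> space M \<Longrightarrow> S z \<in> borel_measurable N"
  using measurable_compose[OF measurable_Pair1' S, of z] by simp

lemma multiplier_bound_nonneg: "0 \<le> b"
  using hb[of undefined] norm_ge_zero order_trans by blast

lemma pairing_adjoint:
  assumes g [measurable]: "g \<in> borel_measurable N" and g2: "(\<integral>\<^sup>+ u. ennreal ((cmod (g u))\<^sup>2) \<partial>N) < \<infinity>"
  shows "(\<integral>z. h z * (\<integral>u. g u * cnj (S z u) \<partial>N) \<partial>M) = (\<integral>u. g u * (\<integral>z. h z * cnj (S z u) \<partial>M) \<partial>N)"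
proof -
  interpret M: finite_measure M by (rule fin)
  interpret N: sigma_finite_measure N by (rule sig)
  interpret MN: pair_sigma_finite M N ..
  let ?f = "\<lambda>z u. h z * (g u * cnj (S z u))"
  have meas: "case_prod ?f \<in> borel_measurable (M \<Otimes>\<^sub>M N)" by measurable
  have "integrable (M \<Otimes>\<^sub>M N) (case_prod ?f)"
  proof (rule integrableI_bounded[OF meas])
    let ?G = "\<integral>\<^sup>+ u. ennreal ((cmod (g u))\<^sup>2) \<partial>N"
    have "(\<integral>\<^sup>+ x. ennreal (norm (case_prod ?f x)) \<partial>(M \<Otimes>\<^sub>M N)) = (\<integral>\<^sup>+ z. \<integral>\<^sup>+ u. ennreal (norm (?f z u)) \<partial>N \<partial>M)"
      by (subst N.nn_integral_fst[symmetric]) simp_all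
    also have "\<dots> \<le> (\<integral>\<^sup>+ z. ennreal b * (?G + ennreal B) \<partial>M)"
    proof (rule nn_integral_mono)
      fix z assume z: "z \<in> space M"
      note [measurable] = kernel_section_measurable[OF z]
      have "(\<integral>\<^sup>+ u. ennreal (norm (?f z u)) \<partial>N) \<le> (\<integral>\<^sup>+ u. ennreal b * (ennreal ((cmod (g u))\<^sup>2) + ennreal ((cmod (S z u))\<^sup>2)) \<partial>N)"
      proof (rule nn_integral_mono)
        fix u
        have "cmod (g u) * cmod (S z u) \<le> (cmod (g u))\<^sup>2 + (cmod (S z u))\<^sup>2"
          by (intro mult_le_sum_squares) auto
        then have "cmod (h z) * (cmod (g u) * cmod (S z u)) \<le> b * ((cmod (g u))\<^sup>2 + (cmod (S z u))\<^sup>2)"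
          using hb[of z] multiplier_bound_nonneg by (intro mult_mono) auto
        then have "ennreal (norm (?f z u)) \<le> ennreal (b * ((cmod (g u))\<^sup>2 + (cmod (S z u))\<^sup>2))"
          by (intro ennreal_leI) (simp add: norm_mult)
        then show "ennreal (norm (?f z u)) \<le> ennreal b * (ennreal ((cmod (g u))\<^sup>2) + ennreal ((cmod (S z u))\<^sup>2))"
          using multiplier_bound_nonneg by (simp add: ennreal_mult ennreal_plus)
      qed
      also have "\<dots> = ennreal b * (?G + (\<integral>\<^sup>+ u. ennreal ((cmod (S z u))\<^sup>2) \<partial>N))"
        by (subst nn_integral_cmult, measurable, subst nn_integral_add) measurable
      also have "\<dots> \<le> ennreal b * (?G + ennreal B)"
        by (intro mult_left_mono add_left_mono SB z) auto
      finally show "(\<integral>\<^sup>+ u. ennreal (norm (?f z u)) \<partial>N) \<le> ennreal b * (?G + ennreal B)" .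
    qed
    also have "\<dots> < \<infinity>"
    proof -
      have "emeasure M (space M) < \<infinity>" using M.emeasure_finite[of "space M"] by (simp add: less_top[symmetric])
      then show ?thesis using g2 by (simp add: ennreal_mult_less_top)
    qed
    finally show "(\<integral>\<^sup>+ x. ennreal (norm (case_prod ?f x)) \<partial>(M \<Otimes>\<^sub>M N)) < \<infinity>" .
  qed
  from MN.Fubini_integral[OF this]
  have "(\<integral>z. \<integral>u. ?f z u \<partial>N \<partial>M) = (\<integral>u. \<integral>z. ?f z u \<partial>M \<partial>N)" by (rule sym)
  moreover have "(\<integral>z. ?f z u \<partial>M) = g u * (\<integral>z. h z * cnj (S z u) \<partial>M)" for u
    by (subst integral_mult_right_zero[symmetric]) (simp only: mult.left_commute)
  ultimately show ?thesis by simp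
qed

lemma adjoint_measurable: "(\<lambda>u. \<integral>z. h z * cnj (S z u) \<partial>M) \<in> borel_measurable N"
proof -
  interpret M: finite_measure M by (rule fin)
  interpret N: sigma_finite_measure N by (rule sig)
  interpret MN: pair_sigma_finite M N ..
  have "(\<lambda>(u, z). h z * cnj (S z u)) \<in> borel_measurable (N \<Otimes>\<^sub>M M)"
    using measurable_compose[OF measurable_pair_swap' S] by (auto simp: case_prod_beta')
  then show ?thesis by (rule M.borel_measurable_lebesgue_integral)
qed

lemma adjoint_square_integrable:
  "(\<integral>\<^sup>+ u. ennreal ((cmod (\<integral>z. h z * cnj (S z u) \<partial>M))\<^sup>2) \<partial>N) < \<infinity>"
proof -
  interpret M: finite_measure M by (rule fin)
  interpret N: sigma_finite_measure N by (rule sig)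
  interpret MN: pair_sigma_finite M N ..
  have Sz [measurable]: "(\<lambda>z. S z u) \<in> borel_measurable M" if "u \<in> space N" for u
    using measurable_compose[OF measurable_Pair2'[OF that] S] by simp
  let ?m = "emeasure M (space M)"
  have m: "?m < \<infinity>" using M.emeasure_finite[of "space M"] by (simp add: less_top[symmetric])
  have "(\<integral>\<^sup>+ u. ennreal ((cmod (\<integral>z. h z * cnj (S z u) \<partial>M))\<^sup>2) \<partial>N)
    \<le> (\<integral>\<^sup>+ u. ennreal (b\<^sup>2) * ?m * (\<integral>\<^sup>+ z. ennreal ((cmod (S z u))\<^sup>2) \<partial>M) \<partial>N)"
  proof (rule nn_integral_mono)
    fix u assume u: "u \<in> space N"
    note [measurable] = Sz[OF u]
    have "ennreal (cmod (\<integral>z. h z * cnj (S z u) \<partial>M)) \<le> (\<integral>\<^sup>+ z. ennreal (norm (h z * cnj (S z u))) \<partial>M)"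
      by (rule norm_integral_le_nn_integral)
    also have "\<dots> \<le> (\<integral>\<^sup>+ z. ennreal b * ennreal (cmod (S z u)) \<partial>M)"
      using hb multiplier_bound_nonneg
      by (intro nn_integral_mono) (simp add: norm_mult ennreal_mult[symmetric] ennreal_leI mult_right_mono)
    finally have "(ennreal (cmod (\<integral>z. h z * cnj (S z u) \<partial>M)))\<^sup>2 \<le> (\<integral>\<^sup>+ z. ennreal b * ennreal (cmod (S z u)) \<partial>M)\<^sup>2"
      by (rule power_mono) simp
    also have "\<dots> \<le> (\<integral>\<^sup>+ z. (ennreal b)\<^sup>2 \<partial>M) * (\<integral>\<^sup>+ z. (ennreal (cmod (S z u)))\<^sup>2 \<partial>M)"
      by (rule Cauchy_Schwarz_nn_integral) measurable
    finally show "ennreal ((cmod (\<integral>z. h z * cnj (S z u) \<partial>M))\<^sup>2)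
       \<le> ennreal (b\<^sup>2) * ?m * (\<integral>\<^sup>+ z. ennreal ((cmod (S z u))\<^sup>2) \<partial>M)"
      using multiplier_bound_nonneg by (simp add: ennreal_power)
  qed
  also have "\<dots> = ennreal (b\<^sup>2) * ?m * (\<integral>\<^sup>+ u. \<integral>\<^sup>+ z. ennreal ((cmod (S z u))\<^sup>2) \<partial>M \<partial>N)"
    by (rule nn_integral_cmult) measurable
  also have "(\<integral>\<^sup>+ u. \<integral>\<^sup>+ z. ennreal ((cmod (S z u))\<^sup>2) \<partial>M \<partial>N) = (\<integral>\<^sup>+ z. \<integral>\<^sup>+ u. ennreal ((cmod (S z u))\<^sup>2) \<partial>N \<partial>M)"
    by (rule MN.Fubini') measurable
  also have "\<dots> \<le> (\<integral>\<^sup>+ z. ennreal B \<partial>M)" by (intro nn_integral_mono SB)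
  finally have "(\<integral>\<^sup>+ u. ennreal ((cmod (\<integral>z. h z * cnj (S z u) \<partial>M))\<^sup>2) \<partial>N) \<le> ennreal (b\<^sup>2) * ?m * (ennreal B * ?m)"
    by (simp add: mult_left_mono)
  also have "\<dots> < \<infinity>" using m by (simp add: ennreal_mult_less_top)
  finally show ?thesis .
qed

text \<open>
  The norm of \<open>T\<^sup>* h\<close>, where \<open>T g (z) = \<langle>g, S\<^sub>z\<rangle>\<close>, is \<open>\<langle>T T\<^sup>* h, h\<rangle>\<close>, and \<open>T T\<^sup>*\<close> has the Gram kernel
  \<open>\<langle>S\<^sub>z, S\<^sub>w\<rangle>\<close>. Both interchanges of integrals are instances of the pairing lemma, first with \<open>T\<^sup>* h\<close> itself and then
  with a kernel function as the square integrable function.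
\<close>

lemma adjoint_norm_le:
  "(\<integral>\<^sup>+ u. ennreal ((cmod (\<integral>z. h z * cnj (S z u) \<partial>M))\<^sup>2) \<partial>N)
    \<le> (\<integral>\<^sup>+ z. \<integral>\<^sup>+ w. ennreal (cmod (h z) * cmod (h w) * cmod (\<integral>u. S z u * cnj (S w u) \<partial>N)) \<partial>M \<partial>M)"
proof -
  define H where "H u = (\<integral>z. h z * cnj (S z u) \<partial>M)" for u
  have Hm [measurable]: "H \<in> borel_measurable N" unfolding H_def by (rule adjoint_measurable)
  have H2: "(\<integral>\<^sup>+ u. ennreal ((cmod (H u))\<^sup>2) \<partial>N) < \<infinity>" unfolding H_def by (rule adjoint_square_integrable)
  have int: "integrable N (\<lambda>u. (cmod (H u))\<^sup>2)"
    by (rule integrableI_bounded) (use H2 in simp_all)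
  have "(\<integral>\<^sup>+ u. ennreal ((cmod (H u))\<^sup>2) \<partial>N) = ennreal (\<integral>u. (cmod (H u))\<^sup>2 \<partial>N)"
    by (rule nn_integral_eq_integral[OF int]) simp
  also have "(\<integral>u. (cmod (H u))\<^sup>2 \<partial>N) = cmod (\<integral>u. cnj (H u) * H u \<partial>N)"
  proof -
    have "(\<integral>u. cnj (H u) * H u \<partial>N) = (\<integral>u. complex_of_real ((cmod (H u))\<^sup>2) \<partial>N)"
      by (intro Bochner_Integration.integral_cong refl) (simp only: complex_norm_square mult.commute)
    also have "\<dots> = complex_of_real (\<integral>u. (cmod (H u))\<^sup>2 \<partial>N)" by (rule integral_complex_of_real)
    finally show ?thesis by simp
  qed
  also have "(\<integral>u. cnj (H u) * H u \<partial>N) = (\<integral>z. h z * (\<integral>u. cnj (H u) * cnj (S z u) \<partial>N) \<partial>M)"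
    using pairing_adjoint[of "\<lambda>u. cnj (H u)"] H2 unfolding H_def[symmetric] by simp
  also have "ennreal (cmod \<dots>) \<le> (\<integral>\<^sup>+ z. ennreal (norm (h z * (\<integral>u. cnj (H u) * cnj (S z u) \<partial>N))) \<partial>M)"
    by (rule norm_integral_le_nn_integral)
  also have "\<dots> \<le> (\<integral>\<^sup>+ z. \<integral>\<^sup>+ w. ennreal (cmod (h z) * cmod (h w) * cmod (\<integral>u. S z u * cnj (S w u) \<partial>N)) \<partial>M \<partial>M)"
  proof (rule nn_integral_mono)
    fix z assume z: "z \<in> space M"
    note [measurable] = kernel_section_measurable[OF z]
    have S2: "(\<integral>\<^sup>+ u. ennreal ((cmod (S z u))\<^sup>2) \<partial>N) < \<infinity>"
      by (rule le_less_trans[OF SB[OF z]]) simp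
    have "(\<integral>u. cnj (H u) * cnj (S z u) \<partial>N) = cnj (\<integral>u. S z u * H u \<partial>N)"
      using Bochner_Integration.integral_cnj[of N "\<lambda>u. S z u * H u"] by (simp add: mult.commute)
    also have "(\<integral>u. S z u * H u \<partial>N) = (\<integral>w. h w * (\<integral>u. S z u * cnj (S w u) \<partial>N) \<partial>M)"
      unfolding H_def by (rule pairing_adjoint[symmetric]) (use S2 in simp_all)
    finally have "ennreal (norm (h z * (\<integral>u. cnj (H u) * cnj (S z u) \<partial>N)))
      = ennreal (cmod (h z)) * ennreal (cmod (\<integral>w. h w * (\<integral>u. S z u * cnj (S w u) \<partial>N) \<partial>M))"
      by (simp add: norm_mult ennreal_mult)
    also have "\<dots> \<le> ennreal (cmod (h z)) * (\<integral>\<^sup>+ w. ennreal (norm (h w * (\<integral>u. S z u * cnj (S w u) \<partial>N))) \<partial>M)"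
      by (intro mult_left_mono norm_integral_le_nn_integral) simp
    also have "\<dots> = (\<integral>\<^sup>+ w. ennreal (cmod (h z)) * ennreal (norm (h w * (\<integral>u. S z u * cnj (S w u) \<partial>N))) \<partial>M)"
    proof (rule nn_integral_cmult[symmetric])
      interpret N: sigma_finite_measure N by (rule sig)
      have "(\<lambda>(w, u). S z u * cnj (S w u)) \<in> borel_measurable (M \<Otimes>\<^sub>M N)" by measurable
      then have [measurable]: "(\<lambda>w. \<integral>u. S z u * cnj (S w u) \<partial>N) \<in> borel_measurable M"
        by (rule N.borel_measurable_lebesgue_integral)
      show "(\<lambda>w. ennreal (norm (h w * (\<integral>u. S z u * cnj (S w u) \<partial>N)))) \<in> borel_measurable M" by measurable
    qed
    also have "\<dots> = (\<integral>\<^sup>+ w. ennreal (cmod (h z) * cmod (h w) * cmod (\<integral>u. S z u * cnj (S w u) \<partial>N)) \<partial>M)"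
      by (simp add: norm_mult ennreal_mult[symmetric] mult.assoc)
    finally show "ennreal (norm (h z * (\<integral>u. cnj (H u) * cnj (S z u) \<partial>N)))
      \<le> (\<integral>\<^sup>+ w. ennreal (cmod (h z) * cmod (h w) * cmod (\<integral>u. S z u * cnj (S w u) \<partial>N)) \<partial>M)" .
  qed
  finally show ?thesis unfolding H_def .
qed

text \<open>
  Cauchy-Schwarz for \<open>\<langle>T g, h\<rangle> = \<langle>g, T\<^sup>* h\<rangle>\<close>.
\<close>

lemma TT_star:
  assumes g [measurable]: "g \<in> borel_measurable N" and g2: "(\<integral>\<^sup>+ u. ennreal ((cmod (g u))\<^sup>2) \<partial>N) < \<infinity>"
  shows "ennreal ((cmod (\<integral>z. h z * (\<integral>u. g u * cnj (S z u) \<partial>N) \<partial>M))\<^sup>2)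
    \<le> (\<integral>\<^sup>+ u. ennreal ((cmod (g u))\<^sup>2) \<partial>N) *
      (\<integral>\<^sup>+ z. \<integral>\<^sup>+ w. ennreal (cmod (h z) * cmod (h w) * cmod (\<integral>u. S z u * cnj (S w u) \<partial>N)) \<partial>M \<partial>M)"
proof -
  let ?H = "\<lambda>u. \<integral>z. h z * cnj (S z u) \<partial>M"
  note [measurable] = adjoint_measurable
  have "ennreal (cmod (\<integral>z. h z * (\<integral>u. g u * cnj (S z u) \<partial>N) \<partial>M)) \<le> (\<integral>\<^sup>+ u. ennreal (norm (g u * ?H u)) \<partial>N)"
    unfolding pairing_adjoint[OF g g2] by (rule norm_integral_le_nn_integral)
  also have "\<dots> = (\<integral>\<^sup>+ u. ennreal (cmod (g u)) * ennreal (cmod (?H u)) \<partial>N)"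
    by (simp add: norm_mult ennreal_mult)
  finally have "(ennreal (cmod (\<integral>z. h z * (\<integral>u. g u * cnj (S z u) \<partial>N) \<partial>M)))\<^sup>2
    \<le> (\<integral>\<^sup>+ u. ennreal (cmod (g u)) * ennreal (cmod (?H u)) \<partial>N)\<^sup>2" by (rule power_mono) simp
  also have "\<dots> \<le> (\<integral>\<^sup>+ u. (ennreal (cmod (g u)))\<^sup>2 \<partial>N) * (\<integral>\<^sup>+ u. (ennreal (cmod (?H u)))\<^sup>2 \<partial>N)"
    by (rule Cauchy_Schwarz_nn_integral) measurable
  also have "\<dots> \<le> (\<integral>\<^sup>+ u. ennreal ((cmod (g u))\<^sup>2) \<partial>N) *
      (\<integral>\<^sup>+ z. \<integral>\<^sup>+ w. ennreal (cmod (h z) * cmod (h w) * cmod (\<integral>u. S z u * cnj (S w u) \<partial>N)) \<partial>M \<partial>M)"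
    using adjoint_norm_le by (intro mult_mono) (simp_all add: ennreal_power)
  finally show ?thesis by (simp add: ennreal_power)
qed

end

section \<open>The embedding\<close>

text \<open>
  The left side is \<open>M\<^bsup>1-2/p\<^esup> X\<^bsup>2/p\<^esup> Y\<^bsup>1-2/p\<^esup>\<close> for the two terms \<open>X\<close> and \<open>Y\<close> on the right. It interpolates, pointwise,
  between the \<open>L\<^sup>2\<close> bound for the kernel \<open>\<kappa>\<^bsup>p/2\<^esup>\<close> and the trivial bound of a bounded kernel from \<open>L\<^sup>1\<close> to \<open>L\<^sup>\<infinity>\<close>.
\<close>

lemma interpolation_inequality:
  fixes \<kappa> x y M p :: real
  assumes nn: "0 \<le> \<kappa>" "0 \<le> x" "0 \<le> y" and M: "0 < M" and p: "2 \<le> p"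
  shows "\<kappa> * x powr (p - 1) * y powr (p - 1)
    \<le> M powr (1 - 2 / p) * (\<kappa> powr (p / 2) * (x powr (p / 2) * y powr (p / 2)) + x powr p * y powr p / M)"
proof (cases "\<kappa> = 0 \<or> x = 0 \<or> y = 0")
  case True
  then have "\<kappa> * x powr (p - 1) * y powr (p - 1) = 0" by auto
  moreover have "0 \<le> M powr (1 - 2 / p) * (\<kappa> powr (p / 2) * (x powr (p / 2) * y powr (p / 2)) + x powr p * y powr p / M)"
    using M by simp
  ultimately show ?thesis by linarith
next
  case False
  then have pos: "0 < \<kappa>" "0 < x" "0 < y" using nn by auto
  define X where "X = \<kappa> powr (p / 2) * (x powr (p / 2) * y powr (p / 2))"
  define Y where "Y = x powr p * y powr p / M"
  have XY: "0 < X" "0 < Y" using pos M by (auto simp: X_def Y_def)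
  define A where "A = max X Y"
  have A: "0 < A" "X \<le> A" "Y \<le> A" "A \<le> X + Y" using XY by (auto simp: A_def)
  have "\<kappa> * x powr (p - 1) * y powr (p - 1) = M powr (1 - 2 / p) * (X powr (2 / p) * Y powr (1 - 2 / p))"
  proof -
    have p0: "p \<noteq> 0" using p by simp
    have lX: "ln X = p / 2 * (ln \<kappa> + ln x + ln y)" using pos by (simp add: X_def ln_mult ln_powr algebra_simps)
    have lY: "ln Y = p * (ln x + ln y) - ln M" using pos M by (simp add: Y_def ln_mult ln_div ln_powr algebra_simps)
    have "ln (\<kappa> * x powr (p - 1) * y powr (p - 1)) = ln \<kappa> + (p - 1) * ln x + (p - 1) * ln y"
      using pos by (simp add: ln_mult ln_powr)
    also have "\<dots> = (1 - 2 / p) * ln M + (2 / p * ln X + (1 - 2 / p) * ln Y)"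
      unfolding lX lY using p0 by (simp add: field_simps)
    also have "\<dots> = ln (M powr (1 - 2 / p) * (X powr (2 / p) * Y powr (1 - 2 / p)))"
      using M XY by (simp add: ln_mult ln_powr)
    finally show ?thesis
      using pos M XY by (subst (asm) ln_inj_iff) auto
  qed
  also have "\<dots> \<le> M powr (1 - 2 / p) * (A powr (2 / p) * A powr (1 - 2 / p))"
    using A XY p by (intro mult_left_mono mult_mono powr_mono2) auto
  also have "A powr (2 / p) * A powr (1 - 2 / p) = A" using A by (simp add: powr_add[symmetric])
  also have "M powr (1 - 2 / p) * A \<le> M powr (1 - 2 / p) * (X + Y)" using A by (intro mult_left_mono) auto
  finally show ?thesis by (simp only: X_def Y_def)
qed

lemma norm_tube_det_minus: "cmod (tube_det (re_im_vec (u - x) y)) = cmod (tube_det (re_im_vec (x - u) y))"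
proof -
  have "lorentz_det (u - x) = lorentz_det (x - u)"
    by (simp add: lorentz_det_eq_form lorentz_form_bilinear)
  moreover have "lorentz_form (u - x) y = - lorentz_form (x - u) y"
    by (simp add: lorentz_form_bilinear)
  ultimately show ?thesis by (simp add: tube_det_re_im cmod_def)
qed

lemma holomorphic_vec_on_translate:
  assumes f: "holomorphic_vec_on f S" and b: "\<And>z. z \<in> T \<Longrightarrow> z + b \<in> S"
  shows "holomorphic_vec_on (\<lambda>w. f (w + b)) T"
  unfolding holomorphic_vec_on_def
proof
  fix z assume "z \<in> T"
  then obtain D where D: "(f has_derivative D) (at (z + b))" "\<And>c v. D (c *s v) = c * D v"
    using f b unfolding holomorphic_vec_on_def by blast
  have "((\<lambda>w. w + b) has_derivative (\<lambda>v. v)) (at z)" by (auto intro!: derivative_eq_intros)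
  then have "((\<lambda>w. f (w + b)) has_derivative D) (at z)"
    by (rule has_derivative_compose) (rule D(1))
  then show "\<exists>D. ((\<lambda>w. f (w + b)) has_derivative D) (at z) \<and> (\<forall>c v. D (c *s v) = c * D v)"
    using D(2) by blast
qed

text \<open>
  The estimate for \<open>f(\<cdot> + i \<epsilon> e)\<close> on a set \<open>E\<close> of finite invariant measure, with a constant independent of \<open>\<epsilon>\<close> and
  \<open>E\<close>. The truncation makes \<open>m = \<integral>\<^sub>E F\<^sup>p d\<mu>\<close> finite, where \<open>F = \<Delta>\<^bsup>n/4\<^esup> \<bar>f\<bar>\<close> for the shifted function. Testing against
  the extremal \<open>h\<close>, for which \<open>f h = F\<^sup>p\<close>, the inequality for \<open>T T\<^sup>*\<close> gives
  \<open>m\<^sup>2 \<le> const \<cdot> \<parallel>f\<parallel>\<^sup>2 \<integral>\<integral> \<kappa> F\<^bsup>p-1\<^esup> F\<^bsup>p-1\<^esup>\<close>. Interpolation and the Schur test bound the double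
  integral by \<open>const \<cdot> m\<^bsup>2-2/p\<^esup>\<close>, and dividing by this power of \<open>m\<close> yields \<open>m\<^bsup>2/p\<^esup> \<le> const \<cdot> \<parallel>f\<parallel>\<^sup>2\<close>.
\<close>

lemma hardy2_truncated_estimate:
  fixes f :: "(complex, 'n::{finite,one}) vec \<Rightarrow> complex" and E :: "((real,'n) vec \<times> (real,'n) vec) set"
  assumes n: "2 \<le> CARD('n)" and k: "k \<noteq> (1::'n)" and p: "4 * (real CARD('n) - 1) / real CARD('n) < p"
    and f: "f \<in> hardy2_space" and \<epsilon>: "0 < \<epsilon>" and r: "0 < r"
    and E [measurable]: "E \<in> sets (borel \<Otimes>\<^sub>M borel)"
    and Esub: "\<And>z. z \<in> E \<Longrightarrow> snd z \<in> lorentz_cone \<and> 1 / r \<le> lorentz_det (snd z) \<and> norm (fst z) \<le> r \<and> norm (snd z) \<le> r"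
  defines "C \<equiv> enn2real (tube_det_mass (real CARD('n) * p / 4) TYPE('n) * cone_const k (real CARD('n) * p / 8 - (real CARD('n) - 1) / 2))"
  shows "(\<integral>\<^sup>+ z. indicator E z * ennreal (cmod (f (re_im_vec (fst z) (snd z + \<epsilon> *\<^sub>R time_axis))) powr p
      * lorentz_det (snd z) powr (real CARD('n) * p / 4 - real CARD('n))) \<partial>(lborel \<Otimes>\<^sub>M lborel))
    \<le> ennreal (((2 * C + 1) / szego_const TYPE('n) * enn2real (hardy2_integral f)) powr (p / 2))"
proof -
  let ?n = "real CARD('n)"
  let ?L = "lborel \<Otimes>\<^sub>M lborel :: ((real,'n) vec \<times> (real,'n) vec) measure"
  define s where "s = ?n * p / 8"
  define c where "c = szego_const TYPE('n)"
  define H where "H = enn2real (hardy2_integral f)"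
  have c: "c > 0" unfolding c_def by (rule szego_const_pos[OF n])
  have n1: "?n \<ge> 2" using n by simp
  have s: "(?n - 1) / 2 < s" using p n1 by (simp add: s_def field_simps)
  have p2: "2 \<le> p"
  proof -
    have "2 \<le> 4 * (?n - 1) / ?n" using n1 by (simp add: field_simps)
    with p show ?thesis by simp
  qed
  have holo: "holomorphic_vec_on f tube_domain" and Hfin: "hardy2_integral f < \<infinity>"
    using f by (auto simp: hardy2_space_def)
  have H: "hardy2_integral f = ennreal H" unfolding H_def using Hfin by (simp add: less_top)

  define b0 :: "(complex,'n) vec" where "b0 = re_im_vec 0 (\<epsilon> *\<^sub>R time_axis)"
  have cone\<epsilon>: "\<epsilon> *\<^sub>R time_axis \<in> (lorentz_cone :: (real,'n) vec set)" using \<epsilon> by (intro lorentz_cone_scaleR) auto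
  define g where "g w = f (w + b0)" for w
  have shift: "w + b0 \<in> tube_domain" if "w \<in> tube_closure" for w
    using tube_closure_shift[OF that, of b0 1] cone\<epsilon> by (simp add: b0_def re_im_vec_in_tube)
  have gholo: "holomorphic_vec_on g tube_domain"
    unfolding g_def by (rule holomorphic_vec_on_translate[OF holo]) (auto intro: shift simp: tube_closure_def)
  have gcont: "continuous_on tube_closure g"
    unfolding g_def using shift
    by (intro continuous_on_compose2[OF holomorphic_vec_on_imp_continuous_on[OF holo]]) (auto intro!: continuous_intros)
  obtain B0 where B0: "\<And>z. z \<in> tube_closure \<Longrightarrow> cmod (g z) \<le> B0"
    using hardy2_bounded_above_height[OF f \<epsilon>] unfolding g_def b0_def by blast
  have gtube: "\<And>z. z \<in> tube_domain \<Longrightarrow> cmod (g z) \<le> B0" using B0 by (simp add: tube_closure_def)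
  have "re_im_vec 0 0 \<in> tube_closure" by (simp add: tube_closure_def)
  from order_trans[OF norm_ge_zero B0[OF this]] have B00: "0 \<le> B0" .
  have gL2: "(\<integral>\<^sup>+ u. ennreal ((cmod (g (re_im_vec u 0)))\<^sup>2) \<partial>lborel) \<le> ennreal H"
    unfolding H[symmetric] hardy2_integral_def
    by (rule SUP_upper2[OF cone\<epsilon>]) (simp add: g_def b0_def re_im_vec_add)
  then have gL2': "(\<integral>\<^sup>+ u. ennreal ((cmod (g (re_im_vec u 0)))\<^sup>2) \<partial>lborel) < \<infinity>"
    by (rule le_less_trans) simp
  have gm [measurable]: "(\<lambda>u. g (re_im_vec u 0)) \<in> borel_measurable borel"
    by (intro borel_measurable_continuous_onI continuous_on_compose2[OF gcont])
       (auto intro!: continuous_intros simp: tube_closure_def)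

  \<comment> \<open>the shifted function, extended by zero outside the tube to be measurable everywhere\<close>
  define \<phi> where "\<phi> z = indicator lorentz_cone (snd z) *\<^sub>R g (re_im_vec (fst z) (snd z))" for z
  define d where "d z = lorentz_det (snd z)" for z :: "(real,'n) vec \<times> (real,'n) vec"
  have \<phi>m [measurable]: "\<phi> \<in> borel_measurable (borel \<Otimes>\<^sub>M borel)"
    using tube_function_measurable[OF holomorphic_vec_on_imp_continuous_on[OF gholo]]
    unfolding \<phi>_def[abs_def] by (simp add: case_prod_beta')
  have dm [measurable]: "d \<in> borel_measurable (borel \<Otimes>\<^sub>M borel)" unfolding d_def[abs_def] by measurable
  have \<phi>b: "cmod (\<phi> z) \<le> B0" for z
    using B00 gtube[OF re_im_vec_in_tube, of "snd z"] by (auto simp: \<phi>_def indicator_def)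
  have dE: "0 < d z" "1 / r \<le> d z" "d z \<le> r\<^sup>2" if "z \<in> E" for z
  proof -
    show "1 / r \<le> d z" using Esub[OF that] by (simp add: d_def)
    then show "0 < d z" using r by (smt (verit) divide_pos_pos)
    have "\<bar>snd z $ 1\<bar> \<le> r" using Esub[OF that] component_le_norm_cart[of "snd z" 1] by linarith
    then have "(snd z $ 1)\<^sup>2 \<le> r\<^sup>2" using r by (simp add: abs_le_square_iff[symmetric])
    moreover have "d z \<le> (snd z $ 1)\<^sup>2" by (simp add: d_def lorentz_det_spatial_norm)
    ultimately show "d z \<le> r\<^sup>2" by linarith
  qed

  define M where "M = density ?L (\<lambda>z. indicator E z * ennreal (d z powr (- ?n)))"
  have setsM [simp, measurable_cong]: "sets M = sets (borel \<Otimes>\<^sub>M borel)"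
    unfolding M_def by (simp cong: sets_pair_measure_cong)
  have spaceM [simp]: "space M = UNIV" by (simp add: M_def space_pair_measure)
  have nnM: "(\<integral>\<^sup>+ z. G z \<partial>M) = (\<integral>\<^sup>+ z. indicator E z * ennreal (d z powr (- ?n)) * G z \<partial>?L)"
    if [measurable]: "G \<in> borel_measurable (borel \<Otimes>\<^sub>M borel)" for G
    unfolding M_def by (rule nn_integral_density) measurable
  have Mfin: "emeasure M (space M) < \<infinity>"
  proof -
    let ?Q = "cball 0 r \<times> cball 0 r :: ((real,'n) vec \<times> (real,'n) vec) set"
    have "emeasure M (space M) = (\<integral>\<^sup>+ z. 1 \<partial>M)" by simp
    also have "\<dots> = (\<integral>\<^sup>+ z. indicator E z * ennreal (d z powr (- ?n)) * 1 \<partial>?L)" by (rule nnM) simp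
    also have "\<dots> \<le> (\<integral>\<^sup>+ z. ennreal ((1 / r) powr (- ?n)) * indicator ?Q z \<partial>?L)"
    proof (rule nn_integral_mono)
      fix z :: "(real,'n) vec \<times> (real,'n) vec"
      show "indicator E z * ennreal (d z powr (- ?n)) * 1 \<le> ennreal ((1 / r) powr (- ?n)) * indicator ?Q z"
      proof (cases "z \<in> E")
        case True
        have "z \<in> ?Q" using Esub[OF True] by (cases z) simp
        moreover have "d z powr (- ?n) \<le> (1 / r) powr (- ?n)" using dE[OF True] r by (intro powr_mono2') auto
        ultimately show ?thesis using True by (simp add: ennreal_leI)
      qed simp
    qed
    also have "\<dots> = ennreal ((1 / r) powr (- ?n)) * emeasure ?L ?Q"
      by (rule nn_integral_cmult_indicator) (auto intro!: pair_measureI)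
    also have "emeasure ?L ?Q = emeasure lborel (cball (0::(real,'n) vec) r) * emeasure lborel (cball (0::(real,'n) vec) r)"
      by (rule lborel.emeasure_pair_measure_Times) auto
    also have "ennreal ((1 / r) powr (- ?n)) * \<dots> < \<infinity>"
      using emeasure_lborel_cball_finite[of "0::(real,'n) vec" r] by (simp add: ennreal_mult_less_top)
    finally show ?thesis .
  qed
  have finM: "finite_measure M" by (rule finite_measureI) (use Mfin in simp)
  interpret M: finite_measure M by (rule finM)

  define F where "F z = cmod (\<phi> z) * d z powr (?n / 4)" for z
  have Fm [measurable]: "F \<in> borel_measurable (borel \<Otimes>\<^sub>M borel)" unfolding F_def[abs_def] by measurable
  have F0: "0 \<le> F z" for z by (simp add: F_def)
  define I where "I = (\<integral>\<^sup>+ z. ennreal (F z powr p) \<partial>M)"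
  have Fp: "F z powr p = cmod (\<phi> z) powr p * d z powr (?n * p / 4)" for z
    by (simp add: F_def powr_mult powr_powr mult.commute)
  have lhs: "(\<integral>\<^sup>+ z. indicator E z * ennreal (cmod (f (re_im_vec (fst z) (snd z + \<epsilon> *\<^sub>R time_axis))) powr p
      * lorentz_det (snd z) powr (?n * p / 4 - ?n)) \<partial>?L) = I"
  proof -
    have "I = (\<integral>\<^sup>+ z. indicator E z * ennreal (d z powr (- ?n)) * ennreal (F z powr p) \<partial>?L)"
      unfolding I_def by (rule nnM) measurable
    also have "\<dots> = (\<integral>\<^sup>+ z. indicator E z * ennreal (cmod (f (re_im_vec (fst z) (snd z + \<epsilon> *\<^sub>R time_axis))) powr p
      * lorentz_det (snd z) powr (?n * p / 4 - ?n)) \<partial>?L)"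
    proof (rule nn_integral_cong)
      fix z :: "(real,'n) vec \<times> (real,'n) vec"
      show "indicator E z * ennreal (d z powr (- ?n)) * ennreal (F z powr p)
        = indicator E z * ennreal (cmod (f (re_im_vec (fst z) (snd z + \<epsilon> *\<^sub>R time_axis))) powr p * lorentz_det (snd z) powr (?n * p / 4 - ?n))"
      proof (cases "z \<in> E")
        case True
        have "\<phi> z = f (re_im_vec (fst z) (snd z + \<epsilon> *\<^sub>R time_axis))"
          using Esub[OF True] by (simp add: \<phi>_def g_def b0_def re_im_vec_add)
        moreover have "d z powr (- ?n) * (cmod (\<phi> z) powr p * d z powr (?n * p / 4)) = cmod (\<phi> z) powr p * d z powr (?n * p / 4 - ?n)"
        proof -
          have e: "d z powr (?n * p / 4 - ?n) = d z powr (?n * p / 4) * d z powr (- ?n)"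
            unfolding powr_add[symmetric] by simp
          show ?thesis unfolding e by (simp only: mult_ac)
        qed
        ultimately show ?thesis using True by (simp add: Fp ennreal_mult[symmetric] d_def)
      qed simp
    qed
    finally show ?thesis by (rule sym)
  qed
  define Fb where "Fb = B0 powr p * (r\<^sup>2) powr (?n * p / 4)"
  have "I \<le> (\<integral>\<^sup>+ z. indicator E z * ennreal (d z powr (- ?n)) * ennreal Fb \<partial>?L)"
  proof -
    have "I = (\<integral>\<^sup>+ z. indicator E z * ennreal (d z powr (- ?n)) * ennreal (F z powr p) \<partial>?L)"
      unfolding I_def by (rule nnM) measurable
    also have "\<dots> \<le> (\<integral>\<^sup>+ z. indicator E z * ennreal (d z powr (- ?n)) * ennreal Fb \<partial>?L)"
    proof (rule nn_integral_mono)
      fix z :: "(real,'n) vec \<times> (real,'n) vec"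
      show "indicator E z * ennreal (d z powr (- ?n)) * ennreal (F z powr p) \<le> indicator E z * ennreal (d z powr (- ?n)) * ennreal Fb"
      proof (cases "z \<in> E")
        case True
        have "F z powr p \<le> Fb"
          unfolding Fp Fb_def using dE[OF True] \<phi>b[of z] p2 n1
          by (intro mult_mono powr_mono2) auto
        then show ?thesis by (intro mult_left_mono ennreal_leI) auto
      qed simp
    qed
    finally show ?thesis .
  qed
  also have "\<dots> = (\<integral>\<^sup>+ z. ennreal Fb \<partial>M)" by (rule nnM[symmetric]) simp
  also have "\<dots> < \<infinity>" using Mfin by (simp add: ennreal_mult_less_top)
  finally have Ifin: "I < \<infinity>" .
  define m where "m = enn2real I"
  have Im: "I = ennreal m" and m0: "0 \<le> m" unfolding m_def using Ifin by (simp_all add: less_top)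

  have "m \<le> ((2 * C + 1) / c * H) powr (p / 2)"
  proof (cases "m = 0")
    case False
    then have mpos: "0 < m" using m0 by simp
    \<comment> \<open>the extremal multiplier: \<open>\<phi> h = F\<^sup>p\<close> and \<open>\<bar>h\<bar> = F\<^bsup>p-1\<^esup> \<Delta>\<^bsup>n/4\<^esup>\<close> on \<open>E\<close>\<close>
    define h where "h z = indicator E z *\<^sub>R (cnj (sgn (\<phi> z)) * complex_of_real (cmod (\<phi> z) powr (p - 1) * d z powr (?n * p / 4)))" for z
    have [measurable]: "h \<in> borel_measurable M"
    proof -
      have "h = (\<lambda>z. indicator E z *\<^sub>R (cnj (\<phi> z /\<^sub>R cmod (\<phi> z)) * complex_of_real (cmod (\<phi> z) powr (p - 1) * d z powr (?n * p / 4))))"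
        by (simp add: h_def fun_eq_iff sgn_div_norm)
      also have "\<dots> \<in> borel_measurable M" by measurable
      finally show ?thesis .
    qed
    have normh: "cmod (h z) = indicator E z * (F z powr (p - 1) * d z powr (?n / 4))" for z
    proof (cases "z \<in> E \<and> \<phi> z \<noteq> 0")
      case True
      have e: "?n * p / 4 = ?n / 4 * (p - 1) + ?n / 4" by (simp add: field_simps)
      have "F z powr (p - 1) * d z powr (?n / 4) = cmod (\<phi> z) powr (p - 1) * d z powr (?n * p / 4)"
        unfolding e powr_add by (simp add: F_def powr_mult powr_powr)
      then show ?thesis using True by (simp add: h_def norm_mult norm_sgn)
    next
      case False
      then show ?thesis using p2 by (auto simp: h_def F_def)
    qed
    define hB where "hB = B0 powr (p - 1) * (r\<^sup>2) powr (?n * p / 4)"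
    have hb: "cmod (h z) \<le> hB" for z
    proof (cases "z \<in> E")
      case True
      have "cmod (h z) \<le> cmod (\<phi> z) powr (p - 1) * d z powr (?n * p / 4)"
        using True by (simp add: h_def norm_mult norm_sgn)
      also have "\<dots> \<le> hB"
        unfolding hB_def using dE[OF True] \<phi>b[of z] p2 n1 by (intro mult_mono powr_mono2) auto
      finally show ?thesis .
    next
      case False
      then show ?thesis by (simp add: h_def hB_def)
    qed
    \<comment> \<open>restricting to \<open>E\<close> makes the norms of the kernels uniformly bounded\<close>
    define S where "S z u = indicator E z *\<^sub>R tube_power (- (?n / 2)) (re_im_vec (u - fst z) (snd z))" for z u
    have Sm: "case_prod S \<in> borel_measurable (M \<Otimes>\<^sub>M lborel)"
      unfolding S_def[abs_def] by measurable
    define SBd where "SBd = enn2real (tube_det_mass ?n TYPE('n) * ennreal ((1 / r) powr (- (?n / 2))))"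
    have massn: "tube_det_mass ?n TYPE('n) < \<infinity>" by (rule tube_det_mass_finite[OF n]) simp
    have SB: "(\<integral>\<^sup>+ u. ennreal ((cmod (S z u))\<^sup>2) \<partial>lborel) \<le> ennreal SBd" for z
    proof (cases "z \<in> E")
      case True
      then have "(\<integral>\<^sup>+ u. ennreal ((cmod (S z u))\<^sup>2) \<partial>lborel) = tube_det_mass ?n TYPE('n) * ennreal (d z powr (- (?n / 2)))"
        using Esub[OF True] nn_integral_tube_power_sq[of "snd z" "fst z"] by (simp add: S_def d_def)
      also have "\<dots> \<le> tube_det_mass ?n TYPE('n) * ennreal ((1 / r) powr (- (?n / 2)))"
        using dE[OF True] r by (intro mult_left_mono ennreal_leI powr_mono2') auto
      also have "\<dots> = ennreal SBd"
        unfolding SBd_def using massn by (simp add: ennreal_mult_less_top less_top[symmetric] ennreal_mult_eq_top_iff)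
      finally show ?thesis .
    qed (simp add: S_def)
    have pair: "(\<integral>u. g (re_im_vec u 0) * cnj (S z u) \<partial>lborel) = indicator E z *\<^sub>R (complex_of_real c * \<phi> z)" for z
    proof (cases "z \<in> E")
      case True
      then have "snd z \<in> lorentz_cone" using Esub by blast
      from szego_formula[OF n gholo gcont gtube gL2' this, of "fst z"] this
      show ?thesis using True by (simp add: S_def c_def \<phi>_def)
    qed (simp add: S_def)
    have int: "(\<integral>z. h z * (\<integral>u. g (re_im_vec u 0) * cnj (S z u) \<partial>lborel) \<partial>M) = complex_of_real (c * m)"
    proof -
      have "h z * (\<integral>u. g (re_im_vec u 0) * cnj (S z u) \<partial>lborel) = complex_of_real (c * (indicator E z * F z powr p))" for z
      proof (cases "z \<in> E \<and> \<phi> z \<noteq> 0")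
        case True
        have "cnj (sgn (\<phi> z)) * \<phi> z = complex_of_real (cmod (\<phi> z))"
          using True by (simp add: sgn_eq complex_norm_square[symmetric] power2_eq_square mult.commute)
        moreover have "cmod (\<phi> z) powr (p - 1) * cmod (\<phi> z) = cmod (\<phi> z) powr p"
          using True powr_add[of "cmod (\<phi> z)" "p - 1" 1] by simp
        ultimately have eqs: "cnj (sgn (\<phi> z)) * \<phi> z = complex_of_real (cmod (\<phi> z))"
          "cmod (\<phi> z) powr p = cmod (\<phi> z) powr (p - 1) * cmod (\<phi> z)" by simp_all
        have "cnj (sgn (\<phi> z)) * complex_of_real (cmod (\<phi> z) powr (p - 1) * d z powr (?n * p / 4)) * (complex_of_real c * \<phi> z)
          = complex_of_real c * complex_of_real (cmod (\<phi> z) powr (p - 1) * d z powr (?n * p / 4)) * (cnj (sgn (\<phi> z)) * \<phi> z)"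
          by (simp only: mult_ac)
        also have "\<dots> = complex_of_real (c * (cmod (\<phi> z) powr p * d z powr (?n * p / 4)))"
          unfolding eqs by (simp only: of_real_mult[symmetric] mult_ac)
        finally have "cnj (sgn (\<phi> z)) * complex_of_real (cmod (\<phi> z) powr (p - 1) * d z powr (?n * p / 4)) * (complex_of_real c * \<phi> z)
          = complex_of_real (c * (cmod (\<phi> z) powr p * d z powr (?n * p / 4)))" .
        then show ?thesis using True by (simp add: h_def pair Fp)
      next
        case False
        then show ?thesis using p2 by (auto simp: pair h_def Fp)
      qed
      then have "(\<integral>z. h z * (\<integral>u. g (re_im_vec u 0) * cnj (S z u) \<partial>lborel) \<partial>M)
        = (\<integral>z. complex_of_real (c * (indicator E z * F z powr p)) \<partial>M)"
        by (simp only:)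
      also have "\<dots> = complex_of_real (\<integral>z. c * (indicator E z * F z powr p) \<partial>M)"
        by (rule integral_complex_of_real)
      also have "(\<integral>z. c * (indicator E z * F z powr p) \<partial>M) = c * (\<integral>z. indicator E z * F z powr p \<partial>M)"
        by (rule integral_mult_right_zero)
      also have "(\<integral>z. indicator E z * F z powr p \<partial>M) = enn2real (\<integral>\<^sup>+ z. ennreal (indicator E z * F z powr p) \<partial>M)"
        by (rule integral_eq_nn_integral) auto
      also have "(\<integral>\<^sup>+ z. ennreal (indicator E z * F z powr p) \<partial>M) = I"
        unfolding I_def by (subst (1 2) nnM) (auto intro!: nn_integral_cong simp: indicator_def)
      finally show ?thesis by (simp add: m_def)
    qed
    \<comment> \<open>the kernel \<open>\<kappa>\<^bsup>p/2\<^esup>\<close>, restricted to \<open>E\<close>\<close>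
    define kk where "kk z w = indicator E z * (indicator E w * ennreal (d z powr s * d w powr s
        * cmod (tube_det (re_im_vec (fst z - fst w) (snd z + snd w))) powr (- 2 * s)))" for z w
    \<comment> \<open>the value 1 outside the tube only serves to keep the weight positive\<close>
    define wt where "wt z = (if snd z \<in> lorentz_cone then schur_weight k (snd z) else 1)" for z :: "(real,'n) vec \<times> (real,'n) vec"
    define Ce where "Ce = tube_det_mass (2 * s) TYPE('n) * cone_const k (s - (?n - 1) / 2)"
    have Ce: "Ce = ennreal C" "0 \<le> C"
    proof -
      have "Ce < \<infinity>"
        using tube_det_mass_finite[OF n, of "2 * s"] cone_const_finite[OF k, of "s - (?n - 1) / 2"] s
        by (simp add: Ce_def ennreal_mult_less_top)
      moreover have s2: "2 * s = ?n * p / 4" by (simp add: s_def)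
      have "C = enn2real Ce" unfolding C_def Ce_def s2 unfolding s_def ..
      ultimately show "Ce = ennreal C" "0 \<le> C" by (simp_all add: less_top)
    qed
    have schur: "(\<integral>\<^sup>+ z. \<integral>\<^sup>+ w. kk z w * ennreal (F z powr (p / 2) * F w powr (p / 2)) \<partial>M \<partial>M) \<le> 2 * Ce * (\<integral>\<^sup>+ z. ennreal ((F z powr (p / 2))\<^sup>2) \<partial>M)"
    proof (rule schur_test[where w = wt])
      show "sigma_finite_measure M" ..
      show "case_prod kk \<in> borel_measurable (M \<Otimes>\<^sub>M M)" unfolding kk_def[abs_def] by measurable
      show "(\<lambda>z. F z powr (p / 2)) \<in> borel_measurable M" by measurable
      show wtm: "wt \<in> borel_measurable M" unfolding wt_def[abs_def] by measurable
      show "kk z w = kk w z" for z w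
        unfolding kk_def norm_tube_det_minus[of "fst z" "fst w"] by (simp only: mult_ac add.commute)
      show wt0: "0 < wt z" for z by (simp add: wt_def schur_weight_pos[OF k])
      show "0 \<le> F z powr (p / 2)" for z by simp
      fix z :: "(real,'n) vec \<times> (real,'n) vec"
      show "(\<integral>\<^sup>+ w. kk z w * ennreal (wt w) \<partial>M) \<le> Ce * ennreal (wt z)"
      proof (cases "z \<in> E")
        case True
        then have zc: "snd z \<in> lorentz_cone" using Esub by blast
        let ?K = "\<lambda>u v. indicator lorentz_cone v * ennreal (lorentz_det (snd z) powr s * lorentz_det v powr s
          * cmod (tube_det (re_im_vec (fst z - u) (snd z + v))) powr (- 2 * s) * schur_weight k v * lorentz_det v powr (- ?n))"
        have km: "(\<lambda>w. kk z w * ennreal (wt w)) \<in> borel_measurable (borel \<Otimes>\<^sub>M borel)"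
          unfolding kk_def wt_def by measurable
        have "(\<integral>\<^sup>+ w. kk z w * ennreal (wt w) \<partial>M) = (\<integral>\<^sup>+ w. indicator E w * ennreal (d w powr (- ?n)) * (kk z w * ennreal (wt w)) \<partial>?L)"
          by (rule nnM[OF km])
        also have "\<dots> \<le> (\<integral>\<^sup>+ w. ?K (fst w) (snd w) \<partial>?L)"
        proof (rule nn_integral_mono)
          fix w :: "(real,'n) vec \<times> (real,'n) vec"
          show "indicator E w * ennreal (d w powr (- ?n)) * (kk z w * ennreal (wt w)) \<le> ?K (fst w) (snd w)"
          proof (cases "w \<in> E")
            case w: True
            then have wc: "snd w \<in> lorentz_cone" using Esub by blast
            have "schur_weight k (snd w) \<ge> 0" using schur_weight_pos[OF k wc] by simp
            then show ?thesis using True w wc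
              by (simp add: kk_def wt_def d_def ennreal_mult[symmetric] mult_ac)
          qed simp
        qed
        also have "\<dots> = (\<integral>\<^sup>+ v. \<integral>\<^sup>+ u. ?K u v \<partial>lborel \<partial>lborel)"
          by (subst lborel_pair.nn_integral_snd[symmetric]) simp_all
        also have "\<dots> = Ce * ennreal (schur_weight k (snd z))"
          unfolding Ce_def by (rule schur_test_integral[OF n k s zc])
        finally show ?thesis using zc by (simp add: wt_def)
      qed (simp add: kk_def)
    qed
    have sq: "(F z powr (p / 2))\<^sup>2 = F z powr p" for z by (simp add: power2_eq_square powr_add[symmetric])
    have "ennreal ((c * m)\<^sup>2) = ennreal ((cmod (\<integral>z. h z * (\<integral>u. g (re_im_vec u 0) * cnj (S z u) \<partial>lborel) \<partial>M))\<^sup>2)"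
      unfolding int norm_of_real by simp
    also have "\<dots> \<le> (\<integral>\<^sup>+ u. ennreal ((cmod (g (re_im_vec u 0)))\<^sup>2) \<partial>lborel) *
      (\<integral>\<^sup>+ z. \<integral>\<^sup>+ w. ennreal (cmod (h z) * cmod (h w) * cmod (\<integral>u. S z u * cnj (S w u) \<partial>lborel)) \<partial>M \<partial>M)"
      by (rule TT_star[OF finM sigma_finite_lborel Sm _ hb SB _ gL2']) measurable
    also have "\<dots> \<le> ennreal H * (ennreal (c * m powr (1 - 2 / p)) * (2 * Ce * ennreal m + ennreal m))"
    proof (rule mult_mono[OF gL2])
      have "(\<integral>\<^sup>+ z. \<integral>\<^sup>+ w. ennreal (cmod (h z) * cmod (h w) * cmod (\<integral>u. S z u * cnj (S w u) \<partial>lborel)) \<partial>M \<partial>M)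
        \<le> (\<integral>\<^sup>+ z. \<integral>\<^sup>+ w. ennreal (c * m powr (1 - 2 / p)) * (kk z w * ennreal (F z powr (p / 2) * F w powr (p / 2)) + ennreal (F z powr p * F w powr p / m)) \<partial>M \<partial>M)"
      proof (rule nn_integral_mono, rule nn_integral_mono)
        fix z w :: "(real,'n) vec \<times> (real,'n) vec"
        show "ennreal (cmod (h z) * cmod (h w) * cmod (\<integral>u. S z u * cnj (S w u) \<partial>lborel))
          \<le> ennreal (c * m powr (1 - 2 / p)) * (kk z w * ennreal (F z powr (p / 2) * F w powr (p / 2)) + ennreal (F z powr p * F w powr p / m))"
        proof (cases "z \<in> E \<and> w \<in> E")
          case True
          then have zE: "z \<in> E" and wE: "w \<in> E" by auto
          have zc: "snd z \<in> lorentz_cone" "snd w \<in> lorentz_cone" using Esub zE wE by auto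
          define t where "t = cmod (tube_det (re_im_vec (fst z - fst w) (snd z + snd w)))"
          define \<kappa> where "\<kappa> = d z powr (?n / 4) * d w powr (?n / 4) * t powr (- (?n / 2))"
          have "(\<integral>u. S z u * cnj (S w u) \<partial>lborel) = complex_of_real c * tube_power (- (?n / 2)) (re_im_vec (fst w - fst z) (snd w + snd z))"
            using szego_kernel_reproducing[OF n zc(2) zc(1), of "fst z" "fst w"] True by (simp add: S_def c_def)
          then have "cmod (\<integral>u. S z u * cnj (S w u) \<partial>lborel) = c * t powr (- (?n / 2))"
            using c by (simp add: norm_mult norm_tube_power t_def norm_tube_det_minus[of "fst w" "fst z"] add.commute)
          then have "cmod (h z) * cmod (h w) * cmod (\<integral>u. S z u * cnj (S w u) \<partial>lborel)
            = c * (\<kappa> * F z powr (p - 1) * F w powr (p - 1))"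
            using True by (simp add: normh \<kappa>_def)
          also have "\<dots> \<le> c * (m powr (1 - 2 / p) * (\<kappa> powr (p / 2) * (F z powr (p / 2) * F w powr (p / 2)) + F z powr p * F w powr p / m))"
            using c by (intro mult_left_mono interpolation_inequality F0 mpos p2) (auto simp: \<kappa>_def)
          also have "\<kappa> powr (p / 2) = d z powr s * d w powr s * t powr (- 2 * s)"
          proof -
            have e: "?n / 4 * (p / 2) = s" "- (?n / 2) * (p / 2) = - 2 * s" by (simp_all add: s_def)
            show ?thesis unfolding \<kappa>_def powr_mult powr_powr e ..
          qed
          finally have "cmod (h z) * cmod (h w) * cmod (\<integral>u. S z u * cnj (S w u) \<partial>lborel)
            \<le> (c * m powr (1 - 2 / p)) * (d z powr s * d w powr s * t powr (- 2 * s) * (F z powr (p / 2) * F w powr (p / 2)) + F z powr p * F w powr p / m)"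
            by (simp only: mult.assoc)
          from ennreal_leI[OF this] show ?thesis
            using True c mpos by (simp add: kk_def t_def ennreal_mult ennreal_plus)
        next
          case False
          then show ?thesis by (auto simp: h_def)
        qed
      qed
      also have "\<dots> = ennreal (c * m powr (1 - 2 / p)) * (\<integral>\<^sup>+ z. \<integral>\<^sup>+ w. kk z w * ennreal (F z powr (p / 2) * F w powr (p / 2)) + ennreal (F z powr p * F w powr p / m) \<partial>M \<partial>M)"
        unfolding kk_def by (subst nn_integral_cmult[symmetric], measurable, rule nn_integral_cong, rule nn_integral_cmult) measurable
      also have "(\<integral>\<^sup>+ z. \<integral>\<^sup>+ w. kk z w * ennreal (F z powr (p / 2) * F w powr (p / 2)) + ennreal (F z powr p * F w powr p / m) \<partial>M \<partial>M)
        = (\<integral>\<^sup>+ z. (\<integral>\<^sup>+ w. kk z w * ennreal (F z powr (p / 2) * F w powr (p / 2)) \<partial>M) + (\<integral>\<^sup>+ w. ennreal (F z powr p * F w powr p / m) \<partial>M) \<partial>M)"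
        unfolding kk_def by (rule nn_integral_cong, rule nn_integral_add) measurable
      also have "\<dots> = (\<integral>\<^sup>+ z. \<integral>\<^sup>+ w. kk z w * ennreal (F z powr (p / 2) * F w powr (p / 2)) \<partial>M \<partial>M) + (\<integral>\<^sup>+ z. \<integral>\<^sup>+ w. ennreal (F z powr p * F w powr p / m) \<partial>M \<partial>M)"
        unfolding kk_def by (rule nn_integral_add) measurable
      also have "(\<integral>\<^sup>+ z. \<integral>\<^sup>+ w. ennreal (F z powr p * F w powr p / m) \<partial>M \<partial>M) = ennreal m"
      proof -
        have "(\<integral>\<^sup>+ w. ennreal (F z powr p * F w powr p / m) \<partial>M) = ennreal (F z powr p)" for z
        proof -
          have "(\<integral>\<^sup>+ w. ennreal (F z powr p * F w powr p / m) \<partial>M) = (\<integral>\<^sup>+ w. ennreal (F z powr p / m) * ennreal (F w powr p) \<partial>M)"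
            using mpos by (intro nn_integral_cong) (simp add: ennreal_mult[symmetric])
          also have "\<dots> = ennreal (F z powr p / m) * I" unfolding I_def by (rule nn_integral_cmult) measurable
          also have "\<dots> = ennreal (F z powr p)" unfolding Im using mpos by (subst ennreal_mult[symmetric]) auto
          finally show ?thesis .
        qed
        then show ?thesis using Im by (simp add: I_def)
      qed
      also have "ennreal (c * m powr (1 - 2 / p)) * ((\<integral>\<^sup>+ z. \<integral>\<^sup>+ w. kk z w * ennreal (F z powr (p / 2) * F w powr (p / 2)) \<partial>M \<partial>M) + ennreal m)
        \<le> ennreal (c * m powr (1 - 2 / p)) * (2 * Ce * ennreal m + ennreal m)"
        using schur unfolding sq I_def[symmetric] Im by (intro mult_left_mono add_right_mono) auto
      finally show "(\<integral>\<^sup>+ z. \<integral>\<^sup>+ w. ennreal (cmod (h z) * cmod (h w) * cmod (\<integral>u. S z u * cnj (S w u) \<partial>lborel)) \<partial>M \<partial>M)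
        \<le> ennreal (c * m powr (1 - 2 / p)) * (2 * Ce * ennreal m + ennreal m)" .
    qed auto
    also have "\<dots> = ennreal (H * (c * m powr (1 - 2 / p) * ((2 * C + 1) * m)))"
    proof -
      have "2 * Ce * ennreal m + ennreal m = ennreal ((2 * C + 1) * m)"
        using Ce m0 by (simp add: distrib_right ennreal_plus ennreal_mult)
      moreover have "0 \<le> H" by (simp add: H_def)
      ultimately show ?thesis using c m0 Ce by (simp add: ennreal_mult)
    qed
    finally have "(c * m)\<^sup>2 \<le> H * (c * m powr (1 - 2 / p) * ((2 * C + 1) * m))"
      using Ce c m0 by (subst (asm) ennreal_le_iff) (auto simp: H_def)
    then have "c * (c * m * m) \<le> c * (m * (H * m powr (1 - 2 / p) * (2 * C + 1)))"
      by (simp add: power2_eq_square mult_ac)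
    then have "m * (c * m) \<le> m * (H * m powr (1 - 2 / p) * (2 * C + 1))" using c by (simp add: mult_ac)
    then have "c * m \<le> H * m powr (1 - 2 / p) * (2 * C + 1)" using mpos by simp
    moreover have "m powr (1 - 2 / p) * m powr (2 / p) = m" using mpos by (simp add: powr_add[symmetric])
    ultimately have "m powr (1 - 2 / p) * (c * m powr (2 / p)) \<le> m powr (1 - 2 / p) * (H * (2 * C + 1))"
      by (simp add: mult_ac)
    then have "c * m powr (2 / p) \<le> H * (2 * C + 1)" using mpos by simp
    then have le: "m powr (2 / p) \<le> (2 * C + 1) / c * H" using c by (simp add: field_simps)
    have "m = (m powr (2 / p)) powr (p / 2)" using mpos p2 by (simp add: powr_powr)
    also have "\<dots> \<le> ((2 * C + 1) / c * H) powr (p / 2)" using le p2 by (intro powr_mono2) auto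
    finally show ?thesis .
  qed simp
  then show ?thesis unfolding lhs Im c_def H_def by (rule ennreal_leI)
qed

text \<open>
  Let \<open>\<epsilon> = 1 / r\<close> tend to \<open>0\<close> while the truncation sets exhaust the tube, and apply Fatou's lemma.
\<close>

theorem hardy2_bergman_estimate:
  fixes f :: "(complex, 'n::{finite,one}) vec \<Rightarrow> complex"
  assumes n: "2 \<le> CARD('n)" and k: "k \<noteq> (1::'n)" and p: "4 * (real CARD('n) - 1) / real CARD('n) < p"
    and f: "f \<in> hardy2_space"
  defines "C \<equiv> enn2real (tube_det_mass (real CARD('n) * p / 4) TYPE('n) * cone_const k (real CARD('n) * p / 8 - (real CARD('n) - 1) / 2))"
  shows "bergman_integral p (real CARD('n) * p / 4 - real CARD('n) / 2) f
    \<le> ennreal (((2 * C + 1) / szego_const TYPE('n) * enn2real (hardy2_integral f)) powr (p / 2))"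
    (is "_ \<le> ?K")
proof -
  let ?n = "real CARD('n)"
  let ?L = "lborel \<Otimes>\<^sub>M lborel :: ((real,'n) vec \<times> (real,'n) vec) measure"
  have holo: "holomorphic_vec_on f tube_domain" using f by (simp add: hardy2_space_def)
  have p0: "0 < p"
  proof -
    have "0 < 4 * (?n - 1) / ?n" using n by simp
    with p show ?thesis by linarith
  qed
  \<comment> \<open>\<open>r\<close> is both the size of the truncation and the inverse of the shift\<close>
  define r where "r j = real (Suc j)" for j
  have r: "0 < r j" for j by (simp add: r_def)
  define E :: "nat \<Rightarrow> ((real,'n) vec \<times> (real,'n) vec) set" where
    "E j = {z. snd z \<in> lorentz_cone \<and> 1 / r j \<le> lorentz_det (snd z) \<and> norm (fst z) \<le> r j \<and> norm (snd z) \<le> r j}" for j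
  have E [measurable]: "E j \<in> sets (borel \<Otimes>\<^sub>M borel)" for j
  proof -
    have "Measurable.pred (borel \<Otimes>\<^sub>M borel) (\<lambda>z. snd z \<in> (lorentz_cone::(real,'n) vec set) \<and> 1 / r j \<le> lorentz_det (snd z) \<and> norm (fst z :: (real,'n) vec) \<le> r j \<and> norm (snd z) \<le> r j)"
      by measurable
    then show ?thesis unfolding E_def by (simp add: pred_def space_pair_measure)
  qed
  define G where "G j z = indicator (E j) z * ennreal (cmod (f (re_im_vec (fst z) (snd z + (1 / r j) *\<^sub>R time_axis))) powr p
      * lorentz_det (snd z) powr (?n * p / 4 - ?n))" for j z
  have Gm: "G j \<in> borel_measurable ?L" for j
  proof -
    let ?b = "re_im_vec 0 ((1 / r j) *\<^sub>R time_axis) :: (complex,'n) vec"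
    have cone: "(1 / r j) *\<^sub>R time_axis \<in> (lorentz_cone :: (real,'n) vec set)"
      using r[of j] by (intro lorentz_cone_scaleR) auto
    have "z + ?b \<in> tube_domain" if "z \<in> tube_domain" for z
      using tube_closure_shift[of z ?b 1] that cone by (simp add: tube_closure_def re_im_vec_in_tube)
    then have "holomorphic_vec_on (\<lambda>w. f (w + ?b)) tube_domain" by (rule holomorphic_vec_on_translate[OF holo])
    from tube_function_measurable[OF holomorphic_vec_on_imp_continuous_on[OF this]]
    have [measurable]: "(\<lambda>z. indicator lorentz_cone (snd z) *\<^sub>R f (re_im_vec (fst z) (snd z) + ?b)) \<in> borel_measurable (borel \<Otimes>\<^sub>M borel)"
      by (simp add: case_prod_beta')
    have "G j = (\<lambda>z. indicator (E j) z * ennreal (cmod (indicator lorentz_cone (snd z) *\<^sub>R f (re_im_vec (fst z) (snd z) + ?b)) powr p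
      * lorentz_det (snd z) powr (?n * p / 4 - ?n)))"
      by (auto simp: G_def fun_eq_iff re_im_vec_add E_def indicator_def)
    also have "\<dots> \<in> borel_measurable ?L" by measurable
    finally show ?thesis .
  qed
  have bound: "(\<integral>\<^sup>+ z. G j z \<partial>?L) \<le> ?K" for j
    unfolding G_def C_def
    by (rule hardy2_truncated_estimate[OF n k p f _ r E]) (auto simp: E_def r)
  have lim: "liminf (\<lambda>j. G j z) = ennreal (cmod (f (re_im_vec (fst z) (snd z))) powr p * lorentz_det (snd z) powr (?n * p / 4 - ?n))"
    if z: "snd z \<in> lorentz_cone" for z
  proof -
    have rinf: "filterlim r at_top sequentially"
      unfolding r_def by (rule filterlim_compose[OF filterlim_real_sequentially filterlim_Suc])
    have r0: "(\<lambda>j. 1 / r j) \<longlonglongrightarrow> 0" by (rule real_tendsto_divide_at_top[OF tendsto_const rinf])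
    have "\<forall>\<^sub>F j in sequentially. 1 / r j < lorentz_det (snd z)"
      using r0 lorentz_coneD(1)[OF z] by (rule order_tendstoD(2))
    moreover have "\<forall>\<^sub>F j in sequentially. norm (fst z) \<le> r j" "\<forall>\<^sub>F j in sequentially. norm (snd z) \<le> r j"
      using rinf by (auto simp: filterlim_at_top)
    ultimately have ev: "\<forall>\<^sub>F j in sequentially. z \<in> E j"
      by eventually_elim (simp add: E_def z)
    have "(\<lambda>j. re_im_vec (fst z) (snd z + (1 / r j) *\<^sub>R time_axis)) \<longlonglongrightarrow> re_im_vec (fst z) (snd z + 0 *\<^sub>R time_axis)"
    proof (rule continuous_on_tendsto_compose[OF _ r0])
      show "continuous_on UNIV (\<lambda>t. re_im_vec (fst z) (snd z + t *\<^sub>R time_axis))"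
        by (intro continuous_intros)
    qed auto
    then have "(\<lambda>j. re_im_vec (fst z) (snd z + (1 / r j) *\<^sub>R time_axis)) \<longlonglongrightarrow> re_im_vec (fst z) (snd z)" by simp
    then have "(\<lambda>j. f (re_im_vec (fst z) (snd z + (1 / r j) *\<^sub>R time_axis))) \<longlonglongrightarrow> f (re_im_vec (fst z) (snd z))"
    proof (rule continuous_on_tendsto_compose[OF holomorphic_vec_on_imp_continuous_on[OF holo]])
      show "\<forall>\<^sub>F j in sequentially. re_im_vec (fst z) (snd z + (1 / r j) *\<^sub>R time_axis) \<in> tube_domain"
        using r by (intro always_eventually allI re_im_vec_in_tube lorentz_cone_add z lorentz_cone_scaleR) auto
    qed (rule re_im_vec_in_tube[OF z])
    then have "(\<lambda>j. cmod (f (re_im_vec (fst z) (snd z + (1 / r j) *\<^sub>R time_axis))) powr p * lorentz_det (snd z) powr (?n * p / 4 - ?n))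
       \<longlonglongrightarrow> cmod (f (re_im_vec (fst z) (snd z))) powr p * lorentz_det (snd z) powr (?n * p / 4 - ?n)"
      using p0 by (intro tendsto_mult tendsto_const tendsto_powr' tendsto_norm) auto
    then have "(\<lambda>j. ennreal (cmod (f (re_im_vec (fst z) (snd z + (1 / r j) *\<^sub>R time_axis))) powr p * lorentz_det (snd z) powr (?n * p / 4 - ?n)))
       \<longlonglongrightarrow> ennreal (cmod (f (re_im_vec (fst z) (snd z))) powr p * lorentz_det (snd z) powr (?n * p / 4 - ?n))"
      by (intro tendsto_ennrealI)
    then have "(\<lambda>j. G j z) \<longlonglongrightarrow> ennreal (cmod (f (re_im_vec (fst z) (snd z))) powr p * lorentz_det (snd z) powr (?n * p / 4 - ?n))"
    proof (rule Lim_transform_eventually)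
      show "\<forall>\<^sub>F j in sequentially. ennreal (cmod (f (re_im_vec (fst z) (snd z + (1 / r j) *\<^sub>R time_axis))) powr p * lorentz_det (snd z) powr (?n * p / 4 - ?n)) = G j z"
        using ev by eventually_elim (simp add: G_def)
    qed
    then show ?thesis by (intro lim_imp_Liminf) auto
  qed
  let ?B = "\<lambda>z::(real,'n) vec \<times> (real,'n) vec. (case z of (x, y) \<Rightarrow> ennreal (cmod (f (re_im_vec x y)) powr p * lorentz_det y powr (?n * p / 4 - ?n / 2 - ?n / 2)) * indicator (UNIV \<times> lorentz_cone) z)"
  have "bergman_integral p (?n * p / 4 - ?n / 2) f = (\<integral>\<^sup>+ z. ?B z \<partial>?L)"
    unfolding bergman_integral_def by (simp add: case_prod_beta')
  also have "\<dots> \<le> (\<integral>\<^sup>+ z. liminf (\<lambda>j. G j z) \<partial>?L)"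
  proof (rule nn_integral_mono)
    fix z :: "(real,'n) vec \<times> (real,'n) vec"
    obtain x y where z: "z = (x, y)" by (cases z)
    show "?B z \<le> liminf (\<lambda>j. G j z)"
      using lim[of z] unfolding z by (auto simp: indicator_def)
  qed
  also have "\<dots> \<le> liminf (\<lambda>j. \<integral>\<^sup>+ z. G j z \<partial>?L)" by (rule nn_integral_liminf) (rule Gm)
  also have "\<dots> \<le> ?K" by (rule Liminf_le) (use bound in auto)
  finally show ?thesis .
qed

text \<open>
  The index \<open>\<nu> = n p / 4 - n / 2\<close> is the one for which both sides scale alike. The bound on \<open>p\<close> says that
  \<open>s = n p / 8\<close> exceeds \<open>(n - 1) / 2\<close>, which is the condition of the Schur test.
\<close>

theorem hardy2_embeds_bergman:
  fixes p :: real
  assumes n: "2 \<le> CARD('n::{finite,one})" and p: "4 * (real CARD('n) - 1) / real CARD('n) < p"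
  shows "continuously_embedded (hardy2_space :: ((complex,'n) vec \<Rightarrow> complex) set) hardy2_norm
    (bergman_space p (real CARD('n) * p / 4 - real CARD('n) / 2))
    (bergman_norm p (real CARD('n) * p / 4 - real CARD('n) / 2))"
proof -
  obtain k :: 'n where k: "k \<noteq> 1" using exists_spatial_index[OF n] by blast
  have p0: "0 < p"
  proof -
    have "0 < 4 * (real CARD('n) - 1) / real CARD('n)" using n by simp
    with p show ?thesis by linarith
  qed
  let ?\<nu> = "real CARD('n) * p / 4 - real CARD('n) / 2"
  define D where "D = (2 * enn2real (tube_det_mass (real CARD('n) * p / 4) TYPE('n) * cone_const k (real CARD('n) * p / 8 - (real CARD('n) - 1) / 2)) + 1) / szego_const TYPE('n)"
  have D: "D > 0" unfolding D_def using szego_const_pos[OF n] by (intro divide_pos_pos add_nonneg_pos) auto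
  have est: "bergman_integral p ?\<nu> f \<le> ennreal ((D * enn2real (hardy2_integral f)) powr (p / 2))"
    if "f \<in> hardy2_space" for f :: "(complex,'n) vec \<Rightarrow> complex"
    unfolding D_def by (rule hardy2_bergman_estimate[OF n k p that])
  show ?thesis
    unfolding continuously_embedded_def
  proof (intro conjI exI[of _ "sqrt D"] ballI subsetI)
    show "0 < sqrt D" using D by simp
    fix f :: "(complex,'n) vec \<Rightarrow> complex" assume f: "f \<in> hardy2_space"
    have "bergman_integral p ?\<nu> f < \<infinity>" by (rule le_less_trans[OF est[OF f]]) simp
    then show "f \<in> bergman_space p ?\<nu>" using f by (simp add: bergman_space_def hardy2_space_def)
    let ?H = "enn2real (hardy2_integral f)"
    have "enn2real (bergman_integral p ?\<nu> f) \<le> (D * ?H) powr (p / 2)"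
      by (rule enn2real_leI[OF _ est[OF f]]) simp
    then have "bergman_norm p ?\<nu> f \<le> ((D * ?H) powr (p / 2)) powr (1 / p)"
      unfolding bergman_norm_def using p0 by (intro powr_mono2) auto
    also have "\<dots> = sqrt (D * ?H)" using D p0 by (simp add: powr_powr powr_half_sqrt)
    finally show "bergman_norm p ?\<nu> f \<le> sqrt D * hardy2_norm f"
      by (simp add: hardy2_norm_def real_sqrt_mult)
  qed
qed

theorem theorem1p4:
  "(\<forall>p::real. 8 / 3 < p \<and> p < 4 \<longrightarrow>
       continuously_embedded
         (hardy2_space :: (complex ^ 3 \<Rightarrow> complex) set) hardy2_norm
         (bergman_space p (3 * p / 4 - 3 / 2)) (bergman_norm p (3 * p / 4 - 3 / 2))) \<and>
     (\<forall>p::real. 3 < p \<and> p < 4 \<longrightarrow>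
       continuously_embedded
         (hardy2_space :: (complex ^ 4 \<Rightarrow> complex) set) hardy2_norm
         (bergman_space p (p - 2)) (bergman_norm p (p - 2))) \<and>
     (\<forall>p::real. 16 / 5 < p \<and> p < 4 \<longrightarrow>
       continuously_embedded
         (hardy2_space :: (complex ^ 5 \<Rightarrow> complex) set) hardy2_norm
         (bergman_space p (5 * p / 4 - 5 / 2)) (bergman_norm p (5 * p / 4 - 5 / 2))) \<and>
     (\<forall>p::real. 10 / 3 < p \<and> p < 4 \<longrightarrow>
       continuously_embedded
         (hardy2_space :: (complex ^ 6 \<Rightarrow> complex) set) hardy2_norm
         (bergman_space p (3 * p / 2 - 3)) (bergman_norm p (3 * p / 2 - 3)))"
proof (intro conjI allI impI)
  fix p :: real
  show "continuously_embedded (hardy2_space :: (complex ^ 3 \<Rightarrow> complex) set) hardy2_norm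
      (bergman_space p (3 * p / 4 - 3 / 2)) (bergman_norm p (3 * p / 4 - 3 / 2))" if "8 / 3 < p \<and> p < 4"
    using hardy2_embeds_bergman[where 'n = 3, of p] that by simp
  show "continuously_embedded (hardy2_space :: (complex ^ 4 \<Rightarrow> complex) set) hardy2_norm
      (bergman_space p (p - 2)) (bergman_norm p (p - 2))" if "3 < p \<and> p < 4"
    using hardy2_embeds_bergman[where 'n = 4, of p] that by simp
  show "continuously_embedded (hardy2_space :: (complex ^ 5 \<Rightarrow> complex) set) hardy2_norm
      (bergman_space p (5 * p / 4 - 5 / 2)) (bergman_norm p (5 * p / 4 - 5 / 2))" if "16 / 5 < p \<and> p < 4"
    using hardy2_embeds_bergman[where 'n = 5, of p] that by simp
  have e: "6 * p / 4 - 6 / 2 = 3 * p / 2 - 3" by simp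
  show "continuously_embedded (hardy2_space :: (complex ^ 6 \<Rightarrow> complex) set) hardy2_norm
      (bergman_space p (3 * p / 2 - 3)) (bergman_norm p (3 * p / 2 - 3))" if "10 / 3 < p \<and> p < 4"
    using hardy2_embeds_bergman[where 'n = 6, of p] that e by simp
qed

end
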